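(* Let $U$ be an open subset of a complex Banach space $E$, let $F$ be a complex Banach space and let $f\in\mathcal{H}^\infty(U,F)$. The following are equivalent: (1) $f\colon U\to F$ has Rosenthal range, i.e. $f(U)$ is a Rosenthal subset of $F$. (2) $T_f\colon\mathcal{G}^\infty(U)\to F$ is a Rosenthal operator. (3) There exist a complex Banach space $G$ which does not contain an isomorphic copy of $\ell_1$, a continuous linear operator $T\colon G\to F$ and a mapping $g\in\mathcal{H}^\infty(U,G)$ such that $f=T\circ g$.
   Context: $\mathcal{H}^\infty(U,F)$ is the Banach space of all bounded holomorphic mappings $f\colon U\to F$ with the supremum norm $\|f\|_\infty=\sup_{x\in U}\|f(x)\|$, and $\mathcal{H}^\infty(U)=\mathcal{H}^\infty(U,\mathbb{C})$. For $x\in U$, $\delta(x)\in\mathcal{H}^\infty(U)^*$ is the evaluation functional $\delta(x)(g)=g(x)$. $\mathcal{G}^\infty(U)$ is the norm-closed linear span of $\{\delta(x)\colon x\in U\}$ in $\mathcal{H}^\infty(U)^*$, and $\delta_U\colon U\to\mathcal{G}^\infty(U)$ is $\delta_U(x)=\delta(x)$. By Mujica's linearization theorem, $\delta_U$ is holomorphic and for each $f\in\mathcal{H}^\infty(U,F)$ there is a unique continuous linear operator $T_f\colon\mathcal{G}^\infty(U)\to F$ with $T_f\circ\delta_U=f$. A subset $A$ of a Banach space is Rosenthal (or conditionally weakly compact) if every sequence in $A$ admits a weak Cauchy subsequence. A bounded linear operator $T\colon X\to Y$ between Banach spaces is Rosenthal if the image $T(B_X)$ of the closed unit ball $B_X$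 is a Rosenthal subset of $Y$. *)

theory Defs
  imports "HOL-Analysis.Analysis" "HOL-Library.Function_Algebras"
begin

section \<open>Complex vector spaces\<close>

class scaleC =
  fixes scaleC :: "complex \<Rightarrow> 'a \<Rightarrow> 'a"  (infixr \<open>*\<^sub>C\<close> 75)

class complex_vector = scaleC + ab_group_add +
  assumes scaleC_add_right: "a *\<^sub>C (x + y) = a *\<^sub>C x + a *\<^sub>C y"
    and scaleC_add_left: "(a + b) *\<^sub>C x = a *\<^sub>C x + b *\<^sub>C x"
    and scaleC_scaleC: "a *\<^sub>C b *\<^sub>C x = (a * b) *\<^sub>C x"
    and scaleC_one: "1 *\<^sub>C x = x"

global_interpretation complex_vector: vector_space "scaleC :: complex \<Rightarrow> 'a \<Rightarrow> 'a::complex_vector"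
  by unfold_locales (simp_all add: scaleC_add_right scaleC_add_left scaleC_scaleC scaleC_one)

instantiation complex :: complex_vector
begin
definition scaleC_complex :: "complex \<Rightarrow> complex \<Rightarrow> complex"
  where "scaleC_complex a x = a * x"
instance
  by standard (simp_all add: scaleC_complex_def algebra_simps)
end

instantiation "fun" :: (type, complex_vector) complex_vector
begin
definition scaleC_fun :: "complex \<Rightarrow> ('a \<Rightarrow> 'b) \<Rightarrow> 'a \<Rightarrow> 'b"
  where "scaleC_fun a f = (\<lambda>x. a *\<^sub>C f x)"
instance
  by standard (simp_all add: scaleC_fun_def plus_fun_def scaleC_add_right scaleC_add_left
      scaleC_scaleC scaleC_one)
end


section \<open>Complex Banach spaces\<close>

text \<open>
  The spaces below depend on the set \<open>U\<close>, and one of them is existentially quantified, so they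
  cannot be types. A complex normed space is therefore given by a linear subspace of an ambient
  type of class \<open>complex_vector\<close>, which only supplies the vector operations, together with a norm
  that is meaningful on that subspace only.

  Maps defined on a subset (bounded holomorphic maps on \<open>U\<close>, linear operators on a space) are
  represented by total functions that vanish off that subset, so that equality of representatives
  is equality of maps. In particular compositions such as \<open>T \<circ> g\<close> respect the convention when
  \<open>T\<close> is linear, and spaces of maps are again subspaces of a function type.
\<close>

record 'a nspace =
  vcarrier :: "'a set"
  vnorm :: "'a \<Rightarrow> real"

text \<open>Truncated off the carrier because the locale \<open>Metric_space\<close> requires a nonnegative symmetric
  function on the whole type.\<close>

definition vdist :: "'a::complex_vector nspace \<Rightarrow> 'a \<Rightarrow> 'a \<Rightarrow> real"
  where "vdist X x y = (if x \<in> vcarrier X \<and> y \<in> vcarrier X then vnorm X (x - y) else 0)"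

definition vtopology :: "'a::complex_vector nspace \<Rightarrow> 'a topology"
  where "vtopology X = Metric_space.mtopology (vcarrier X) (vdist X)"

locale complex_normed_space =
  fixes X :: "'a::complex_vector nspace"
  assumes subspace: "complex_vector.subspace (vcarrier X)"
    and norm_eq_zero: "x \<in> vcarrier X \<Longrightarrow> vnorm X x = 0 \<longleftrightarrow> x = 0"
    and norm_scale: "x \<in> vcarrier X \<Longrightarrow> vnorm X (a *\<^sub>C x) = cmod a * vnorm X x"
    and norm_triangle: "\<lbrakk>x \<in> vcarrier X; y \<in> vcarrier X\<rbrakk> \<Longrightarrow> vnorm X (x + y) \<le> vnorm X x + vnorm X y"

locale complex_banach_space = complex_normed_space +
  assumes complete: "Metric_space.mcomplete (vcarrier X) (vdist X)"

lemma (in complex_normed_space) Metric_space_vdist: "Metric_space (vcarrier X) (vdist X)"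
proof
  have diff: "x - y \<in> vcarrier X" if "x \<in> vcarrier X" "y \<in> vcarrier X" for x y
    using complex_vector.subspace_diff[OF subspace that] .
  have minus: "vnorm X (- x) = vnorm X x" if "x \<in> vcarrier X" for x
    using norm_scale[OF that, of "-1"] by simp
  have nonneg: "0 \<le> vnorm X x" if "x \<in> vcarrier X" for x
  proof -
    have "- x \<in> vcarrier X" using complex_vector.subspace_neg[OF subspace that] .
    from norm_triangle[OF that this] minus[OF that] norm_eq_zero[of 0]
      complex_vector.subspace_0[OF subspace]
    show ?thesis by simp
  qed
  show "0 \<le> vdist X x y" for x y
    by (simp add: vdist_def nonneg diff)
  show "vdist X x y = vdist X y x" for x y
    using minus[of "x - y"] diff[of x y] by (auto simp: vdist_def)
  show "vdist X x y = 0 \<longleftrightarrow> x = y" if "x \<in> vcarrier X" "y \<in> vcarrier X" for x y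
    using that norm_eq_zero[OF diff[OF that]] by (simp add: vdist_def)
  show "vdist X x z \<le> vdist X x y + vdist X y z"
    if "x \<in> vcarrier X" "y \<in> vcarrier X" "z \<in> vcarrier X" for x y z
    using norm_triangle[OF diff[OF that(1,2)] diff[OF that(2,3)]] that by (simp add: vdist_def)
qed

definition unit_ball :: "'a nspace \<Rightarrow> 'a set"
  where "unit_ball X = {x \<in> vcarrier X. vnorm X x \<le> 1}"

definition complex_scalars :: "complex nspace"
  where "complex_scalars = \<lparr>vcarrier = UNIV, vnorm = cmod\<rparr>"

definition ell1 :: "(nat \<Rightarrow> complex) nspace"
  where "ell1 = \<lparr>vcarrier = {a. summable (\<lambda>n. cmod (a n))}, vnorm = (\<lambda>a. \<Sum>n. cmod (a n))\<rparr>"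


section \<open>Operators, duals and weak Cauchy sequences\<close>

definition operators :: "'a::complex_vector nspace \<Rightarrow> 'b::complex_vector nspace \<Rightarrow> ('a \<Rightarrow> 'b) set"
  where "operators X Y = {T.
    (\<forall>x\<in>vcarrier X. \<forall>y\<in>vcarrier X. T (x + y) = T x + T y) \<and>
    (\<forall>a. \<forall>x\<in>vcarrier X. T (a *\<^sub>C x) = a *\<^sub>C T x) \<and>
    continuous_map (vtopology X) (vtopology Y) T \<and>
    (\<forall>x. x \<notin> vcarrier X \<longrightarrow> T x = 0)}"

definition dual :: "'a::complex_vector nspace \<Rightarrow> ('a \<Rightarrow> complex) nspace"
  where "dual X = \<lparr>vcarrier = operators X complex_scalars,
    vnorm = (\<lambda>\<phi>. SUP x\<in>unit_ball X. cmod (\<phi> x))\<rparr>"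

definition weakly_Cauchy :: "'a::complex_vector nspace \<Rightarrow> (nat \<Rightarrow> 'a) \<Rightarrow> bool"
  where "weakly_Cauchy X s \<longleftrightarrow> range s \<subseteq> vcarrier X \<and>
    (\<forall>\<phi>\<in>vcarrier (dual X). Cauchy (\<lambda>n. \<phi> (s n)))"

definition rosenthal_set :: "'a::complex_vector nspace \<Rightarrow> 'a set \<Rightarrow> bool"
  where "rosenthal_set X A \<longleftrightarrow> A \<subseteq> vcarrier X \<and>
    (\<forall>s::nat \<Rightarrow> 'a. range s \<subseteq> A \<longrightarrow> (\<exists>r::nat \<Rightarrow> nat. strict_mono r \<and> weakly_Cauchy X (s \<circ> r)))"

definition rosenthal_operator ::
    "'a::complex_vector nspace \<Rightarrow> 'b::complex_vector nspace \<Rightarrow> ('a \<Rightarrow> 'b) \<Rightarrow> bool"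
  where "rosenthal_operator X Y T \<longleftrightarrow> T \<in> operators X Y \<and> rosenthal_set Y (T ` unit_ball X)"

definition contains_isomorphic_copy ::
    "'a::complex_vector nspace \<Rightarrow> 'b::complex_vector nspace \<Rightarrow> bool"
  where "contains_isomorphic_copy X Y \<longleftrightarrow>
    (\<exists>J\<in>operators Y X. embedding_map (vtopology Y) (vtopology X) J)"


section \<open>Bounded holomorphic maps and their linearization\<close>

text \<open>Holomorphy on an open set is complex Frechet differentiability at every point.\<close>

definition holomorphic_map ::
    "'a::complex_vector nspace \<Rightarrow> 'a set \<Rightarrow> 'b::complex_vector nspace \<Rightarrow> ('a \<Rightarrow> 'b) \<Rightarrow> bool"
  where "holomorphic_map E U F f \<longleftrightarrow> f ` U \<subseteq> vcarrier F \<and>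
    (\<forall>x\<in>U. \<exists>D\<in>operators E F.
      ((\<lambda>y. vnorm F (f y - f x - D (y - x)) / vnorm E (y - x)) \<longlongrightarrow> 0) (atin (vtopology E) x))"

text \<open>The \<open>0\<close> inserted into the supremum only matters for \<open>U = {}\<close>, where the space is \<open>{0}\<close>.\<close>

definition Hinf ::
    "'a::complex_vector nspace \<Rightarrow> 'a set \<Rightarrow> 'b::complex_vector nspace \<Rightarrow> ('a \<Rightarrow> 'b) nspace"
  where "Hinf E U F = \<lparr>
    vcarrier = {f. holomorphic_map E U F f \<and> (\<exists>K. \<forall>x\<in>U. vnorm F (f x) \<le> K) \<and>
                   (\<forall>x. x \<notin> U \<longrightarrow> f x = 0)},
    vnorm = (\<lambda>f. Sup (insert 0 ((\<lambda>x. vnorm F (f x)) ` U)))\<rparr>"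

text \<open>\<open>evaluation E U x\<close> is the functional \<open>\<delta>(x)\<close>. It is automatically \<open>0\<close> for \<open>x \<notin> U\<close>, since
  the elements of \<open>Hinf E U complex_scalars\<close> vanish there; so \<open>evaluation E U\<close> is itself the
  representative of \<open>\<delta>\<^sub>U\<close>.\<close>

definition evaluation :: "'a::complex_vector nspace \<Rightarrow> 'a set \<Rightarrow> 'a \<Rightarrow> ('a \<Rightarrow> complex) \<Rightarrow> complex"
  where "evaluation E U x = (\<lambda>g. if g \<in> vcarrier (Hinf E U complex_scalars) then g x else 0)"

definition Ginf :: "'a::complex_vector nspace \<Rightarrow> 'a set \<Rightarrow> (('a \<Rightarrow> complex) \<Rightarrow> complex) nspace"
  where "Ginf E U = \<lparr>
    vcarrier = vtopology (dual (Hinf E U complex_scalars)) closure_of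
                 complex_vector.span (evaluation E U ` U),
    vnorm = vnorm (dual (Hinf E U complex_scalars))\<rparr>"

text \<open>The operator \<open>T\<^sub>f\<close>, which exists uniquely by Mujica's linearization theorem.\<close>

definition linearization ::
    "'a::complex_vector nspace \<Rightarrow> 'a set \<Rightarrow> 'b::complex_vector nspace \<Rightarrow> ('a \<Rightarrow> 'b) \<Rightarrow>
      (('a \<Rightarrow> complex) \<Rightarrow> complex) \<Rightarrow> 'b"
  where "linearization E U F f =
    (THE T. T \<in> operators (Ginf E U) F \<and> (\<forall>x\<in>U. T (evaluation E U x) = f x))"

text \<open>The factorization \<open>f = T \<circ> g\<close> through a given space \<open>G\<close>. HOL cannot quantify over the type
  carrying \<open>G\<close> inside a formula. Existence is therefore asserted for a space on the type of \<open>F\<close>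
  (the interpolation space of Davis, Figiel, Johnson and Pelczynski is a linear subspace of \<open>F\<close>
  with another norm), while consequences of a factorization are asserted for \<open>G\<close> on an arbitrary
  type.\<close>

definition factors_without_ell1 ::
    "'a::complex_vector nspace \<Rightarrow> 'a set \<Rightarrow> 'b::complex_vector nspace \<Rightarrow> ('a \<Rightarrow> 'b) \<Rightarrow>
      'g::complex_vector nspace \<Rightarrow> bool"
  where "factors_without_ell1 E U F f G \<longleftrightarrow>
    complex_banach_space G \<and> \<not> contains_isomorphic_copy G ell1 \<and>
    (\<exists>T\<in>operators G F. \<exists>g\<in>vcarrier (Hinf E U G). \<forall>x\<in>U. f x = T (g x))"

end

theory Submission
  imports Defs "HOL-Complex_Analysis.Complex_Analysis"
begin

text \<open>
  The three conditions are compared through functionals. If \<open>\<phi> \<in> F\<^sup>*\<close> is bounded by \<open>s\<close> on the range of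
  \<open>f\<close>, then \<open>\<phi> \<circ> f\<close> is a bounded holomorphic function of norm at most \<open>s\<close>. As \<open>T\<^sub>f \<mu>\<close> is characterised
  by \<open>\<phi> (T\<^sub>f \<mu>) = \<mu> (\<phi> \<circ> f)\<close>, the functional \<open>\<phi>\<close> is bounded by \<open>s\<close> on the image of the unit ball
  under \<open>T\<^sub>f\<close> too. So this image lies in the closed absolutely convex hull of the range, whereas it
  contains the range because \<open>T\<^sub>f\<close> maps the evaluation at \<open>x\<close> to \<open>f x\<close>. The equivalence of (1) and (2)
  thus rests on the fact that the closed absolutely convex hull of a Rosenthal set is Rosenthal.

  That fact is proved in \<open>rosenthal_set_almost_absorbed\<close>, for sets described by functionals only, so
  that neither the hull nor a separation theorem appears. A sequence without weakly Cauchy subsequences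
  has a subsequence for which all patterns of values near two complex numbers \<open>p\<close>, \<open>q\<close> are realised by
  functionals of norm at most \<open>1\<close> (\<open>pointwise_Cauchy_or_independent\<close>). Averaging over these
  functionals gives a finitely additive mean on the dual ball together with Rademacher functions
  (\<open>rademacher_mean\<close>). Integration against the Rademacher functions defines functionals on \<open>F\<close>
  that are large at the given sequence, hence large at some points of the Rosenthal set; this
  contradicts Bessel's inequality for a weakly Cauchy sequence of such points.

  For (1) implies (3), the interpolation space \<open>interp\<close> of Davis, Figiel, Johnson and Pelczynski is
  built from the range of \<open>f\<close>. Its balls are almost absorbed by the range, hence are Rosenthal in \<open>F\<close>,
  and a gliding hump argument shows that a copy of \<open>ell1\<close> in it would produce one in \<open>F\<close> spanned by a
  weakly Cauchy sequence (\<open>interp_not_contains_ell1\<close>). The map \<open>f\<close> itself is the second factor: the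
  Cauchy estimates for the functions \<open>\<phi> \<circ> f\<close> show that it is holomorphic into this space
  (\<open>holomorphic_into_interp\<close>). Finally (3) implies (1) by Rosenthal's theorem on \<open>ell1\<close>
  (\<open>Rosenthal_ell1_dichotomy\<close>), where the patterns of values give the lower
  \<open>ell1\<close>-estimate.
\<close>

section \<open>Normed spaces and bounded operators\<close>

text \<open>
  The inequality for the scalars \<open>a\<close> and \<open>inverse a\<close> together gives equality; this reduces the
  homogeneity of each of the suprema used as norms below to an upper estimate.
\<close>

lemma homogeneous_if_subhomogeneous:
  fixes p :: "'a::complex_vector \<Rightarrow> real"
  assumes le: "\<And>a x. x \<in> V \<Longrightarrow> p (a *\<^sub>C x) \<le> cmod a * p x"
    and V: "\<And>a x. x \<in> V \<Longrightarrow> a *\<^sub>C x \<in> V" and nonneg: "\<And>x. x \<in> V \<Longrightarrow> 0 \<le> p x" and x: "x \<in> V"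
  shows "p (a *\<^sub>C x) = cmod a * p x"
proof (cases "a = 0")
  case True
  then show ?thesis using le[OF x, of 0] nonneg[OF V[OF x], of 0] by simp
next
  case False
  have "x = inverse a *\<^sub>C a *\<^sub>C x" using False by (simp add: scaleC_one)
  then have "p x \<le> cmod (inverse a) * p (a *\<^sub>C x)" using le[OF V[OF x]] by metis
  from mult_left_mono[OF this, of "cmod a"] have "cmod a * p x \<le> p (a *\<^sub>C x)"
    using False by (simp add: norm_inverse flip: mult.assoc)
  then show ?thesis using le[OF x, of a] by simp
qed

context complex_normed_space
begin

lemma zero_in [simp]: "0 \<in> vcarrier X"
  using complex_vector.subspace_0[OF subspace] .

lemma add_in: "x \<in> vcarrier X \<Longrightarrow> y \<in> vcarrier X \<Longrightarrow> x + y \<in> vcarrier X"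
  using complex_vector.subspace_add[OF subspace] .

lemma diff_in: "x \<in> vcarrier X \<Longrightarrow> y \<in> vcarrier X \<Longrightarrow> x - y \<in> vcarrier X"
  using complex_vector.subspace_diff[OF subspace] .

lemma scale_in: "x \<in> vcarrier X \<Longrightarrow> a *\<^sub>C x \<in> vcarrier X"
  using complex_vector.subspace_scale[OF subspace] .

lemma sum_in: "(\<And>i. i \<in> I \<Longrightarrow> f i \<in> vcarrier X) \<Longrightarrow> sum f I \<in> vcarrier X"
  using complex_vector.subspace_sum[OF subspace] .

lemma norm_0 [simp]: "vnorm X 0 = 0"
  by (simp add: norm_eq_zero)

lemma norm_minus: "x \<in> vcarrier X \<Longrightarrow> vnorm X (- x) = vnorm X x"
  using norm_scale[of x "-1"] by simp

lemma norm_nonneg: assumes "x \<in> vcarrier X" shows "0 \<le> vnorm X x"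
proof -
  have "- x \<in> vcarrier X" using diff_in[OF zero_in assms] by simp
  from norm_triangle[OF assms this] norm_minus[OF assms] show ?thesis by simp
qed

lemma norm_diff_triangle:
  "x \<in> vcarrier X \<Longrightarrow> y \<in> vcarrier X \<Longrightarrow> vnorm X (x - y) \<le> vnorm X x + vnorm X y"
  using norm_triangle[of x "- y"] norm_minus[of y] diff_in[of 0 y] by simp

lemma norm_diff_commute:
  "x \<in> vcarrier X \<Longrightarrow> y \<in> vcarrier X \<Longrightarrow> vnorm X (x - y) = vnorm X (y - x)"
  using norm_minus[OF diff_in[of x y]] by simp

lemma norm_sum_le:
  assumes "finite I" "\<And>i. i \<in> I \<Longrightarrow> f i \<in> vcarrier X"
  shows "vnorm X (sum f I) \<le> (\<Sum>i\<in>I. vnorm X (f i))"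
  using assms
proof (induction rule: finite_induct)
  case (insert i I)
  then show ?case
    using norm_triangle[of "f i" "sum f I"] sum_in[of I f] by force
qed simp

lemma topspace_vtopology [simp]: "topspace (vtopology X) = vcarrier X"
  unfolding vtopology_def using Metric_space.topspace_mtopology[OF Metric_space_vdist] .

lemma openin_vtopology: "openin (vtopology X) U \<longleftrightarrow> U \<subseteq> vcarrier X \<and>
    (\<forall>x\<in>U. \<exists>r>0. \<forall>y\<in>vcarrier X. vnorm X (y - x) < r \<longrightarrow> y \<in> U)"
proof -
  interpret M: Metric_space "vcarrier X" "vdist X" by (rule Metric_space_vdist)
  have "M.mball x r \<subseteq> U \<longleftrightarrow> (\<forall>y\<in>vcarrier X. vnorm X (y - x) < r \<longrightarrow> y \<in> U)"
    if "x \<in> vcarrier X" for x r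
    using that by (auto simp: M.mball_def vdist_def norm_diff_commute)
  then show ?thesis
    unfolding vtopology_def M.openin_mtopology by (metis subsetD)
qed

lemma closure_of_vtopology:
  assumes "S \<subseteq> vcarrier X"
  shows "x \<in> vtopology X closure_of S \<longleftrightarrow> x \<in> vcarrier X \<and> (\<forall>r>0. \<exists>y\<in>S. vnorm X (x - y) < r)"
proof -
  interpret M: Metric_space "vcarrier X" "vdist X" by (rule Metric_space_vdist)
  show ?thesis
    unfolding vtopology_def M.metric_closure_of M.in_mball vdist_def mem_Collect_eq
    using assms by (smt (verit, ccfv_threshold) subsetD)
qed

lemma tendsto_0_atin_vtopology:
  fixes g :: "'a \<Rightarrow> real"
  assumes "x \<in> vcarrier X"
  shows "(g \<longlongrightarrow> 0) (atin (vtopology X) x) \<longleftrightarrow>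
    (\<forall>e>0. \<exists>d>0. \<forall>y\<in>vcarrier X. y \<noteq> x \<longrightarrow> vnorm X (y - x) < d \<longrightarrow> \<bar>g y\<bar> < e)"
    (is "_ \<longleftrightarrow> ?R")
proof -
  have ev: "eventually P (atin (vtopology X) x) \<longleftrightarrow>
      (\<exists>d>0. \<forall>y\<in>vcarrier X. y \<noteq> x \<longrightarrow> vnorm X (y - x) < d \<longrightarrow> P y)" (is "_ \<longleftrightarrow> ?Q") for P
  proof
    assume "eventually P (atin (vtopology X) x)"
    then obtain U where U: "openin (vtopology X) U" "x \<in> U" "\<forall>y\<in>U - {x}. P y"
      using assms by (auto simp: eventually_atin)
    then show ?Q unfolding openin_vtopology by (metis Diff_iff singletonD)
  next
    assume ?Q
    then obtain d where d: "d > 0" "\<forall>y\<in>vcarrier X. y \<noteq> x \<longrightarrow> vnorm X (y - x) < d \<longrightarrow> P y" by blast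
    let ?U = "{y \<in> vcarrier X. vnorm X (y - x) < d}"
    have "openin (vtopology X) ?U"
      unfolding openin_vtopology
    proof (intro conjI ballI)
      fix y assume y: "y \<in> ?U"
      have "z \<in> ?U" if "z \<in> vcarrier X" "vnorm X (z - y) < d - vnorm X (y - x)" for z
        using norm_triangle[OF diff_in[of z y] diff_in[of y x]] that y assms by auto
      then show "\<exists>r>0. \<forall>z\<in>vcarrier X. vnorm X (z - y) < r \<longrightarrow> z \<in> ?U"
        using y by (intro exI[of _ "d - vnorm X (y - x)"]) auto
    qed auto
    then show "eventually P (atin (vtopology X) x)"
      unfolding eventually_atin using d assms by (intro disjI2 exI[of _ ?U]) auto
  qed
  show ?thesis unfolding tendsto_iff ev by (simp add: dist_real_def)
qed

end

lemma continuous_map_vtopology: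
  assumes "complex_normed_space X" "complex_normed_space Y"
  shows "continuous_map (vtopology X) (vtopology Y) T \<longleftrightarrow> T ` vcarrier X \<subseteq> vcarrier Y \<and>
    (\<forall>a\<in>vcarrier X. \<forall>e>0. \<exists>d>0. \<forall>x\<in>vcarrier X. vnorm X (a - x) < d \<longrightarrow> vnorm Y (T a - T x) < e)"
proof -
  interpret X: complex_normed_space X by fact
  interpret Y: complex_normed_space Y by fact
  show ?thesis
    unfolding vtopology_def
      Metric_space.metric_continuous_map[OF X.Metric_space_vdist Y.Metric_space_vdist]
    by (rule conj_cong[OF refl]) (force simp: vdist_def image_subset_iff)
qed

lemma operators_add: "T \<in> operators X Y \<Longrightarrow> x \<in> vcarrier X \<Longrightarrow> y \<in> vcarrier X \<Longrightarrow> T (x + y) = T x + T y"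
  and operators_scale: "T \<in> operators X Y \<Longrightarrow> x \<in> vcarrier X \<Longrightarrow> T (a *\<^sub>C x) = a *\<^sub>C T x"
  and operators_off: "T \<in> operators X Y \<Longrightarrow> x \<notin> vcarrier X \<Longrightarrow> T x = 0"
  by (auto simp: operators_def)

lemma operators_0 [simp]: "T \<in> operators X Y \<Longrightarrow> T 0 = 0"
  by (metis complex_vector.scale_zero_left operators_off operators_scale)

lemma operators_in:
  assumes "complex_normed_space X" "complex_normed_space Y" "T \<in> operators X Y"
  shows "T x \<in> vcarrier Y"
proof (cases "x \<in> vcarrier X")
  case True
  then show ?thesis
    using assms continuous_map_vtopology[OF assms(1,2)] by (auto simp: operators_def)
next
  case False
  then show ?thesis
    using assms by (simp add: operators_off complex_normed_space.zero_in)
qed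

lemma operators_diff:
  assumes "complex_normed_space X" "T \<in> operators X Y" "x \<in> vcarrier X" "y \<in> vcarrier X"
  shows "T (x - y) = T x - T y"
  using operators_add[OF assms(2), of "x - y" y] complex_normed_space.diff_in[OF assms(1)] assms(3,4)
  by simp

lemma operators_sum:
  assumes "complex_normed_space X" "T \<in> operators X Y" "\<And>i. i \<in> I \<Longrightarrow> f i \<in> vcarrier X"
  shows "T (sum f I) = (\<Sum>i\<in>I. T (f i))"
  using assms(3)
proof (induction I rule: infinite_finite_induct)
  case (insert i I)
  then show ?case
    using operators_add[OF assms(2), of "f i" "sum f I"] complex_normed_space.sum_in[OF assms(1), of I f]
    by simp
qed (use assms(2) in auto)

text \<open>
  Continuity at \<open>0\<close> gives a radius \<open>d\<close> on which the values stay below \<open>1\<close>; the vector of norm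
  \<open>d / 2\<close> in direction \<open>x\<close> then bounds the value at \<open>x\<close>.
\<close>

lemma operators_bounded:
  assumes "complex_normed_space X" "complex_normed_space Y" "T \<in> operators X Y"
  obtains C where "C > 0" "\<And>x. x \<in> vcarrier X \<Longrightarrow> vnorm Y (T x) \<le> C * vnorm X x"
proof -
  interpret X: complex_normed_space X by fact
  interpret Y: complex_normed_space Y by fact
  have "continuous_map (vtopology X) (vtopology Y) T" using assms(3) by (simp add: operators_def)
  then obtain d where d: "d > 0" "\<forall>x\<in>vcarrier X. vnorm X (0 - x) < d \<longrightarrow> vnorm Y (T 0 - T x) < 1"
    unfolding continuous_map_vtopology[OF assms(1,2)] by (metis X.zero_in zero_less_one)
  have "vnorm Y (T x) \<le> (2 / d) * vnorm X x" if x: "x \<in> vcarrier X" for x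
  proof (cases "x = 0")
    case True
    then show ?thesis using assms(3) by simp
  next
    case False
    have pos: "vnorm X x > 0" using False x X.norm_eq_zero X.norm_nonneg by force
    let ?c = "of_real (d / (2 * vnorm X x)) :: complex"
    have c: "cmod ?c = d / (2 * vnorm X x)" using pos d by (simp only: norm_of_real) simp
    have cx: "?c *\<^sub>C x \<in> vcarrier X" by (rule X.scale_in[OF x])
    have Tcx: "T (?c *\<^sub>C x) \<in> vcarrier Y" by (rule operators_in[OF assms])
    have "vnorm X (0 - ?c *\<^sub>C x) < d"
      using X.norm_minus[OF cx] X.norm_scale[OF x, of ?c] pos d c by simp
    then have "vnorm Y (0 - T (?c *\<^sub>C x)) < 1" using d cx assms(3) by simp
    then have "vnorm Y (T (?c *\<^sub>C x)) < 1" using Y.norm_minus[OF Tcx] by simp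
    then have "cmod ?c * vnorm Y (T x) < 1"
      using Y.norm_scale[OF operators_in[OF assms]] by (simp add: operators_scale[OF assms(3) x])
    then show ?thesis unfolding c using pos d by (simp add: field_simps)
  qed
  then show ?thesis using that[of "2 / d"] d by simp
qed

lemma operatorsI:
  assumes "complex_normed_space X" "complex_normed_space Y"
    and "\<And>x y. x \<in> vcarrier X \<Longrightarrow> y \<in> vcarrier X \<Longrightarrow> T (x + y) = T x + T y"
    and "\<And>a x. x \<in> vcarrier X \<Longrightarrow> T (a *\<^sub>C x) = a *\<^sub>C T x"
    and "\<And>x. x \<notin> vcarrier X \<Longrightarrow> T x = 0"
    and "\<And>x. x \<in> vcarrier X \<Longrightarrow> T x \<in> vcarrier Y"
    and bd: "\<And>x. x \<in> vcarrier X \<Longrightarrow> vnorm Y (T x) \<le> C * vnorm X x"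
  shows "T \<in> operators X Y"
proof -
  interpret X: complex_normed_space X by fact
  interpret Y: complex_normed_space Y by fact
  have "\<exists>d>0. \<forall>x\<in>vcarrier X. vnorm X (a - x) < d \<longrightarrow> vnorm Y (T a - T x) < e"
    if a: "a \<in> vcarrier X" and e: "e > 0" for a and e :: real
  proof (intro exI[of _ "e / (\<bar>C\<bar> + 1)"] conjI ballI impI)
    show "0 < e / (\<bar>C\<bar> + 1)" using e by simp
    fix x assume x: "x \<in> vcarrier X" and lt: "vnorm X (a - x) < e / (\<bar>C\<bar> + 1)"
    have "T a = T (a - x) + T x" using assms(3)[OF X.diff_in[OF a x] x] by simp
    then have "vnorm Y (T a - T x) = vnorm Y (T (a - x))" by simp
    also have "\<dots> \<le> C * vnorm X (a - x)" using bd X.diff_in[OF a x] by simp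
    also have "\<dots> \<le> (\<bar>C\<bar> + 1) * vnorm X (a - x)"
      using X.norm_nonneg[OF X.diff_in[OF a x]] by (intro mult_right_mono) auto
    also have "\<dots> < e" using lt by (simp add: field_simps)
    finally show "vnorm Y (T a - T x) < e" .
  qed
  then show ?thesis
    unfolding operators_def continuous_map_vtopology[OF assms(1,2)] using assms by auto
qed

lemma complex_normed_space_scalars: "complex_normed_space complex_scalars"
  by unfold_locales
    (auto simp: complex_scalars_def complex_vector.subspace_def norm_mult scaleC_complex_def norm_triangle_ineq)

lemma scalars_simps [simp]: "vcarrier complex_scalars = UNIV" "vnorm complex_scalars = cmod"
  by (simp_all add: complex_scalars_def)

lemma functional_bounded:
  assumes "complex_normed_space X" "\<phi> \<in> operators X complex_scalars"
  obtains C where "C > 0" "\<And>x. x \<in> vcarrier X \<Longrightarrow> cmod (\<phi> x) \<le> C * vnorm X x"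
  using operators_bounded[OF assms(1) complex_normed_space_scalars assms(2)] by auto

lemma functional_scale:
  "\<phi> \<in> operators X complex_scalars \<Longrightarrow> x \<in> vcarrier X \<Longrightarrow> \<phi> (a *\<^sub>C x) = a * \<phi> x"
  by (simp add: operators_scale scaleC_complex_def)

lemma functionalI:
  assumes "complex_normed_space X"
    and "\<And>x y. x \<in> vcarrier X \<Longrightarrow> y \<in> vcarrier X \<Longrightarrow> \<phi> (x + y) = \<phi> x + \<phi> y"
    and "\<And>a x. x \<in> vcarrier X \<Longrightarrow> \<phi> (a *\<^sub>C x) = a * \<phi> x"
    and "\<And>x. x \<notin> vcarrier X \<Longrightarrow> \<phi> x = 0"
    and "\<And>x. x \<in> vcarrier X \<Longrightarrow> cmod (\<phi> x) \<le> C * vnorm X x"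
  shows "\<phi> \<in> operators X complex_scalars"
  by (rule operatorsI[OF assms(1) complex_normed_space_scalars]) (use assms in \<open>auto simp: scaleC_complex_def\<close>)

lemma functional_comp:
  assumes "complex_normed_space X" "complex_normed_space Y"
    and T: "T \<in> operators X Y" and \<phi>: "\<phi> \<in> operators Y complex_scalars"
  shows "(\<lambda>x. \<phi> (T x)) \<in> operators X complex_scalars"
proof -
  obtain C where C: "C > 0" "\<And>x. x \<in> vcarrier X \<Longrightarrow> vnorm Y (T x) \<le> C * vnorm X x"
    using operators_bounded[OF assms(1-3)] by blast
  obtain D where D: "D > 0" "\<And>y. y \<in> vcarrier Y \<Longrightarrow> cmod (\<phi> y) \<le> D * vnorm Y y"
    using functional_bounded[OF assms(2,4)] by blast
  note Tin = operators_in[OF assms(1-3)]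
  show ?thesis
  proof (rule functionalI[OF assms(1), where C = "D * C"])
    fix x assume "x \<in> vcarrier X"
    then show "cmod (\<phi> (T x)) \<le> D * C * vnorm X x"
      using order_trans[OF D(2)[OF Tin, of x] mult_left_mono[OF C(2)[of x], of D]] D(1) by (simp add: mult.assoc)
  qed (use Tin T \<phi> in \<open>simp_all add: operators_add[OF T] operators_add[OF \<phi>] operators_scale[OF T] functional_scale[OF \<phi>] operators_off[OF T]\<close>)
qed

lemma (in complex_banach_space) Cauchy_limit:
  assumes s: "\<And>n. s n \<in> vcarrier X"
    and C: "\<And>e. e > 0 \<Longrightarrow> \<exists>N. \<forall>m\<ge>N. \<forall>n\<ge>N. vnorm X (s m - s n) < e"
  obtains x where "x \<in> vcarrier X" "(\<lambda>n. vnorm X (s n - x)) \<longlonglongrightarrow> 0"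
proof -
  interpret M: Metric_space "vcarrier X" "vdist X" by (rule Metric_space_vdist)
  have "M.MCauchy s"
    unfolding M.MCauchy_def using s C by (simp add: vdist_def image_subset_iff)
  then obtain x where x: "limitin M.mtopology s x sequentially"
    using complete M.mcomplete_def by blast
  then have xX: "x \<in> vcarrier X" using M.limitin_mspace by blast
  moreover have "(\<lambda>n. vdist X (s n) x) \<longlonglongrightarrow> 0"
    using x M.limitin_metric_dist_null by blast
  then have "(\<lambda>n. vnorm X (s n - x)) \<longlonglongrightarrow> 0" using xX s by (simp add: vdist_def)
  ultimately show ?thesis using that by blast
qed

lemma complex_banach_spaceI:
  assumes "complex_normed_space X"
    and lim: "\<And>s. (\<And>n. s n \<in> vcarrier X) \<Longrightarrow>
      (\<And>e. e > 0 \<Longrightarrow> \<exists>N. \<forall>m\<ge>N. \<forall>n\<ge>N. vnorm X (s m - s n) < e) \<Longrightarrow>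
      \<exists>x\<in>vcarrier X. (\<lambda>n. vnorm X (s n - x)) \<longlonglongrightarrow> 0"
  shows "complex_banach_space X"
proof -
  interpret complex_normed_space X by fact
  interpret M: Metric_space "vcarrier X" "vdist X" by (rule Metric_space_vdist)
  show ?thesis
  proof
    show "M.mcomplete"
      unfolding M.mcomplete_def
    proof (intro allI impI)
      fix s assume s: "M.MCauchy s"
      then have sX: "s n \<in> vcarrier X" for n by (auto simp: M.MCauchy_def)
      have "\<exists>x\<in>vcarrier X. (\<lambda>n. vnorm X (s n - x)) \<longlonglongrightarrow> 0"
        by (rule lim) (use s sX in \<open>auto simp: M.MCauchy_def vdist_def\<close>)
      then obtain x where "x \<in> vcarrier X" "(\<lambda>n. vdist X (s n) x) \<longlonglongrightarrow> 0"
        using sX by (auto simp: vdist_def)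
      then show "\<exists>x. limitin M.mtopology s x sequentially"
        using sX M.limitin_metric_dist_null by fastforce
    qed
  qed
qed

section \<open>The Hahn-Banach theorem\<close>

text \<open>
  The graph of a real linear functional, defined on a subspace and dominated by \<open>C\<close> times the norm.
  For sets of pairs the union of a chain is an upper bound, and single-valuedness is a consequence of
  the domination, since at \<open>0\<close> the only value dominated together with its negative is \<open>0\<close>.
\<close>

definition (in complex_normed_space) dominated_graph :: "real \<Rightarrow> ('a \<times> real) set \<Rightarrow> bool"
  where "dominated_graph C g \<longleftrightarrow> g \<subseteq> vcarrier X \<times> UNIV \<and> (0, 0) \<in> g \<and>
    (\<forall>x s y t. (x, s) \<in> g \<longrightarrow> (y, t) \<in> g \<longrightarrow> (x + y, s + t) \<in> g) \<and>
    (\<forall>c x s. (x, s) \<in> g \<longrightarrow> (of_real c *\<^sub>C x, c * s) \<in> g) \<and>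
    (\<forall>x s. (x, s) \<in> g \<longrightarrow> s \<le> C * vnorm X x)"

context complex_normed_space
begin

lemma dominated_graphD:
  assumes "dominated_graph C g"
  shows "(x, s) \<in> g \<Longrightarrow> x \<in> vcarrier X" "(0, 0) \<in> g"
    "(x, s) \<in> g \<Longrightarrow> (y, t) \<in> g \<Longrightarrow> (x + y, s + t) \<in> g"
    "(x, s) \<in> g \<Longrightarrow> (of_real c *\<^sub>C x, c * s) \<in> g"
    "(x, s) \<in> g \<Longrightarrow> s \<le> C * vnorm X x"
  using assms unfolding dominated_graph_def by auto

lemma dominated_graph_unique:
  assumes g: "dominated_graph C g" and "(x, s) \<in> g" "(x, t) \<in> g"
  shows "s = t"
proof -
  have le: "s \<le> t" if "(x, s) \<in> g" "(x, t) \<in> g" for s t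
  proof -
    have "(of_real (-1) *\<^sub>C x, -1 * t) \<in> g"
      using dominated_graphD(4)[OF g that(2)] .
    then have "(x + of_real (-1) *\<^sub>C x, s + -1 * t) \<in> g"
      using dominated_graphD(3)[OF g that(1)] by blast
    then have "(0, s - t) \<in> g" by simp
    then have "s - t \<le> C * vnorm X 0" using dominated_graphD(5)[OF g] by blast
    then show ?thesis by simp
  qed
  from le[OF assms(2,3)] le[OF assms(3,2)] show ?thesis by simp
qed

text \<open>
  The value \<open>a\<close> at a new vector \<open>x0\<close> has to lie between all \<open>s - C * vnorm X (y - x0)\<close> and all
  \<open>C * vnorm X (z + x0) - t\<close>; the triangle inequality for \<open>y + z = (y - x0) + (z + x0)\<close> shows that
  each of the first numbers is below each of the second.
\<close>

lemma dominated_graph_extend: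
  assumes g: "dominated_graph C g" and x0: "x0 \<in> vcarrier X" and C: "C \<ge> 0"
  obtains g' a where "dominated_graph C g'" "g \<subseteq> g'" "(x0, a) \<in> g'"
proof -
  have g0: "(0, 0) \<in> g" and gX: "\<And>x s. (x, s) \<in> g \<Longrightarrow> x \<in> vcarrier X"
    and gadd: "\<And>x s y t. (x, s) \<in> g \<Longrightarrow> (y, t) \<in> g \<Longrightarrow> (x + y, s + t) \<in> g"
    and gsc: "\<And>c x s. (x, s) \<in> g \<Longrightarrow> (of_real c *\<^sub>C x, c * s) \<in> g"
    and gle: "\<And>x s. (x, s) \<in> g \<Longrightarrow> s \<le> C * vnorm X x"
    using dominated_graphD[OF g] by auto
  let ?L = "{s - C * vnorm X (y - x0) | y s. (y, s) \<in> g}"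
  have key: "s - C * vnorm X (y - x0) \<le> C * vnorm X (z + x0) - t"
    if "(y, s) \<in> g" "(z, t) \<in> g" for y s z t
  proof -
    have "s + t \<le> C * vnorm X (y + z)" using gle gadd that by blast
    also have "\<dots> \<le> C * (vnorm X (y - x0) + vnorm X (z + x0))"
      using norm_triangle[of "y - x0" "z + x0"] gX[OF that(1)] gX[OF that(2)] x0 C
      by (intro mult_left_mono) (auto simp: diff_in add_in)
    finally show ?thesis by (simp add: algebra_simps)
  qed
  have ne: "?L \<noteq> {}" using g0 by blast
  have bdd: "bdd_above ?L" using key[OF _ g0] by (intro bdd_aboveI) auto
  define a where "a = Sup ?L"
  have lower: "s - a \<le> C * vnorm X (y - x0)" if "(y, s) \<in> g" for y s
    using cSup_upper[OF _ bdd, of "s - C * vnorm X (y - x0)"] that unfolding a_def by force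
  have upper: "t + a \<le> C * vnorm X (z + x0)" if "(z, t) \<in> g" for z t
    using cSup_least[OF ne, of "C * vnorm X (z + x0) - t"] key[OF _ that] unfolding a_def by force
  define g' where "g' = {(y + of_real c *\<^sub>C x0, s + c * a) | y s c. (y, s) \<in> g}"
  have I: "(y + of_real c *\<^sub>C x0, s + c * a) \<in> g'" if "(y, s) \<in> g" for y s c
    using that unfolding g'_def by blast
  have dom: "s + c * a \<le> C * vnorm X (y + of_real c *\<^sub>C x0)" if ys: "(y, s) \<in> g" for y s c
  proof -
    have scale: "C * vnorm X (of_real d *\<^sub>C z) = d * (C * vnorm X z)" if "d \<ge> 0" "z \<in> vcarrier X" for d z
      using norm_scale[OF that(2), of "of_real d"] that(1) by simp
    note yX = gX[OF ys]
    consider "c = 0" | "c > 0" | "c < 0" by linarith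
    then show ?thesis
    proof cases
      case 1
      then show ?thesis using gle[OF ys] by simp
    next
      case 2
      let ?y = "of_real (1 / c) *\<^sub>C y"
      have "c * (1 / c * s + a) \<le> c * (C * vnorm X (?y + x0))"
        by (rule mult_left_mono[OF upper[OF gsc[OF ys]]]) (use 2 in simp)
      also have "\<dots> = C * vnorm X (of_real c *\<^sub>C (?y + x0))"
        by (rule scale[symmetric]) (use 2 yX x0 in \<open>auto intro: add_in scale_in\<close>)
      also have "of_real c *\<^sub>C (?y + x0) = y + of_real c *\<^sub>C x0"
        using 2 by (simp add: scaleC_add_right scaleC_scaleC scaleC_one flip: of_real_mult)
      finally show ?thesis using 2 by (simp add: algebra_simps)
    next
      case 3
      define d where "d = - c"
      have d: "d > 0" "c = - d" using 3 by (auto simp: d_def)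
      let ?y = "of_real (1 / d) *\<^sub>C y"
      have "d * (1 / d * s - a) \<le> d * (C * vnorm X (?y - x0))"
        by (rule mult_left_mono[OF lower[OF gsc[OF ys]]]) (use d in simp)
      also have "\<dots> = C * vnorm X (of_real d *\<^sub>C (?y - x0))"
        by (rule scale[symmetric]) (use d yX x0 in \<open>auto intro: diff_in scale_in\<close>)
      also have "of_real d *\<^sub>C (?y - x0) = y + of_real c *\<^sub>C x0"
        using d by (simp add: complex_vector.scale_right_diff_distrib scaleC_scaleC scaleC_one flip: of_real_mult)
      finally show ?thesis using d by (simp add: algebra_simps)
    qed
  qed
  have "dominated_graph C g'"
    unfolding dominated_graph_def
  proof (intro conjI allI impI)
    show "g' \<subseteq> vcarrier X \<times> UNIV" using gX x0 by (auto simp: g'_def add_in scale_in)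
    show "(0, 0) \<in> g'" using I[OF g0, of 0] by simp
    show "(x + y, s + t) \<in> g'" if "(x, s) \<in> g'" "(y, t) \<in> g'" for x s y t
    proof -
      from that obtain x1 s1 c y1 t1 d where e: "(x1, s1) \<in> g" "x = x1 + of_real c *\<^sub>C x0" "s = s1 + c * a"
        "(y1, t1) \<in> g" "y = y1 + of_real d *\<^sub>C x0" "t = t1 + d * a" unfolding g'_def by blast
      show ?thesis using I[OF gadd[OF e(1,4)], of "c + d"]
        by (simp add: e algebra_simps scaleC_add_left)
    qed
    show "(of_real c *\<^sub>C x, c * s) \<in> g'" if "(x, s) \<in> g'" for c x s
    proof -
      from that obtain x1 s1 d where e: "(x1, s1) \<in> g" "x = x1 + of_real d *\<^sub>C x0" "s = s1 + d * a"
        unfolding g'_def by blast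
      show ?thesis using I[OF gsc[OF e(1)], of c "c * d"]
        by (simp add: e algebra_simps scaleC_add_right scaleC_scaleC)
    qed
    show "s \<le> C * vnorm X x" if "(x, s) \<in> g'" for x s
      using that dom unfolding g'_def by auto
  qed
  moreover have "g \<subseteq> g'" using I[where c = 0] by auto
  moreover have "(x0, a) \<in> g'" using I[OF g0, of 1] by (simp add: scaleC_one)
  ultimately show ?thesis using that by blast
qed

lemma dominated_graph_total:
  assumes g0: "dominated_graph C g0" and C: "C \<ge> 0"
  obtains g where "dominated_graph C g" "g0 \<subseteq> g" "Domain g = vcarrier X"
proof -
  let ?A = "{g. dominated_graph C g \<and> g0 \<subseteq> g}"
  have "\<exists>M\<in>?A. \<forall>Y\<in>?A. M \<subseteq> Y \<longrightarrow> Y = M"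
  proof (rule subset_Zorn_nonempty)
    show "?A \<noteq> {}" using g0 by blast
    fix \<C> assume ne: "\<C> \<noteq> {}" and ch: "subset.chain ?A \<C>"
    have dg: "dominated_graph C h" and sub: "g0 \<subseteq> h" if "h \<in> \<C>" for h
      using ch that unfolding subset.chain_def by auto
    have tot: "h \<subseteq> k \<or> k \<subseteq> h" if "h \<in> \<C>" "k \<in> \<C>" for h k
      using subset.chain_total[OF ch that] by auto
    note D = dominated_graphD[OF dg]
    have "dominated_graph C (\<Union>\<C>)"
      unfolding dominated_graph_def
    proof (intro conjI allI impI)
      show "\<Union>\<C> \<subseteq> vcarrier X \<times> UNIV" using D(1) by auto
      show "(0, 0) \<in> \<Union>\<C>" using D(2) ne by auto
      show "(x + y, s + t) \<in> \<Union>\<C>" if "(x, s) \<in> \<Union>\<C>" "(y, t) \<in> \<Union>\<C>" for x s y t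
      proof -
        from that obtain h k where hk: "h \<in> \<C>" "(x, s) \<in> h" "k \<in> \<C>" "(y, t) \<in> k" by blast
        then obtain m where "m \<in> \<C>" "(x, s) \<in> m" "(y, t) \<in> m"
          using tot[OF hk(1,3)] by blast
        then show ?thesis using D(3) by blast
      qed
      show "(of_real c *\<^sub>C x, c * s) \<in> \<Union>\<C>" if "(x, s) \<in> \<Union>\<C>" for c x s
        using that D(4) by blast
      show "s \<le> C * vnorm X x" if "(x, s) \<in> \<Union>\<C>" for x s
        using that D(5) by blast
    qed
    moreover have "g0 \<subseteq> \<Union>\<C>" using sub ne by blast
    ultimately show "\<Union>\<C> \<in> ?A" by blast
  qed
  then obtain g where gA: "g \<in> ?A" and gmax: "\<forall>Y\<in>?A. g \<subseteq> Y \<longrightarrow> Y = g" by (elim bexE)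
  have g: "dominated_graph C g" "g0 \<subseteq> g" using gA by simp_all
  have max: "h = g" if "dominated_graph C h" "g \<subseteq> h" for h
  proof -
    have "h \<in> ?A" using that g(2) by (simp add: subset_trans[OF g(2)])
    then show ?thesis using gmax that(2) by simp
  qed
  have "x \<in> Domain g" if x: "x \<in> vcarrier X" for x
  proof -
    obtain g' a where "dominated_graph C g'" "g \<subseteq> g'" "(x, a) \<in> g'"
      using dominated_graph_extend[OF g(1) x C] by blast
    then show ?thesis using max by blast
  qed
  then have "Domain g = vcarrier X" using dominated_graphD(1)[OF g(1)] by blast
  then show ?thesis using that g by blast
qed

text \<open>
  The complex functional is \<open>u x - \<i> * u (\<i> *\<^sub>C x)\<close> for a dominated real extension \<open>u\<close> of the real
  part. The functional to be extended is given as a relation \<open>R\<close>: the bound makes \<open>R\<close> single-valued,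
  so values can be prescribed on linear combinations without checking that they are
  well defined.
\<close>

theorem Hahn_Banach:
  assumes R: "R \<subseteq> vcarrier X \<times> UNIV" "R \<noteq> {}" and C: "C \<ge> 0"
    and add: "\<And>x s y t. (x, s) \<in> R \<Longrightarrow> (y, t) \<in> R \<Longrightarrow> (x + y, s + t) \<in> R"
    and scale: "\<And>a x s. (x, s) \<in> R \<Longrightarrow> (a *\<^sub>C x, a * s) \<in> R"
    and bound: "\<And>x s. (x, s) \<in> R \<Longrightarrow> cmod s \<le> C * vnorm X x"
  obtains \<psi> where "\<psi> \<in> operators X complex_scalars" "\<And>x s. (x, s) \<in> R \<Longrightarrow> \<psi> x = s"
    "\<And>x. x \<in> vcarrier X \<Longrightarrow> cmod (\<psi> x) \<le> C * vnorm X x"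
proof -
  let ?g0 = "{(x, Re s) | x s. (x, s) \<in> R}"
  have "dominated_graph C ?g0"
    unfolding dominated_graph_def
  proof (intro conjI allI impI)
    show "?g0 \<subseteq> vcarrier X \<times> UNIV" using R(1) by blast
    obtain x s where "(x, s) \<in> R" using R(2) by auto
    from scale[OF this, of 0] show "(0, 0) \<in> ?g0" by force
    show "s \<le> C * vnorm X x" if xs: "(x, s) \<in> ?g0" for x s
    proof -
      obtain z where "(x, z) \<in> R" "s = Re z" using xs by blast
      then show ?thesis using order_trans[OF complex_Re_le_cmod bound] by simp
    qed
    show "(x + y, s + t) \<in> ?g0" if xy: "(x, s) \<in> ?g0" "(y, t) \<in> ?g0" for x s y t
    proof -
      obtain w z where wz: "(x, w) \<in> R" "s = Re w" "(y, z) \<in> R" "t = Re z" using xy by blast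
      have "(x + y, w + z) \<in> R" "s + t = Re (w + z)" using add[OF wz(1,3)] wz by simp_all
      then show ?thesis by blast
    qed
    show "(of_real c *\<^sub>C x, c * s) \<in> ?g0" if xs: "(x, s) \<in> ?g0" for c x s
    proof -
      obtain z where z: "(x, z) \<in> R" "s = Re z" using xs by blast
      have "(of_real c *\<^sub>C x, of_real c * z) \<in> R" "c * s = Re (of_real c * z)"
        using scale[OF z(1)] z by simp_all
      then show ?thesis by blast
    qed
  qed
  then obtain g where g: "dominated_graph C g" "?g0 \<subseteq> g" "Domain g = vcarrier X"
    using dominated_graph_total[OF _ C] by blast
  have gadd: "\<And>x s y t. (x, s) \<in> g \<Longrightarrow> (y, t) \<in> g \<Longrightarrow> (x + y, s + t) \<in> g"
    and gsc: "\<And>c x s. (x, s) \<in> g \<Longrightarrow> (of_real c *\<^sub>C x, c * s) \<in> g"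
    and gle: "\<And>x s. (x, s) \<in> g \<Longrightarrow> s \<le> C * vnorm X x"
    using dominated_graphD[OF g(1)] by auto
  define u where "u x = (THE s. (x, s) \<in> g)" for x
  have u_eq: "u x = s" if "(x, s) \<in> g" for x s
    unfolding u_def using that dominated_graph_unique[OF g(1)] by blast
  have u: "(x, u x) \<in> g" if "x \<in> vcarrier X" for x
    using that g(3) u_eq by (metis Domain.cases)
  have u_add: "u (x + y) = u x + u y" if "x \<in> vcarrier X" "y \<in> vcarrier X" for x y
    using that by (intro u_eq gadd u)
  have u_scale: "u (of_real c *\<^sub>C x) = c * u x" if "x \<in> vcarrier X" for c x
    using that by (intro u_eq gsc u)
  define \<psi> where "\<psi> x = (if x \<in> vcarrier X then Complex (u x) (- u (\<i> *\<^sub>C x)) else 0)" for x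
  have \<psi>_add: "\<psi> (x + y) = \<psi> x + \<psi> y" if "x \<in> vcarrier X" "y \<in> vcarrier X" for x y
    using that by (simp add: \<psi>_def add_in scale_in u_add scaleC_add_right complex_eq_iff)
  have \<psi>_scale: "\<psi> (a *\<^sub>C x) = a * \<psi> x" if x: "x \<in> vcarrier X" for a x
  proof -
    have r: "\<psi> (of_real c *\<^sub>C x) = of_real c * \<psi> x" if x: "x \<in> vcarrier X" for c x
    proof -
      have "\<i> *\<^sub>C of_real c *\<^sub>C x = of_real c *\<^sub>C \<i> *\<^sub>C x" by (simp add: scaleC_scaleC mult.commute)
      then have "u (\<i> *\<^sub>C of_real c *\<^sub>C x) = c * u (\<i> *\<^sub>C x)" by (simp only: u_scale[OF scale_in[OF x]])
      then show ?thesis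
        using x by (simp add: \<psi>_def scale_in u_scale complex_eq_iff del: complex_vector.scale_scale)
    qed
    have i: "\<psi> (\<i> *\<^sub>C x) = \<i> * \<psi> x" if x: "x \<in> vcarrier X" for x
    proof -
      have "\<i> *\<^sub>C \<i> *\<^sub>C x = of_real (-1) *\<^sub>C x" by (simp add: scaleC_scaleC)
      then have "u (\<i> *\<^sub>C \<i> *\<^sub>C x) = - u x" using u_scale[OF x, of "-1"] by simp
      then show ?thesis
        using x by (simp add: \<psi>_def scale_in complex_eq_iff del: complex_vector.scale_scale)
    qed
    have "a = of_real (Re a) + of_real (Im a) * \<i>" by (simp add: complex_eq_iff)
    then have "a *\<^sub>C x = of_real (Re a) *\<^sub>C x + of_real (Im a) *\<^sub>C \<i> *\<^sub>C x"
      by (metis scaleC_scaleC scaleC_add_left)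
    then have "\<psi> (a *\<^sub>C x) = of_real (Re a) * \<psi> x + of_real (Im a) * (\<i> * \<psi> x)"
      using x by (simp add: \<psi>_add scale_in r i del: complex_vector.scale_scale)
    also have "\<dots> = a * \<psi> x" by (simp add: complex_eq_iff algebra_simps)
    finally show ?thesis .
  qed
  have \<psi>_bound: "cmod (\<psi> x) \<le> C * vnorm X x" if x: "x \<in> vcarrier X" for x
  proof (cases "\<psi> x = 0")
    case True
    then show ?thesis using C norm_nonneg[OF x] by simp
  next
    case False
    \<comment> \<open>Rotate \<open>x\<close> so that the value becomes its own modulus, which is then a value of \<open>u\<close>.\<close>
    define e where "e = cnj (\<psi> x) / cmod (\<psi> x)"
    have e: "cmod e = 1" using False by (simp add: e_def norm_divide)
    have "\<psi> (e *\<^sub>C x) = of_real (cmod (\<psi> x))"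
      unfolding \<psi>_scale[OF x] e_def using False
      by (simp add: field_simps power2_eq_square flip: complex_norm_square of_real_mult)
    then have "cmod (\<psi> x) = Re (\<psi> (e *\<^sub>C x))" by simp
    also have "\<dots> = u (e *\<^sub>C x)" using x by (simp add: \<psi>_def scale_in)
    also have "\<dots> \<le> C * vnorm X (e *\<^sub>C x)" using gle u scale_in[OF x] by blast
    finally show ?thesis using norm_scale[OF x, of e] e by simp
  qed
  have "\<psi> x = s" if xs: "(x, s) \<in> R" for x s
  proof -
    have uR: "u y = Re t" if "(y, t) \<in> R" for y t using that g(2) by (intro u_eq) blast
    have "x \<in> vcarrier X" using xs R(1) by blast
    then show ?thesis using uR[OF xs] uR[OF scale[OF xs, of \<i>]] by (simp add: \<psi>_def complex_eq_iff)
  qed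
  moreover have "\<psi> \<in> operators X complex_scalars"
    by (rule functionalI) (use \<psi>_add \<psi>_scale \<psi>_bound complex_normed_space_axioms in \<open>auto simp: \<psi>_def\<close>)
  ultimately show ?thesis using that \<psi>_bound by blast
qed

text \<open>
  The unit ball of the dual, described by pointwise bounds, so that it is visibly an intersection of
  sets closed for pointwise convergence.
\<close>

definition dual_ball :: "('a \<Rightarrow> complex) set"
  where "dual_ball = {\<phi> \<in> operators X complex_scalars. \<forall>x\<in>vcarrier X. cmod (\<phi> x) \<le> vnorm X x}"

lemma norming_functional:
  assumes x: "x \<in> vcarrier X"
  obtains \<phi> where "\<phi> \<in> dual_ball" "\<phi> x = of_real (vnorm X x)"
proof (cases "x = 0")
  case True
  have "(\<lambda>_. 0) \<in> operators X complex_scalars"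
    by (rule functionalI[where C = 0]) (auto simp: complex_normed_space_axioms)
  then show ?thesis using True that[of "\<lambda>_. 0"] by (simp add: dual_ball_def norm_nonneg)
next
  case False
  let ?R = "{(a *\<^sub>C x, a * of_real (vnorm X x)) | a. True}"
  have R: "(a *\<^sub>C x, a * of_real (vnorm X x)) \<in> ?R" for a by blast
  obtain \<psi> where "\<psi> \<in> operators X complex_scalars" and \<psi>: "\<And>y s. (y, s) \<in> ?R \<Longrightarrow> \<psi> y = s"
    "\<And>y. y \<in> vcarrier X \<Longrightarrow> cmod (\<psi> y) \<le> 1 * vnorm X y"
  proof (rule Hahn_Banach[of ?R 1])
    show "(y + z, s + t) \<in> ?R" if "(y, s) \<in> ?R" "(z, t) \<in> ?R" for y s z t
    proof -
      from that obtain a b where "y = a *\<^sub>C x" "s = a * of_real (vnorm X x)"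
        "z = b *\<^sub>C x" "t = b * of_real (vnorm X x)" by blast
      then show ?thesis using R[of "a + b"] by (simp add: scaleC_add_left distrib_right)
    qed
    show "(b *\<^sub>C y, b * s) \<in> ?R" if "(y, s) \<in> ?R" for b y s
    proof -
      from that obtain a where "y = a *\<^sub>C x" "s = a * of_real (vnorm X x)" by blast
      then show ?thesis using R[of "b * a"] by (simp add: mult.assoc)
    qed
  qed (use x norm_nonneg[OF x] in \<open>auto simp: scale_in norm_mult norm_scale\<close>)
  moreover have "\<psi> x = of_real (vnorm X x)" using \<psi>(1)[OF R[of 1]] by (simp add: scaleC_one)
  ultimately show ?thesis using that[of \<psi>] by (simp add: dual_ball_def)
qed

lemma eq_if_functionals_eq:
  assumes "x \<in> vcarrier X" "y \<in> vcarrier X" "\<And>\<phi>. \<phi> \<in> operators X complex_scalars \<Longrightarrow> \<phi> x = \<phi> y"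
  shows "x = y"
proof -
  obtain \<phi> where \<phi>: "\<phi> \<in> dual_ball" "\<phi> (x - y) = of_real (vnorm X (x - y))"
    using norming_functional[OF diff_in[OF assms(1,2)]] by blast
  then have op: "\<phi> \<in> operators X complex_scalars" by (simp add: dual_ball_def)
  then have "\<phi> (x - y) = 0"
    using operators_diff[OF complex_normed_space_axioms op assms(1,2)] assms(3)[of \<phi>] by simp
  then show ?thesis using \<phi> norm_eq_zero[OF diff_in[OF assms(1,2)]] by simp
qed

end

section \<open>Rosenthal's dichotomy for sequences of functions\<close>

text \<open>
  No subsequence of the pairs \<open>(A n, B n)\<close> indexed by \<open>M\<close> converges on \<open>X\<close>: along every infinite
  subset of \<open>M\<close> some point of \<open>X\<close> is infinitely often in \<open>A n\<close> and infinitely often in \<open>B n\<close>.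
\<close>

definition oscillates :: "(nat \<Rightarrow> 'k set) \<Rightarrow> (nat \<Rightarrow> 'k set) \<Rightarrow> 'k set \<Rightarrow> nat set \<Rightarrow> bool"
  where "oscillates A B X M \<longleftrightarrow>
    (\<forall>L\<subseteq>M. infinite L \<longrightarrow> (\<exists>x\<in>X. infinite {n \<in> L. x \<in> A n} \<and> infinite {n \<in> L. x \<in> B n}))"

text \<open>
  Oscillation survives intersection with both \<open>A m\<close> and \<open>B m\<close> for a suitable \<open>m\<close>, after thinning out
  the index set. Otherwise one could choose indices \<open>m k\<close> and decreasing infinite sets \<open>L k\<close>, with
  \<open>m j \<in> L k\<close> for \<open>j > k\<close>, such that \<open>L k\<close> is tame on \<open>X k \<inter> A (m k)\<close> or on
  \<open>X k \<inter> B (m k)\<close>. By the pigeonhole principle the set \<open>X k\<close> and the side are constant for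
  infinitely many \<open>k\<close>. A point that oscillates along these \<open>m k\<close> lies in the chosen side of some
  \<open>m j\<close>, and then \<open>L j\<close> forbids its oscillation.
\<close>

lemma oscillates_split:
  assumes fin: "finite \<X>" and M: "infinite M" and osc: "\<And>X. X \<in> \<X> \<Longrightarrow> oscillates A B X M"
  obtains m L where "m \<in> M" "L \<subseteq> M" "infinite L" "\<And>n. n \<in> L \<Longrightarrow> m < n"
    "\<And>X. X \<in> \<X> \<Longrightarrow> oscillates A B (X \<inter> A m) L \<and> oscillates A B (X \<inter> B m) L"
proof (rule ccontr)
  note witness = that
  assume no: "\<not> thesis"
  define side where "side b = (if b then A else B)" for b
  define tame where "tame X b m L \<longleftrightarrow>
    (\<forall>x\<in>X \<inter> side b m. finite {n \<in> L. x \<in> A n} \<or> finite {n \<in> L. x \<in> B n})" for X b m L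
  have step: "\<exists>X\<in>\<X>. \<exists>b. \<exists>L\<subseteq>K. infinite L \<and> (\<forall>n\<in>L. m < n) \<and> tame X b m L"
    if K: "K \<subseteq> M" "infinite K" and m: "m \<in> M" for K m
  proof -
    let ?K = "K - {..m}"
    have K': "?K \<subseteq> M" "infinite ?K" using K by auto
    have "\<not> (\<forall>X\<in>\<X>. oscillates A B (X \<inter> A m) ?K \<and> oscillates A B (X \<inter> B m) ?K)"
    proof
      assume all: "\<forall>X\<in>\<X>. oscillates A B (X \<inter> A m) ?K \<and> oscillates A B (X \<inter> B m) ?K"
      have thesis by (rule witness[of m ?K]) (use m K' all in auto)
      with no show False ..
    qed
    then obtain X b where "X \<in> \<X>" "\<not> oscillates A B (X \<inter> side b m) ?K"
      unfolding side_def by metis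
    then obtain L where "X \<in> \<X>" "L \<subseteq> ?K" "infinite L" "tame X b m L"
      unfolding oscillates_def tame_def by blast
    then show ?thesis
      by (intro bexI[of _ X] exI[of _ b] exI[of _ L]) auto
  qed
  define P where "P = (\<lambda>(m, L, X, b). m \<in> M \<and> L \<subseteq> M \<and> infinite L \<and> X \<in> \<X> \<and> (\<forall>n\<in>L. m < n) \<and> tame X b m L)"
  define Q where "Q = (\<lambda>(m::nat, L :: nat set, X :: 'a set, b :: bool) (m' :: nat, L', X' :: 'a set, b' :: bool). m' \<in> L \<and> L' \<subseteq> L)"
  have "\<exists>s. \<forall>k::nat. P (s k) \<and> Q (s k) (s (Suc k))"
  proof (rule dependent_nat_choice)
    obtain m where m: "m \<in> M" using M by (metis finite.emptyI ex_in_conv)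
    show "\<exists>s. P s" using step[OF subset_refl M m] m unfolding P_def by auto
    fix s :: "nat \<times> nat set \<times> 'a set \<times> bool" and k :: nat
    assume s: "P s"
    obtain m L X b where sd: "s = (m, L, X, b)" by (cases s)
    from s have L: "L \<subseteq> M" "infinite L" unfolding P_def sd by auto
    then obtain m' where m': "m' \<in> L" by (metis finite.emptyI ex_in_conv)
    with L have "m' \<in> M" by blast
    from step[OF L this] obtain X' b' L' where
      "X' \<in> \<X>" "L' \<subseteq> L" "infinite L'" "\<forall>n\<in>L'. m' < n" "tame X' b' m' L'" by blast
    then have "P (m', L', X', b') \<and> Q s (m', L', X', b')"
      using m' L unfolding P_def Q_def sd by auto
    then show "\<exists>s'. P s' \<and> Q s s'" by blast
  qed
  then obtain s where s: "\<And>k. P (s k)" "\<And>k. Q (s k) (s (Suc k))" by blast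
  define m L X b where "m k = fst (s k)" and "L k = fst (snd (s k))"
    and "X k = fst (snd (snd (s k)))" and "b k = snd (snd (snd (s k)))" for k
  have inv: "m k \<in> M" "L k \<subseteq> M" "X k \<in> \<X>" "\<forall>n\<in>L k. m k < n" "tame (X k) (b k) (m k) (L k)"
    and nxt: "m (Suc k) \<in> L k" "L (Suc k) \<subseteq> L k" for k
    using s(1)[of k] s(2)[of k] unfolding P_def Q_def m_def L_def X_def b_def by (auto split: prod.splits)
  have mono: "strict_mono m" using inv(4) nxt(1) by (auto simp: strict_mono_Suc_iff)
  have later: "m j \<in> L k" if "k < j" for j k
  proof -
    have "L j \<subseteq> L k" if "k \<le> j" for j k using lift_Suc_antimono_le[of L] nxt(2) that by blast
    then have "L (j - 1) \<subseteq> L k" using that by simp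
    then show ?thesis using nxt(1)[of "j - 1"] that by auto
  qed
  have "range (\<lambda>k. (X k, b k)) \<subseteq> \<X> \<times> UNIV" using inv(3) by auto
  then have "finite (range (\<lambda>k. (X k, b k)))" by (rule finite_subset) (use fin in simp)
  from pigeonhole_infinite[OF infinite_UNIV_nat this]
  obtain k0 where k0: "infinite {k. (X k, b k) = (X k0, b k0)}" by auto
  define J where "J = {k. (X k, b k) = (X k0, b k0)}"
  have J: "infinite J" using k0 by (simp add: J_def)
  have "infinite (m ` J)" "m ` J \<subseteq> M"
    using J mono inv(1) by (auto simp: finite_image_iff strict_mono_imp_inj_on)
  then obtain x where x: "x \<in> X k0" "infinite {n \<in> m ` J. x \<in> A n}" "infinite {n \<in> m ` J. x \<in> B n}"
    using osc[OF inv(3)[of k0]] unfolding oscillates_def by blast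
  have "infinite {n \<in> m ` J. x \<in> side (b k0) n}" using x by (simp add: side_def)
  then have "{n \<in> m ` J. x \<in> side (b k0) n} \<noteq> {}" by (metis finite.emptyI)
  then obtain j where j: "j \<in> J" "x \<in> side (b k0) (m j)" by blast
  have tail: "finite {n \<in> m ` J. x \<in> D n}" if "finite {n \<in> L j. x \<in> D n}" for D
  proof (rule finite_subset)
    show "{n \<in> m ` J. x \<in> D n} \<subseteq> m ` {..j} \<union> {n \<in> L j. x \<in> D n}"
    proof
      fix n assume n: "n \<in> {n \<in> m ` J. x \<in> D n}"
      then obtain k where k: "n = m k" by blast
      show "n \<in> m ` {..j} \<union> {n \<in> L j. x \<in> D n}"
        using later[of j k] n unfolding k by (cases "k \<le> j") auto
    qed
  qed (use that in simp)
  from inv(5)[of j] j x have "finite {n \<in> L j. x \<in> A n} \<or> finite {n \<in> L j. x \<in> B n}"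
    unfolding tame_def J_def by auto
  then show False using tail[of A] tail[of B] x by blast
qed

text \<open>
  Starting from \<open>{S}\<close>, splitting each set of a finite family into its parts in \<open>A m\<close> and \<open>B m\<close>
  realises all patterns of the chosen indices at once; oscillating sets are not empty.
\<close>

lemma oscillates_independent:
  assumes M: "infinite M" and osc: "oscillates A B S M"
  obtains r :: "nat \<Rightarrow> nat" where "strict_mono r" "range r \<subseteq> M"
    "\<And>N P. \<exists>x\<in>S. \<forall>i<N. x \<in> (if i \<in> P then A (r i) else B (r i))"
proof -
  define P where "P = (\<lambda>(k::nat) (m::nat, L, \<X>). L \<subseteq> M \<and> infinite L \<and> finite \<X> \<and> (\<forall>n\<in>L. k > 0 \<longrightarrow> m < n) \<and>
      (\<forall>X\<in>\<X>. oscillates A B X L) \<and> (k = 0 \<longrightarrow> \<X> = {S}))"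
  define Q where "Q = (\<lambda>(m::nat, L::nat set, \<X>) (m', L'::nat set, \<X>'). m' \<in> L \<and> L' \<subseteq> L \<and>
      \<X>' = (\<lambda>X. X \<inter> A m') ` \<X> \<union> (\<lambda>X. X \<inter> B m') ` \<X>)"
  have "\<exists>s. \<forall>k::nat. P k (s k) \<and> Q (s k) (s (Suc k))"
  proof (rule dependent_nat_choice)
    show "\<exists>s. P 0 s" using M osc unfolding P_def by (intro exI[of _ "(0, M, {S})"]) auto
    fix s :: "nat \<times> nat set \<times> 'a set set" and k :: nat
    assume s: "P k s"
    obtain m L \<X> where sd: "s = (m, L, \<X>)" by (cases s)
    from s have L: "L \<subseteq> M" "infinite L" "finite \<X>" "\<And>X. X \<in> \<X> \<Longrightarrow> oscillates A B X L"
      unfolding P_def sd by auto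
    obtain m' L' where m': "m' \<in> L" "L' \<subseteq> L" "infinite L'" "\<And>n. n \<in> L' \<Longrightarrow> m' < n"
      "\<And>X. X \<in> \<X> \<Longrightarrow> oscillates A B (X \<inter> A m') L' \<and> oscillates A B (X \<inter> B m') L'"
      using oscillates_split[OF L(3,2,4)] by blast
    let ?s = "(m', L', (\<lambda>X. X \<inter> A m') ` \<X> \<union> (\<lambda>X. X \<inter> B m') ` \<X>)"
    have "P (Suc k) ?s" using m' L unfolding P_def by auto
    moreover have "Q s ?s" using m' unfolding Q_def sd by simp
    ultimately show "\<exists>s'. P (Suc k) s' \<and> Q s s'" by blast
  qed
  then obtain s where s: "\<And>k. P k (s k)" "\<And>k. Q (s k) (s (Suc k))" by blast
  define m L \<X> where "m k = fst (s k)" and "L k = fst (snd (s k))" and "\<X> k = snd (snd (s k))" for k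
  have inv: "L k \<subseteq> M" "infinite (L k)" "\<And>n. n \<in> L k \<Longrightarrow> k > 0 \<Longrightarrow> m k < n"
    "\<And>X. X \<in> \<X> k \<Longrightarrow> oscillates A B X (L k)"
    and nxt: "m (Suc k) \<in> L k" "L (Suc k) \<subseteq> L k"
      "\<X> (Suc k) = (\<lambda>X. X \<inter> A (m (Suc k))) ` \<X> k \<union> (\<lambda>X. X \<inter> B (m (Suc k))) ` \<X> k" for k
    using s(1)[of k] s(2)[of k] unfolding P_def Q_def m_def L_def \<X>_def by (auto split: prod.splits)
  have base: "\<X> 0 = {S}" using s(1)[of 0] unfolding P_def \<X>_def by (auto split: prod.splits)
  define r where "r k = m (Suc k)" for k
  have "strict_mono r" using inv(3)[OF nxt(1)] by (auto simp: strict_mono_Suc_iff r_def)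
  moreover have "range r \<subseteq> M" using nxt(1) inv(1) by (auto simp: r_def)
  moreover have "\<exists>x\<in>S. \<forall>i<N. x \<in> (if i \<in> P then A (r i) else B (r i))" for N P
  proof -
    have "\<exists>X\<in>\<X> N. \<forall>x\<in>X. x \<in> S \<and> (\<forall>i<N. x \<in> (if i \<in> P then A (r i) else B (r i)))"
    proof (induction N)
      case 0
      then show ?case using base by auto
    next
      case (Suc N)
      then obtain X where X: "X \<in> \<X> N" "\<forall>x\<in>X. x \<in> S \<and> (\<forall>i<N. x \<in> (if i \<in> P then A (r i) else B (r i)))"
        by blast
      let ?X = "X \<inter> (if N \<in> P then A (r N) else B (r N))"
      have "?X \<in> \<X> (Suc N)" unfolding nxt(3) using X(1) by (auto simp: r_def)
      then show ?case using X(2) by (intro bexI[of _ ?X]) (auto simp: less_Suc_eq)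
    qed
    then obtain X where X: "X \<in> \<X> N" "\<forall>x\<in>X. x \<in> S \<and> (\<forall>i<N. x \<in> (if i \<in> P then A (r i) else B (r i)))"
      by blast
    obtain x where "x \<in> X" using inv(4)[OF X(1)] inv(2)[of N] unfolding oscillates_def by blast
    then show ?thesis using X(2) by blast
  qed
  ultimately show ?thesis using that by blast
qed

lemma two_cluster_points:
  fixes g :: "nat \<Rightarrow> complex"
  assumes b: "bounded (range g)" and nc: "\<not> Cauchy g"
  obtains u v where "u \<noteq> v" "\<And>e. e > 0 \<Longrightarrow> infinite {n. cmod (g n - u) < e}"
    "\<And>e. e > 0 \<Longrightarrow> infinite {n. cmod (g n - v) < e}"
proof -
  have cl: "infinite {n. cmod (g n - u) < e}"
    if t: "strict_mono t" and lim: "(g \<circ> t) \<longlonglongrightarrow> u" and e: "e > 0" for t u e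
  proof -
    obtain N where N: "\<forall>n\<ge>N. cmod (g (t n) - u) < e"
      using LIMSEQ_D[OF lim e] by auto
    have "infinite (t ` {N..})"
      using t by (simp add: finite_image_iff strict_mono_imp_inj_on infinite_Ici)
    moreover have "t ` {N..} \<subseteq> {n. cmod (g n - u) < e}" using N by auto
    ultimately show ?thesis by (meson finite_subset)
  qed
  obtain u t where u: "strict_mono t" "(g \<circ> t) \<longlonglongrightarrow> u"
    using bounded_imp_convergent_subsequence[OF b] by blast
  have "\<not> g \<longlonglongrightarrow> u" using nc LIMSEQ_imp_Cauchy by blast
  then obtain e where e: "e > 0" "\<forall>N. \<exists>n\<ge>N. \<not> cmod (g n - u) < e"
    unfolding LIMSEQ_iff by blast
  have "infinite {n. \<not> cmod (g n - u) < e}" (is "infinite ?K")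
    unfolding infinite_nat_iff_unbounded_le using e(2) by blast
  then obtain a :: "nat \<Rightarrow> nat" where a: "strict_mono a" "\<And>n. a n \<in> ?K"
    using infinite_enumerate by blast
  have "bounded (range (g \<circ> a))" using b by (rule bounded_subset) auto
  then obtain v c where v: "strict_mono c" "(g \<circ> a \<circ> c) \<longlonglongrightarrow> v"
    using bounded_imp_convergent_subsequence by blast
  have "(\<lambda>n. cmod ((g \<circ> a \<circ> c) n - u)) \<longlonglongrightarrow> cmod (v - u)" by (intro tendsto_intros v)
  then have "e \<le> cmod (v - u)"
    by (rule tendsto_lowerbound) (use a in \<open>auto simp: not_less\<close>)
  then have "u \<noteq> v" using e(1) by auto
  moreover have "(g \<circ> (a \<circ> c)) \<longlonglongrightarrow> v" using v(2) by (simp add: o_assoc)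
  ultimately show ?thesis
    using that[of u v] cl[OF u] cl[OF strict_mono_o[OF a(1) v(1)]] by blast
qed

text \<open>
  A bounded sequence that is not Cauchy at a point visits two disjoint discs infinitely often, and the
  discs may be taken from a countable list. If no pair of discs on the list oscillated on any infinite
  index set, a diagonal sequence would be tame for every pair, hence pointwise Cauchy.
\<close>

lemma pointwise_Cauchy_or_oscillates:
  fixes f :: "nat \<Rightarrow> 'k \<Rightarrow> complex"
  assumes bd: "\<And>x. x \<in> S \<Longrightarrow> bounded (range (\<lambda>n. f n x))"
  obtains (Cauchy) r :: "nat \<Rightarrow> nat" where "strict_mono r" "\<And>x. x \<in> S \<Longrightarrow> Cauchy (\<lambda>n. f (r n) x)"
  | (oscillates) p q M where "p \<noteq> q" "infinite M"
    "oscillates (\<lambda>n. {x. cmod (f n x - p) < cmod (p - q) / 8})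
       (\<lambda>n. {x. cmod (f n x - q) < cmod (p - q) / 8}) S M"
proof (rule ccontr)
  assume no: "\<not> thesis"
  define near where "near c p q n = {x. cmod (f n x - c) < cmod (p - q) / 8}" for c p q n
  define tame where "tame p q L \<longleftrightarrow>
    (\<forall>x\<in>S. finite {n \<in> L. x \<in> near p p q n} \<or> finite {n \<in> L. x \<in> near q p q n})" for p q L
  have step: "\<exists>L\<subseteq>M. infinite L \<and> tame p q L" if "p \<noteq> q" "infinite M" for p q M
    using no oscillates[OF that] unfolding oscillates_def tame_def near_def by blast
  obtain D :: "complex set" where D: "countable D" "\<And>X. open X \<Longrightarrow> X \<noteq> {} \<Longrightarrow> \<exists>d\<in>D. d \<in> X"
    using countable_dense_setE by blast
  have "D \<noteq> {}" using D(2)[of UNIV] by auto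
  then have rng: "range (from_nat_into (D \<times> D)) = D \<times> D" using D(1) by (simp add: range_from_nat_into)
  define pq where "pq = from_nat_into (D \<times> D)"
  define good where "good k L \<longleftrightarrow> (fst (pq k) \<noteq> snd (pq k) \<longrightarrow> tame (fst (pq k)) (snd (pq k)) L)" for k L
  have step': "\<exists>L\<subseteq>M. infinite L \<and> good k L" if "infinite M" for M k
    using step[OF _ that] that unfolding good_def by (cases "fst (pq k) = snd (pq k)") blast+
  define Q where "Q = (\<lambda>k (n::nat, L) (n', L'). L' \<subseteq> L \<and> n' \<in> L' \<and> n < n' \<and> good k L')"
  have "\<exists>s. \<forall>k::nat. infinite (snd (s k)) \<and> Q k (s k) (s (Suc k))"
  proof (rule dependent_nat_choice)
    show "\<exists>s :: nat \<times> nat set. infinite (snd s)" by (intro exI[of _ "(0, UNIV)"]) simp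
    fix s :: "nat \<times> nat set" and k
    assume "infinite (snd s)"
    then obtain L where L: "L \<subseteq> snd s" "infinite L" "good k L" using step' by blast
    then obtain n where "n \<in> L" "fst s < n" by (meson infinite_nat_iff_unbounded)
    then show "\<exists>s'. infinite (snd s') \<and> Q k s s'"
      using L unfolding Q_def by (intro exI[of _ "(n, L)"]) (auto split: prod.splits)
  qed
  then obtain s where s: "\<And>k. Q k (s k) (s (Suc k))" by blast
  define r L where "r k = fst (s k)" and "L k = snd (s k)" for k
  have nxt: "L (Suc k) \<subseteq> L k" "r (Suc k) \<in> L (Suc k)" "r k < r (Suc k)" "good k (L (Suc k))" for k
    using s[of k] unfolding Q_def r_def L_def by (auto split: prod.splits)
  have r: "strict_mono r" using nxt(3) by (simp add: strict_mono_Suc_iff)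
  have later: "r j \<in> L (Suc k)" if "k < j" for j k
  proof -
    have "L j \<subseteq> L (Suc k)" using lift_Suc_antimono_le[of L "Suc k" j] nxt(1) that by auto
    then show ?thesis using nxt(2)[of "j - 1"] that by auto
  qed
  have "Cauchy (\<lambda>n. f (r n) x)" if x: "x \<in> S" for x
  proof (rule ccontr)
    assume nc: "\<not> Cauchy (\<lambda>n. f (r n) x)"
    have "bounded (range (\<lambda>n. f (r n) x))" using bd[OF x] by (rule bounded_subset) auto
    from two_cluster_points[OF this nc] obtain u v where uv: "u \<noteq> v"
      and u: "\<And>e. e > 0 \<Longrightarrow> infinite {n. cmod (f (r n) x - u) < e}"
      and v: "\<And>e. e > 0 \<Longrightarrow> infinite {n. cmod (f (r n) x - v) < e}" by blast
    \<comment> \<open>Centres within \<open>e\<close> of \<open>u\<close> and \<open>v\<close> satisfy \<open>2 * e < cmod (p - q) / 8\<close>, so the discs about them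
      contain the \<open>e\<close>-discs about \<open>u\<close> and \<open>v\<close>.\<close>
    define e where "e = cmod (u - v) / 20"
    have e: "e > 0" using uv by (simp add: e_def)
    obtain p where p: "p \<in> D" "cmod (p - u) < e"
      using D(2)[of "ball u e"] e by (auto simp: dist_norm norm_minus_commute)
    obtain q where q: "q \<in> D" "cmod (q - v) < e"
      using D(2)[of "ball v e"] e by (auto simp: dist_norm norm_minus_commute)
    have "cmod (u - v) \<le> cmod (p - q) + cmod (p - u) + cmod (q - v)"
      using norm_triangle_ineq4[of "p - q" "p - u - (q - v)"] norm_triangle_ineq4[of "p - u" "q - v"]
      by (simp add: algebra_simps)
    then have pq18: "18 * e < cmod (p - q)" using p q unfolding e_def by linarith
    obtain k where k: "pq k = (p, q)" using rng p q unfolding pq_def by (metis SigmaI imageE)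
    have "p \<noteq> q" using pq18 e by auto
    then have tm: "tame p q (L (Suc k))" using nxt(4)[of k] k by (simp add: good_def)
    have inf: "infinite {n \<in> L (Suc k). x \<in> near c p q n}"
      if c: "cmod (c - w) < e" and w: "infinite {n. cmod (f (r n) x - w) < e}" for c w
    proof
      assume fin: "finite {n \<in> L (Suc k). x \<in> near c p q n}"
      have "r ` ({n. cmod (f (r n) x - w) < e} - {..k}) \<subseteq> {n \<in> L (Suc k). x \<in> near c p q n}"
      proof
        fix y assume "y \<in> r ` ({n. cmod (f (r n) x - w) < e} - {..k})"
        then obtain n where y: "y = r n" and n: "n \<notin> {..k}" "cmod (f (r n) x - w) < e" by blast
        have "cmod (f (r n) x - c) \<le> cmod (f (r n) x - w) + cmod (c - w)"
          using norm_triangle_ineq4[of "f (r n) x - w" "c - w"] by simp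
        then have "x \<in> near c p q (r n)" using n(2) c pq18 e unfolding near_def by auto
        then show "y \<in> {n \<in> L (Suc k). x \<in> near c p q n}" using later n(1) y by simp
      qed
      then have "finite (r ` ({n. cmod (f (r n) x - w) < e} - {..k}))" using fin finite_subset by blast
      then show False using w r by (simp add: finite_image_iff strict_mono_imp_inj_on)
    qed
    show False using tm inf[OF p(2) u[OF e]] inf[OF q(2) v[OF e]] x unfolding tame_def by blast
  qed
  then show False using no Cauchy[OF r] by blast
qed

text \<open>
  The complex form of Rosenthal's dichotomy. Discs that are small compared with the distance of their
  centres take the place of half planes, because both the real and the imaginary part of the values
  have to be controlled.
\<close>

theorem pointwise_Cauchy_or_independent:
  fixes f :: "nat \<Rightarrow> 'k \<Rightarrow> complex"
  assumes bd: "\<And>x. x \<in> S \<Longrightarrow> bounded (range (\<lambda>n. f n x))"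
  obtains (Cauchy) r :: "nat \<Rightarrow> nat" where "strict_mono r" "\<And>x. x \<in> S \<Longrightarrow> Cauchy (\<lambda>n. f (r n) x)"
  | (independent) p q and r :: "nat \<Rightarrow> nat" where "p \<noteq> q" "strict_mono r"
    "\<And>N P. \<exists>x\<in>S. \<forall>i<N. cmod (f (r i) x - (if i \<in> P then p else q)) < cmod (p - q) / 8"
proof (rule pointwise_Cauchy_or_oscillates[of S f])
  fix p q M
  assume pq: "p \<noteq> q" and M: "infinite M"
    and osc: "oscillates (\<lambda>n. {x. cmod (f n x - p) < cmod (p - q) / 8})
       (\<lambda>n. {x. cmod (f n x - q) < cmod (p - q) / 8}) S M"
  obtain r :: "nat \<Rightarrow> nat" where r: "strict_mono r"
    "\<And>N P. \<exists>x\<in>S. \<forall>i<N. x \<in> (if i \<in> P then {x. cmod (f (r i) x - p) < cmod (p - q) / 8}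
        else {x. cmod (f (r i) x - q) < cmod (p - q) / 8})"
    using oscillates_independent[OF M osc] by metis
  have "\<exists>x\<in>S. \<forall>i<N. cmod (f (r i) x - (if i \<in> P then p else q)) < cmod (p - q) / 8" for N P
  proof -
    obtain x where x: "x \<in> S" "\<forall>i<N. x \<in> (if i \<in> P then {x. cmod (f (r i) x - p) < cmod (p - q) / 8}
        else {x. cmod (f (r i) x - q) < cmod (p - q) / 8})" using r(2) by blast
    have "cmod (f (r i) x - (if i \<in> P then p else q)) < cmod (p - q) / 8" if "i < N" for i
      using x(2)[rule_format, OF that] by (auto split: if_splits)
    then show ?thesis using x(1) by blast
  qed
  then show ?thesis using independent[OF pq r(1)] by blast
qed (use bd Cauchy in blast)+

section \<open>Rosenthal's theorem on sequences equivalent to the basis of \<open>ell1\<close>\<close>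

text \<open>
  A sequence equivalent to the unit vector basis of \<open>ell1\<close>.
\<close>

definition ell1_sequence :: "'a::complex_vector nspace \<Rightarrow> (nat \<Rightarrow> 'a) \<Rightarrow> bool"
  where "ell1_sequence X x \<longleftrightarrow> range x \<subseteq> vcarrier X \<and> (\<exists>C. \<forall>n. vnorm X (x n) \<le> C) \<and>
    (\<exists>d>0. \<forall>N c. d * (\<Sum>i<N. cmod (c i)) \<le> vnorm X (\<Sum>i<N. c i *\<^sub>C x i))"

lemma ell1_sequenceI:
  assumes "\<And>n. x n \<in> vcarrier X" "\<And>n. vnorm X (x n) \<le> C" "d > 0"
    "\<And>N c. d * (\<Sum>i<N. cmod (c i)) \<le> vnorm X (\<Sum>i<N. c i *\<^sub>C x i)"
  shows "ell1_sequence X x"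
  unfolding ell1_sequence_def
  by (intro conjI exI[of _ C] exI[of _ d] allI image_subsetI assms)

lemma ell1_sequenceE:
  assumes "ell1_sequence X x"
  obtains C d where "\<And>n. x n \<in> vcarrier X" "\<And>n. vnorm X (x n) \<le> C" "d > 0"
    "\<And>N c. d * (\<Sum>i<N. cmod (c i)) \<le> vnorm X (\<Sum>i<N. c i *\<^sub>C x i)"
proof -
  have "range x \<subseteq> vcarrier X" using assms unfolding ell1_sequence_def by simp
  moreover obtain C where "\<forall>n. vnorm X (x n) \<le> C" using assms unfolding ell1_sequence_def by (elim conjE exE)
  moreover obtain d where "0 < d" "\<forall>N c. d * (\<Sum>i<N. cmod (c i)) \<le> vnorm X (\<Sum>i<N. c i *\<^sub>C x i)"
    using assms unfolding ell1_sequence_def by (elim conjE exE)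
  ultimately show ?thesis using that[of C d] by (simp add: image_subset_iff)
qed

text \<open>
  The coefficients of a combination of the subsequence are spread over the larger index range and
  padded with zeros.
\<close>

lemma ell1_sequence_subseq:
  assumes x: "ell1_sequence X x" and r: "strict_mono (r :: nat \<Rightarrow> nat)"
  shows "ell1_sequence X (x \<circ> r)"
proof -
  obtain C d where in': "\<And>n. x n \<in> vcarrier X" "\<And>n. vnorm X (x n) \<le> C"
    and d: "d > 0" "\<And>N c. d * (\<Sum>i<N. cmod (c i)) \<le> vnorm X (\<Sum>i<N. c i *\<^sub>C x i)"
    by (rule ell1_sequenceE[OF x]) (rule that)
  have "d * (\<Sum>i<N. cmod (c i)) \<le> vnorm X (\<Sum>i<N. c i *\<^sub>C x (r i))" for N c
  proof -
    have inj: "inj r" using r by (rule strict_mono_imp_inj_on)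
    define b where "b k = (if k \<in> r ` {..<N} then c (inv r k) else 0)" for k
    have br: "b (r i) = c i" if "i < N" for i using that inj by (simp add: b_def)
    have sub: "r ` {..<N} \<subseteq> {..<r N}" using r by (auto simp: strict_mono_less)
    have red: "(\<Sum>k<r N. h k) = (\<Sum>i<N. h (r i))" if "\<And>k. k \<notin> r ` {..<N} \<Longrightarrow> h k = 0"
      for h :: "nat \<Rightarrow> 'z::comm_monoid_add"
    proof -
      have "(\<Sum>k<r N. h k) = sum h (r ` {..<N})"
        using that by (intro sum.mono_neutral_right sub) auto
      also have "\<dots> = (\<Sum>i<N. h (r i))" using inj by (simp add: sum.reindex inj_on_subset)
      finally show ?thesis .
    qed
    have "(\<Sum>k<r N. cmod (b k)) = (\<Sum>i<N. cmod (c i))"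
      by (subst red) (auto simp: b_def br intro!: sum.cong simp: inv_f_f[OF inj])
    moreover have "(\<Sum>k<r N. b k *\<^sub>C x k) = (\<Sum>i<N. c i *\<^sub>C x (r i))"
      by (subst red) (auto simp: b_def br intro!: sum.cong simp: inv_f_f[OF inj])
    ultimately show ?thesis using d(2)[where N = "r N" and c = b] by simp
  qed
  then show ?thesis by (intro ell1_sequenceI[where C = C and d = d]) (simp_all add: in' d(1))
qed

context complex_normed_space
begin

text \<open>
  Two functionals with opposite patterns differ at \<open>x i\<close> by \<open>p - q\<close> up to sign, with an error of
  at most a quarter of its modulus. After multiplying the coefficients by \<open>- \<i>\<close> if necessary, at least
  half of the sum of their moduli comes from the real parts of \<open>c i * u\<close>, where \<open>u\<close> is the
  direction of \<open>p - q\<close>. Choosing the pattern according to the signs of these real parts leaves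
  \<open>1 / 2 - 1 / 4\<close> of the sum for the difference of two functionals of norm at most \<open>1\<close>.
\<close>

lemma independent_imp_ell1_lower:
  fixes x :: "nat \<Rightarrow> 'a"
  assumes x: "\<And>n. x n \<in> vcarrier X" and pq: "p \<noteq> q"
    and ind: "\<And>N P. \<exists>\<phi>\<in>dual_ball. \<forall>i<N. cmod (\<phi> (x i) - (if i \<in> P then p else q)) < cmod (p - q) / 8"
  shows "cmod (p - q) / 8 * (\<Sum>i<N. cmod (c i)) \<le> vnorm X (\<Sum>i<N. c i *\<^sub>C x i)"
proof -
  define w where "w = p - q"
  define u where "u = w / cmod w"
  have w: "w \<noteq> 0" using pq by (simp add: w_def)
  have u: "cmod u = 1" "cmod w * u = w" using w by (simp_all add: u_def norm_divide)
  have main: "cmod w / 8 * (\<Sum>i<N. cmod (c i)) \<le> vnorm X (\<Sum>i<N. c i *\<^sub>C x i)"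
    if half: "(\<Sum>i<N. cmod (c i)) \<le> 2 * (\<Sum>i<N. \<bar>Re (c i * u)\<bar>)" for c
  proof -
    define P where "P = {i. Re (c i * u) \<ge> 0}"
    define sg :: "nat \<Rightarrow> complex" where "sg i = (if i \<in> P then 1 else -1)" for i
    obtain \<phi> \<psi> where \<phi>: "\<phi> \<in> dual_ball" "\<And>i. i < N \<Longrightarrow> cmod (\<phi> (x i) - (if i \<in> P then p else q)) < cmod w / 8"
      and \<psi>: "\<psi> \<in> dual_ball" "\<And>i. i < N \<Longrightarrow> cmod (\<psi> (x i) - (if i \<in> - P then p else q)) < cmod w / 8"
      using ind[of N P] ind[of N "- P"] unfolding w_def by blast
    let ?y = "\<Sum>i<N. c i *\<^sub>C x i"
    have y: "?y \<in> vcarrier X" by (intro sum_in scale_in x)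
    have comb: "\<theta> ?y = (\<Sum>i<N. c i * \<theta> (x i))" if "\<theta> \<in> dual_ball" for \<theta>
    proof -
      have op: "\<theta> \<in> operators X complex_scalars" using that by (simp add: dual_ball_def)
      have "\<theta> ?y = (\<Sum>i<N. \<theta> (c i *\<^sub>C x i))"
        by (rule operators_sum[OF complex_normed_space_axioms op]) (intro scale_in x)
      then show ?thesis using functional_scale[OF op x] by simp
    qed
    define err where "err i = \<phi> (x i) - \<psi> (x i) - sg i * w" for i
    have err: "cmod (err i) \<le> cmod w / 4" if i: "i < N" for i
    proof -
      have "err i = (\<phi> (x i) - (if i \<in> P then p else q)) - (\<psi> (x i) - (if i \<in> - P then p else q))"
        by (simp add: err_def sg_def w_def)
      then show ?thesis
        using norm_triangle_ineq4[of "\<phi> (x i) - (if i \<in> P then p else q)" "\<psi> (x i) - (if i \<in> - P then p else q)"]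
          \<phi>(2)[OF i] \<psi>(2)[OF i] by simp
    qed
    have eq: "\<phi> ?y - \<psi> ?y = cmod w * (\<Sum>i<N. sg i * (c i * u)) + (\<Sum>i<N. c i * err i)"
    proof -
      have "\<phi> ?y - \<psi> ?y = (\<Sum>i<N. c i * \<phi> (x i) - c i * \<psi> (x i))"
        by (simp add: comb \<phi> \<psi> sum_subtractf)
      also have "\<dots> = (\<Sum>i<N. (sg i * c i) * (cmod w * u) + c i * err i)"
        unfolding u(2) by (simp add: err_def algebra_simps)
      also have "\<dots> = (\<Sum>i<N. cmod w * (sg i * (c i * u)) + c i * err i)"
        by (simp only: mult_ac)
      finally show ?thesis by (simp only: sum.distrib sum_distrib_left)
    qed
    have "Re (sg i * (c i * u)) = \<bar>Re (c i * u)\<bar>" for i by (auto simp: sg_def P_def)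
    then have "(\<Sum>i<N. \<bar>Re (c i * u)\<bar>) = Re (\<Sum>i<N. sg i * (c i * u))" by simp
    also have "\<dots> \<le> cmod (\<Sum>i<N. sg i * (c i * u))" by (rule complex_Re_le_cmod)
    finally have "cmod w * ((\<Sum>i<N. cmod (c i)) / 2) \<le> cmod w * cmod (\<Sum>i<N. sg i * (c i * u))"
      using half by (intro mult_left_mono) auto
    also have "\<dots> = cmod (cmod w * (\<Sum>i<N. sg i * (c i * u)))" by (simp add: norm_mult)
    also have "\<dots> \<le> cmod (\<phi> ?y - \<psi> ?y) + cmod (\<Sum>i<N. c i * err i)"
      unfolding eq using norm_triangle_ineq4[of "cmod w * (\<Sum>i<N. sg i * (c i * u)) + (\<Sum>i<N. c i * err i)"
          "\<Sum>i<N. c i * err i"] by simp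
    also have "cmod (\<phi> ?y - \<psi> ?y) \<le> 2 * vnorm X ?y"
      using norm_triangle_ineq4[of "\<phi> ?y" "\<psi> ?y"] \<phi>(1) \<psi>(1) y unfolding dual_ball_def by force
    also have "cmod (\<Sum>i<N. c i * err i) \<le> (\<Sum>i<N. cmod (c i) * (cmod w / 4))"
      by (rule sum_norm_le) (simp only: norm_mult lessThan_iff, rule mult_left_mono[OF err norm_ge_zero])
    also have "\<dots> = (\<Sum>i<N. cmod (c i)) * (cmod w / 4)" by (rule sum_distrib_right[symmetric])
    finally show ?thesis by (simp add: algebra_simps)
  qed
  consider "(\<Sum>i<N. cmod (c i)) \<le> 2 * (\<Sum>i<N. \<bar>Re (c i * u)\<bar>)"
    | "(\<Sum>i<N. cmod (c i)) \<le> 2 * (\<Sum>i<N. \<bar>Im (c i * u)\<bar>)"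
  proof -
    have "cmod (c i) \<le> \<bar>Re (c i * u)\<bar> + \<bar>Im (c i * u)\<bar>" for i
      using cmod_le[of "c i * u"] u(1) by (simp only: norm_mult)
    then have "(\<Sum>i<N. cmod (c i)) \<le> (\<Sum>i<N. \<bar>Re (c i * u)\<bar> + \<bar>Im (c i * u)\<bar>)" by (rule sum_mono)
    then show ?thesis using that unfolding sum.distrib by linarith
  qed
  then show ?thesis
  proof cases
    case 1
    then show ?thesis using main[of c] by (simp add: w_def)
  next
    case 2
    define b where "b i = - \<i> * c i" for i
    have b: "cmod (b i) = cmod (c i)" "Re (b i * u) = Im (c i * u)" for i
      by (simp_all add: b_def norm_mult)
    have "(\<Sum>i<N. b i *\<^sub>C x i) = (- \<i>) *\<^sub>C (\<Sum>i<N. c i *\<^sub>C x i)"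
      by (simp only: b_def complex_vector.scale_sum_right scaleC_scaleC)
    then have "vnorm X (\<Sum>i<N. b i *\<^sub>C x i) = vnorm X (\<Sum>i<N. c i *\<^sub>C x i)"
      using norm_scale[OF sum_in[of "{..<N}" "\<lambda>i. c i *\<^sub>C x i"], of "- \<i>"] by (simp add: scale_in x)
    then show ?thesis using main[of b] 2 by (simp only: b w_def)
  qed
qed

lemma weakly_CauchyI:
  assumes x: "\<And>n. x n \<in> vcarrier X" and C: "\<And>\<phi>. \<phi> \<in> dual_ball \<Longrightarrow> Cauchy (\<lambda>n. \<phi> (x n))"
  shows "weakly_Cauchy X x"
  unfolding weakly_Cauchy_def
proof (intro conjI ballI)
  fix \<phi> assume "\<phi> \<in> vcarrier (dual X)"
  then have \<phi>: "\<phi> \<in> operators X complex_scalars" by (simp add: dual_def)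
  obtain K where K: "K > 0" "\<And>y. y \<in> vcarrier X \<Longrightarrow> cmod (\<phi> y) \<le> K * vnorm X y"
    using functional_bounded[OF complex_normed_space_axioms \<phi>] by blast
  let ?\<psi> = "\<lambda>y. of_real (1 / K) * \<phi> y"
  have bd: "cmod (?\<psi> y) \<le> 1 * vnorm X y" if "y \<in> vcarrier X" for y
    using K(2)[OF that] K(1) by (simp add: norm_mult norm_divide field_simps)
  have "?\<psi> \<in> operators X complex_scalars"
    by (rule functionalI[OF complex_normed_space_axioms _ _ _ bd])
      (use K(1) \<phi> in \<open>simp_all add: operators_add[OF \<phi>] functional_scale[OF \<phi>] operators_off[OF \<phi>] algebra_simps\<close>)
  then have "?\<psi> \<in> dual_ball" using bd by (simp add: dual_ball_def)
  then have "convergent (\<lambda>n. ?\<psi> (x n))" using C[of ?\<psi>] by (simp only: Cauchy_convergent_iff)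
  from convergent_mult[OF convergent_const[of "of_real K"] this]
  show "Cauchy (\<lambda>n. \<phi> (x n))" using K(1) by (simp add: Cauchy_convergent_iff)
qed (use x in auto)

lemma weakly_CauchyD:
  "weakly_Cauchy X x \<Longrightarrow> \<phi> \<in> operators X complex_scalars \<Longrightarrow> Cauchy (\<lambda>n. \<phi> (x n))"
  by (simp add: weakly_Cauchy_def dual_def)

lemma bounded_on_dual_ball:
  assumes "\<And>n. x n \<in> vcarrier X" "\<And>n. vnorm X (x n) \<le> C" "\<phi> \<in> dual_ball"
  shows "bounded (range (\<lambda>n. \<phi> (x n)))"
  using assms unfolding bounded_iff dual_ball_def by (auto intro!: exI[of _ C]) (meson order_trans)

text \<open>
  Rosenthal's theorem in the form given by Dor for complex scalars: the sequence is regarded as a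
  sequence of functions on the dual ball.
\<close>

theorem Rosenthal_ell1_dichotomy:
  assumes x: "\<And>n. x n \<in> vcarrier X" and C: "\<And>n. vnorm X (x n) \<le> C"
  shows "\<exists>r :: nat \<Rightarrow> nat. strict_mono r \<and> (weakly_Cauchy X (x \<circ> r) \<or> ell1_sequence X (x \<circ> r))"
proof (rule pointwise_Cauchy_or_independent[of dual_ball "\<lambda>n \<phi>. \<phi> (x n)"])
  show "bounded (range (\<lambda>n. \<phi> (x n)))" if "\<phi> \<in> dual_ball" for \<phi>
    using bounded_on_dual_ball[OF x C that] .
next
  fix r :: "nat \<Rightarrow> nat"
  assume "strict_mono r" "\<And>\<phi>. \<phi> \<in> dual_ball \<Longrightarrow> Cauchy (\<lambda>n. \<phi> (x (r n)))"
  then show ?thesis using x by (intro exI[of _ r]) (auto intro!: weakly_CauchyI)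
next
  fix p q and r :: "nat \<Rightarrow> nat"
  assume pq: "p \<noteq> q" and r: "strict_mono r"
    and ind: "\<And>N P. \<exists>\<phi>\<in>dual_ball. \<forall>i<N. cmod (\<phi> (x (r i)) - (if i \<in> P then p else q)) < cmod (p - q) / 8"
  have "cmod (p - q) / 8 > 0" using pq by simp
  then have "ell1_sequence X (x \<circ> r)"
    by (rule ell1_sequenceI[where C = C, rotated 2]) (use x C independent_imp_ell1_lower[OF x pq ind] in simp_all)
  then show ?thesis using r by blast
qed

text \<open>
  The functional that takes the values \<open>(-1) ^ i\<close> on the sequence is bounded on its span by the lower
  estimate, and extends to the whole space.
\<close>

lemma ell1_sequence_not_weakly_Cauchy:
  assumes "ell1_sequence X x"
  shows "\<not> weakly_Cauchy X x"
proof
  assume wC: "weakly_Cauchy X x"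
  obtain C d where x: "\<And>n. x n \<in> vcarrier X" "\<And>n. vnorm X (x n) \<le> C" and d: "d > 0"
    "\<And>N c. d * (\<Sum>i<N. cmod (c i)) \<le> vnorm X (\<Sum>i<N. c i *\<^sub>C x i)"
    by (rule ell1_sequenceE[OF assms]) (rule that)
  define R where "R = {(\<Sum>i<N. c i *\<^sub>C x i, \<Sum>i<N. c i * (-1) ^ i) | N c. True}"
  have I: "(\<Sum>i<N. c i *\<^sub>C x i, \<Sum>i<N. c i * (-1) ^ i) \<in> R" for N c
    unfolding R_def by blast
  obtain \<psi> where \<psi>: "\<psi> \<in> operators X complex_scalars" "\<And>y s. (y, s) \<in> R \<Longrightarrow> \<psi> y = s"
  proof (rule Hahn_Banach[of R "1 / d"])
    show "R \<subseteq> vcarrier X \<times> UNIV" unfolding R_def using x by (auto intro!: sum_in scale_in)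
    show "R \<noteq> {}" using I by blast
    show "(y + z, s + t) \<in> R" if ys: "(y, s) \<in> R" and zt: "(z, t) \<in> R" for y s z t
    proof -
      obtain N c where c: "y = (\<Sum>i<N. c i *\<^sub>C x i)" "s = (\<Sum>i<N. c i * (-1) ^ i)"
        using ys unfolding R_def by blast
      obtain M b where b: "z = (\<Sum>i<M. b i *\<^sub>C x i)" "t = (\<Sum>i<M. b i * (-1) ^ i)"
        using zt unfolding R_def by blast
      let ?K = "max N M"
      let ?c = "\<lambda>i. if i < N then c i else 0" and ?b = "\<lambda>i. if i < M then b i else 0"
      have pad: "(\<Sum>i<n. h i) = (\<Sum>i<?K. if i < n then h i else 0)" if "n \<le> ?K"
        for n and h :: "nat \<Rightarrow> 'z::comm_monoid_add"
      proof -
        have "(\<Sum>i<?K. if i < n then h i else 0) = (\<Sum>i<n. if i < n then h i else 0)"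
          using that by (intro sum.mono_neutral_right) auto
        then show ?thesis by simp
      qed
      have "y = (\<Sum>i<?K. ?c i *\<^sub>C x i)" "s = (\<Sum>i<?K. ?c i * (-1) ^ i)"
        unfolding c by (subst pad, simp, rule sum.cong, auto)+
      moreover have "z = (\<Sum>i<?K. ?b i *\<^sub>C x i)" "t = (\<Sum>i<?K. ?b i * (-1) ^ i)"
        unfolding b by (subst pad, simp, rule sum.cong, auto)+
      ultimately have "y + z = (\<Sum>i<?K. (?c i + ?b i) *\<^sub>C x i)"
        "s + t = (\<Sum>i<?K. (?c i + ?b i) * (-1) ^ i)"
        by (simp_all only: sum.distrib scaleC_add_left distrib_right)
      then show ?thesis using I by metis
    qed
    show "(a *\<^sub>C y, a * s) \<in> R" if ys: "(y, s) \<in> R" for a y s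
    proof -
      obtain N c where c: "y = (\<Sum>i<N. c i *\<^sub>C x i)" "s = (\<Sum>i<N. c i * (-1) ^ i)"
        using ys unfolding R_def by blast
      have "a *\<^sub>C y = (\<Sum>i<N. (a * c i) *\<^sub>C x i)" "a * s = (\<Sum>i<N. (a * c i) * (-1) ^ i)"
        unfolding c by (simp_all add: complex_vector.scale_sum_right sum_distrib_left mult.assoc)
      then show ?thesis using I by metis
    qed
    show "cmod s \<le> 1 / d * vnorm X y" if ys: "(y, s) \<in> R" for y s
    proof -
      obtain N c where c: "y = (\<Sum>i<N. c i *\<^sub>C x i)" "s = (\<Sum>i<N. c i * (-1) ^ i)"
        using ys unfolding R_def by blast
      have "cmod s \<le> (\<Sum>i<N. cmod (c i))"
        unfolding c by (intro sum_norm_le) (simp add: norm_mult norm_power)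
      then have "d * cmod s \<le> d * (\<Sum>i<N. cmod (c i))" using d(1) by (intro mult_left_mono) auto
      also have "\<dots> \<le> vnorm X y" unfolding c(1) by (rule d(2))
      finally show ?thesis using d(1) by (simp add: field_simps)
    qed
  qed (use d in auto)
  have "\<psi> (x n) = (-1) ^ n" for n
  proof -
    have "(\<Sum>i<Suc n. (if i = n then 1 else 0) *\<^sub>C x i) = x n"
      "(\<Sum>i<Suc n. (if i = n then 1 else 0) * (-1) ^ i) = (-1 :: complex) ^ n"
      by (simp_all add: scaleC_one)
    then show ?thesis using \<psi>(2)[OF I[where N = "Suc n" and c = "\<lambda>i. if i = n then 1 else 0"]] by metis
  qed
  then have "Cauchy (\<lambda>n. (-1 :: complex) ^ n)" using weakly_CauchyD[OF wC \<psi>(1)] by simp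
  then obtain M where "\<forall>m\<ge>M. \<forall>n\<ge>M. dist ((-1 :: complex) ^ m) ((-1) ^ n) < 1"
    unfolding Cauchy_def by (metis zero_less_one)
  then have "dist ((-1 :: complex) ^ M) ((-1) ^ Suc M) < 1" by (metis le_refl le_SucI)
  moreover have "(-1 :: complex) ^ M - (-1) ^ Suc M = 2 * (-1) ^ M" by simp
  ultimately show False by (simp only: dist_norm norm_mult norm_power) simp
qed

end

definition vlim :: "'a::complex_vector nspace \<Rightarrow> (nat \<Rightarrow> 'a) \<Rightarrow> 'a \<Rightarrow> bool"
  where "vlim X s y \<longleftrightarrow> range s \<subseteq> vcarrier X \<and> y \<in> vcarrier X \<and> (\<lambda>n. vnorm X (s n - y)) \<longlonglongrightarrow> 0"

context complex_normed_space
begin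

lemma vlim_norm:
  assumes "vlim X s y" shows "(\<lambda>n. vnorm X (s n)) \<longlonglongrightarrow> vnorm X y"
proof (rule LIMSEQ_I)
  fix e :: real assume "e > 0"
  then obtain N where N: "\<forall>n\<ge>N. norm (vnorm X (s n - y) - 0) < e"
    using LIMSEQ_D assms unfolding vlim_def by blast
  have in': "s n \<in> vcarrier X" "y \<in> vcarrier X" for n using assms by (auto simp: vlim_def)
  have "\<bar>vnorm X (s n) - vnorm X y\<bar> \<le> vnorm X (s n - y)" for n
    using norm_triangle[OF diff_in[OF in'(1)[of n] in'(2)] in'(2)]
      norm_diff_triangle[OF in'(1)[of n] diff_in[OF in'(1)[of n] in'(2)]] by simp
  then show "\<exists>N. \<forall>n\<ge>N. norm (vnorm X (s n) - vnorm X y) < e"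
    using N by (metis (no_types, lifting) abs_ge_self diff_zero le_less_trans real_norm_def)
qed

lemma vlim_unique:
  assumes "vlim X s y" "vlim X s z" shows "y = z"
proof -
  have in': "s n \<in> vcarrier X" "y \<in> vcarrier X" "z \<in> vcarrier X" for n
    using assms by (auto simp: vlim_def)
  have "(\<lambda>n. vnorm X (s n - y) + vnorm X (s n - z)) \<longlonglongrightarrow> 0 + 0"
    using assms by (intro tendsto_add) (auto simp: vlim_def)
  moreover have "vnorm X (y - z) \<le> vnorm X (s n - y) + vnorm X (s n - z)" for n
    using norm_diff_triangle[OF diff_in[OF in'(1,3)] diff_in[OF in'(1,2)], of n n] by simp
  ultimately have "vnorm X (y - z) \<le> 0" using LIMSEQ_le_const by fastforce
  then show ?thesis using norm_nonneg norm_eq_zero diff_in in' by (metis eq_iff_diff_eq_0 order_antisym)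
qed

lemma vlim_add:
  assumes "vlim X s y" "vlim X t z" shows "vlim X (\<lambda>n. s n + t n) (y + z)"
proof -
  have in': "s n \<in> vcarrier X" "t n \<in> vcarrier X" "y \<in> vcarrier X" "z \<in> vcarrier X" for n
    using assms by (auto simp: vlim_def)
  have lim: "(\<lambda>n. vnorm X (s n - y) + vnorm X (t n - z)) \<longlonglongrightarrow> 0 + 0"
    using assms by (intro tendsto_add) (auto simp: vlim_def)
  have le: "vnorm X (s n + t n - (y + z)) \<le> vnorm X (s n - y) + vnorm X (t n - z)" for n
    using norm_triangle[OF diff_in[OF in'(1,3)] diff_in[OF in'(2,4)], of n n] by (simp add: algebra_simps)
  have ge: "0 \<le> vnorm X (s n + t n - (y + z))" for n by (intro norm_nonneg diff_in add_in in')
  have "(\<lambda>n. vnorm X (s n + t n - (y + z))) \<longlonglongrightarrow> 0"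
    by (rule tendsto_sandwich[OF _ _ tendsto_const lim[simplified]])
      (use le ge in auto)
  then show ?thesis using in' by (auto simp: vlim_def add_in)
qed

lemma vlim_scale:
  assumes "vlim X s y" shows "vlim X (\<lambda>n. a *\<^sub>C s n) (a *\<^sub>C y)"
proof -
  have in': "s n \<in> vcarrier X" "y \<in> vcarrier X" for n
    using assms by (auto simp: vlim_def)
  have "vnorm X (a *\<^sub>C s n - a *\<^sub>C y) = cmod a * vnorm X (s n - y)" for n
    using norm_scale[OF diff_in[OF in'], of a n] by (simp add: complex_vector.scale_right_diff_distrib)
  moreover have "(\<lambda>n. cmod a * vnorm X (s n - y)) \<longlonglongrightarrow> cmod a * 0"
    using assms by (intro tendsto_mult_left) (auto simp: vlim_def)
  ultimately show ?thesis using in' by (auto simp: vlim_def scale_in)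
qed

end

section \<open>Isomorphic copies of \<open>ell1\<close>\<close>

lemma complex_normed_space_ell1: "complex_normed_space ell1"
proof
  have "0 \<in> vcarrier ell1" by (simp add: ell1_def)
  moreover have "a + b \<in> vcarrier ell1" if "a \<in> vcarrier ell1" "b \<in> vcarrier ell1" for a b
  proof -
    have s: "summable (\<lambda>n. cmod (a n))" "summable (\<lambda>n. cmod (b n))" using that by (simp_all add: ell1_def)
    have "summable (\<lambda>n. cmod ((a + b) n))"
      by (rule summable_comparison_test'[OF summable_add[OF s]]) (simp add: norm_triangle_ineq)
    then show ?thesis by (simp add: ell1_def)
  qed
  moreover have "c *\<^sub>C a \<in> vcarrier ell1" if "a \<in> vcarrier ell1" for c a
    using that summable_mult[of "\<lambda>n. cmod (a n)" "cmod c"]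
    by (simp add: ell1_def scaleC_fun_def scaleC_complex_def norm_mult)
  ultimately show "complex_vector.subspace (vcarrier ell1)"
    unfolding complex_vector.subspace_def by blast
next
  fix a :: "nat \<Rightarrow> complex" assume a: "a \<in> vcarrier ell1"
  show "vnorm ell1 a = 0 \<longleftrightarrow> a = 0"
    using suminf_eq_zero_iff[of "\<lambda>n. cmod (a n)"] a by (auto simp: ell1_def zero_fun_def fun_eq_iff)
  show "vnorm ell1 (c *\<^sub>C a) = cmod c * vnorm ell1 a" for c
    using suminf_mult[of "\<lambda>n. cmod (a n)" "cmod c"] a
    by (simp add: ell1_def scaleC_fun_def scaleC_complex_def norm_mult)
next
  fix a b :: "nat \<Rightarrow> complex" assume a: "a \<in> vcarrier ell1" and b: "b \<in> vcarrier ell1"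
  have s: "summable (\<lambda>n. cmod (a n))" "summable (\<lambda>n. cmod (b n))" using a b by (simp_all add: ell1_def)
  have "(\<Sum>n. cmod ((a + b) n)) \<le> (\<Sum>n. cmod (a n) + cmod (b n))"
  proof (rule suminf_le)
    show "summable (\<lambda>n. cmod ((a + b) n))"
      by (rule summable_comparison_test'[OF summable_add[OF s]]) (simp add: plus_fun_def norm_triangle_ineq)
  qed (auto simp: plus_fun_def norm_triangle_ineq summable_add s)
  then show "vnorm ell1 (a + b) \<le> vnorm ell1 a + vnorm ell1 b"
    using suminf_add[OF s] by (simp add: ell1_def)
qed

text \<open>
  The image of an open set \<open>U\<close> is cut out by the union of the balls of radius \<open>d * r\<close> about \<open>J a\<close>,
  where \<open>r\<close> is the radius of a ball about \<open>a\<close> inside \<open>U\<close>.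
\<close>

lemma embedding_map_if_bounded_below:
  assumes Y: "complex_normed_space Y" and X: "complex_normed_space X"
    and J: "J \<in> operators Y X" and d: "d > 0" "\<And>a. a \<in> vcarrier Y \<Longrightarrow> d * vnorm Y a \<le> vnorm X (J a)"
  shows "embedding_map (vtopology Y) (vtopology X) J"
proof -
  interpret Y: complex_normed_space Y by fact
  interpret X: complex_normed_space X by fact
  note Jin = operators_in[OF Y X J]
  have diff: "d * vnorm Y (a - b) \<le> vnorm X (J a - J b)" if "a \<in> vcarrier Y" "b \<in> vcarrier Y" for a b
    using d(2)[OF Y.diff_in[OF that]] operators_diff[OF Y J that] by simp
  have inj: "inj_on J (vcarrier Y)"
  proof (rule inj_onI)
    fix a b assume ab: "a \<in> vcarrier Y" "b \<in> vcarrier Y" "J a = J b"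
    then have "d * vnorm Y (a - b) \<le> 0" using diff[of a b] by simp
    then have "vnorm Y (a - b) = 0"
      using d(1) Y.norm_nonneg[OF Y.diff_in[OF ab(1,2)]] by (simp add: mult_le_0_iff)
    then show "a = b" using Y.norm_eq_zero Y.diff_in ab by simp
  qed
  let ?S = "J ` vcarrier Y"
  have "open_map (vtopology Y) (subtopology (vtopology X) ?S) J"
    unfolding open_map_def
  proof (intro allI impI)
    fix U assume U: "openin (vtopology Y) U"
    then have UY: "U \<subseteq> vcarrier Y" using Y.openin_vtopology by blast
    define V where "V = {y \<in> vcarrier X. \<exists>a\<in>U. \<exists>r>0. (\<forall>b\<in>vcarrier Y. vnorm Y (b - a) < r \<longrightarrow> b \<in> U) \<and>
        vnorm X (y - J a) < d * r}"
    have "openin (vtopology X) V"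
      unfolding X.openin_vtopology
    proof (intro conjI ballI)
      show "V \<subseteq> vcarrier X" by (auto simp: V_def)
      fix y assume "y \<in> V"
      then obtain a r where y: "y \<in> vcarrier X" and a: "a \<in> U" "r > 0"
        "\<forall>b\<in>vcarrier Y. vnorm Y (b - a) < r \<longrightarrow> b \<in> U" "vnorm X (y - J a) < d * r"
        unfolding V_def by blast
      have "z \<in> V" if z: "z \<in> vcarrier X" "vnorm X (z - y) < d * r - vnorm X (y - J a)" for z
      proof -
        have "vnorm X (z - J a) \<le> vnorm X (z - y) + vnorm X (y - J a)"
          using X.norm_triangle[OF X.diff_in[OF z(1) y] X.diff_in[OF y Jin]] by simp
        then show ?thesis using z a unfolding V_def by force
      qed
      then show "\<exists>e>0. \<forall>z\<in>vcarrier X. vnorm X (z - y) < e \<longrightarrow> z \<in> V"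
        using a(4) by (intro exI[of _ "d * r - vnorm X (y - J a)"]) simp
    qed
    moreover have "J ` U = V \<inter> ?S"
    proof
      show "J ` U \<subseteq> V \<inter> ?S"
      proof
        fix y assume "y \<in> J ` U"
        then obtain a where a: "a \<in> U" "y = J a" by blast
        then obtain r where "r > 0" "\<forall>b\<in>vcarrier Y. vnorm Y (b - a) < r \<longrightarrow> b \<in> U"
          using U unfolding Y.openin_vtopology by blast
        moreover from this(1) have "vnorm X (y - J a) < d * r" using a d(1) by simp
        moreover have "y \<in> vcarrier X" "y \<in> ?S" using a UY Jin by auto
        ultimately show "y \<in> V \<inter> ?S" using a(1) unfolding V_def by blast
      qed
      show "V \<inter> ?S \<subseteq> J ` U"
      proof
        fix y assume y: "y \<in> V \<inter> ?S"
        then obtain b where b: "b \<in> vcarrier Y" "y = J b" by blast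
        from y obtain a r where a: "a \<in> U" "r > 0"
          "\<forall>b\<in>vcarrier Y. vnorm Y (b - a) < r \<longrightarrow> b \<in> U" "vnorm X (y - J a) < d * r"
          unfolding V_def by blast
        have "d * vnorm Y (b - a) < d * r" using diff[OF b(1), of a] a b UY by auto
        then show "y \<in> J ` U" using a(3) b d(1) by simp
      qed
    qed
    ultimately show "openin (subtopology (vtopology X) ?S) (J ` U)"
      unfolding openin_subtopology by blast
  qed
  moreover have "continuous_map (vtopology Y) (subtopology (vtopology X) ?S) J"
    using J by (simp add: continuous_map_in_subtopology operators_def)
  ultimately show ?thesis
    unfolding embedding_map_def using inj Jin
    by (intro bijective_open_imp_homeomorphic_map) auto
qed

text \<open>
  The image of the open unit ball contains all points of the range of norm less than some \<open>r\<close>, so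
  vectors of norm \<open>1\<close> have images of norm at least \<open>r\<close>.
\<close>

lemma embedding_map_bounded_below:
  assumes Y: "complex_normed_space Y" and X: "complex_normed_space X"
    and J: "J \<in> operators Y X" and emb: "embedding_map (vtopology Y) (vtopology X) J"
  obtains d where "d > 0" "\<And>a. a \<in> vcarrier Y \<Longrightarrow> d * vnorm Y a \<le> vnorm X (J a)"
proof -
  interpret Y: complex_normed_space Y by fact
  interpret X: complex_normed_space X by fact
  let ?S = "J ` vcarrier Y" and ?B = "{a \<in> vcarrier Y. vnorm Y a < 1}"
  have hom: "homeomorphic_map (vtopology Y) (subtopology (vtopology X) ?S) J"
    using emb by (simp add: embedding_map_def)
  have inj: "inj_on J (vcarrier Y)" using homeomorphic_imp_injective_map[OF hom] by simp
  have "openin (vtopology Y) ?B"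
    unfolding Y.openin_vtopology
  proof (intro conjI ballI)
    fix a assume a: "a \<in> ?B"
    have "b \<in> ?B" if "b \<in> vcarrier Y" "vnorm Y (b - a) < 1 - vnorm Y a" for b
      using Y.norm_triangle[OF Y.diff_in[of b a], of a] that a by auto
    then show "\<exists>r>0. \<forall>b\<in>vcarrier Y. vnorm Y (b - a) < r \<longrightarrow> b \<in> ?B"
      using a by (intro exI[of _ "1 - vnorm Y a"]) auto
  qed auto
  then have "openin (subtopology (vtopology X) ?S) (J ` ?B)"
    using homeomorphic_imp_open_map[OF hom] by (simp add: open_map_def)
  then obtain V where V: "openin (vtopology X) V" "J ` ?B = V \<inter> ?S"
    unfolding openin_subtopology by blast
  have "J 0 \<in> J ` ?B" by (rule imageI) simp
  then have "0 \<in> V" using V(2) J by simp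
  then obtain r where r: "r > 0" "\<And>y. y \<in> vcarrier X \<Longrightarrow> vnorm X (y - 0) < r \<Longrightarrow> y \<in> V"
    using V(1) unfolding X.openin_vtopology by blast
  have "r * vnorm Y a \<le> vnorm X (J a)" if a: "a \<in> vcarrier Y" for a
  proof (cases "a = 0")
    case False
    have pos: "vnorm Y a > 0" using False a Y.norm_eq_zero Y.norm_nonneg by force
    define b where "b = of_real (1 / vnorm Y a) *\<^sub>C a"
    have c: "cmod (of_real (1 / vnorm Y a)) = 1 / vnorm Y a" using pos by (simp only: norm_of_real) simp
    have b: "b \<in> vcarrier Y" "vnorm Y b = 1"
      using pos c by (simp_all only: b_def Y.scale_in[OF a] Y.norm_scale[OF a]) simp
    have Jb: "vnorm X (J b) = vnorm X (J a) / vnorm Y a"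
      using X.norm_scale[OF operators_in[OF Y X J, of a]] c by (simp only: b_def operators_scale[OF J a]) simp
    have "\<not> vnorm X (J b) < r"
    proof
      assume "vnorm X (J b) < r"
      then have "J b \<in> V \<inter> ?S" using r(2) operators_in[OF Y X J] b by simp
      then have "J b \<in> J ` ?B" by (simp only: V(2))
      then obtain b' where b': "J b = J b'" "b' \<in> ?B" by (elim imageE)
      then have "b = b'" using inj_onD[OF inj b'(1)] b(1) by simp
      then show False using b' b by simp
    qed
    then show ?thesis unfolding Jb using pos by (simp add: field_simps)
  qed (use J in simp)
  then show ?thesis using that r(1) by blast
qed

lemma contains_ell1_imp_ell1_sequence:
  assumes X: "complex_normed_space X" and emb: "contains_isomorphic_copy X ell1"
  obtains x where "ell1_sequence X x"
proof -
  note L = complex_normed_space_ell1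
  obtain J where J: "J \<in> operators ell1 X" "embedding_map (vtopology ell1) (vtopology X) J"
    using emb unfolding contains_isomorphic_copy_def by blast
  obtain d where d: "d > 0" "\<And>a. a \<in> vcarrier ell1 \<Longrightarrow> d * vnorm ell1 a \<le> vnorm X (J a)"
    using embedding_map_bounded_below[OF L X J] by blast
  obtain C where C: "C > 0" "\<And>a. a \<in> vcarrier ell1 \<Longrightarrow> vnorm X (J a) \<le> C * vnorm ell1 a"
    using operators_bounded[OF L X J(1)] by blast
  define e :: "nat \<Rightarrow> nat \<Rightarrow> complex" where "e k = (\<lambda>n. if n = k then 1 else 0)" for k
  have fin: "a \<in> vcarrier ell1 \<and> vnorm ell1 a = (\<Sum>n<N. cmod (a n))" if "\<And>n. n \<ge> N \<Longrightarrow> a n = 0" for a N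
  proof -
    have "(\<lambda>n. cmod (a n)) sums (\<Sum>n<N. cmod (a n))"
      by (rule sums_finite) (use that in \<open>auto simp: not_less\<close>)
    then show ?thesis by (simp add: ell1_def sums_iff)
  qed
  have e: "e k \<in> vcarrier ell1" "vnorm ell1 (e k) = 1" for k
    using fin[of "Suc k" "e k"] by (simp_all add: e_def if_distrib cong: if_cong)
  have comb: "(\<Sum>k<N. c k *\<^sub>C e k) = (\<lambda>n. if n < N then c n else 0)" for N and c :: "nat \<Rightarrow> complex"
  proof (induction N)
    case 0
    then show ?case by (simp add: zero_fun_def)
  next
    case (Suc N)
    then show ?case
      by (auto simp: plus_fun_def scaleC_fun_def scaleC_complex_def e_def fun_eq_iff less_Suc_eq)
  qed
  have "ell1_sequence X (\<lambda>k. J (e k))"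
  proof (rule ell1_sequenceI[where C = C and d = d])
    show "J (e n) \<in> vcarrier X" for n using operators_in[OF L X J(1)] .
    show "vnorm X (J (e n)) \<le> C" for n using C(2)[OF e(1)[of n]] e(2)[of n] by simp
    fix N and c :: "nat \<Rightarrow> complex"
    let ?a = "\<Sum>k<N. c k *\<^sub>C e k"
    have "vnorm ell1 ?a = (\<Sum>n<N. cmod (c n))" "?a \<in> vcarrier ell1"
      unfolding comb using fin[of N "\<lambda>n. if n < N then c n else 0"] by simp_all
    moreover have "J ?a = (\<Sum>k<N. c k *\<^sub>C J (e k))"
      using operators_sum[OF L J(1), of "{..<N}" "\<lambda>k. c k *\<^sub>C e k"] operators_scale[OF J(1) e(1)]
        complex_normed_space.scale_in[OF L e(1)] by simp
    ultimately show "d * (\<Sum>i<N. cmod (c i)) \<le> vnorm X (\<Sum>i<N. c i *\<^sub>C J (e i))"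
      using d(2)[of ?a] by simp
  qed (rule d)
  then show ?thesis using that by blast
qed

text \<open>
  The embedding sends \<open>a\<close> to the sum of the series with terms \<open>a n *\<^sub>C x n\<close>, which converges absolutely.
\<close>

lemma (in complex_banach_space) ell1_sequence_imp_contains_ell1:
  assumes "ell1_sequence X x"
  shows "contains_isomorphic_copy X ell1"
proof -
  note L = complex_normed_space_ell1
  interpret L: complex_normed_space ell1 by (rule L)
  note X = complex_normed_space_axioms
  obtain C d where x: "\<And>n. x n \<in> vcarrier X" "\<And>n. vnorm X (x n) \<le> C" and d: "d > 0"
    "\<And>N c. d * (\<Sum>i<N. cmod (c i)) \<le> vnorm X (\<Sum>i<N. c i *\<^sub>C x i)"
    by (rule ell1_sequenceE[OF assms]) (rule that)
  define s where "s a N = (\<Sum>i<N. a i *\<^sub>C x i)" for a :: "nat \<Rightarrow> complex" and N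
  have sX: "s a N \<in> vcarrier X" for a N unfolding s_def by (intro sum_in scale_in x)
  have s_le: "vnorm X (\<Sum>i\<in>I. a i *\<^sub>C x i) \<le> C * (\<Sum>i\<in>I. cmod (a i))" if "finite I" for I a
  proof -
    have "vnorm X (\<Sum>i\<in>I. a i *\<^sub>C x i) \<le> (\<Sum>i\<in>I. cmod (a i) * vnorm X (x i))"
      using norm_sum_le[OF that, of "\<lambda>i. a i *\<^sub>C x i"] by (simp add: scale_in x norm_scale)
    also have "\<dots> \<le> (\<Sum>i\<in>I. cmod (a i) * C)" by (intro sum_mono mult_left_mono x) simp
    finally show ?thesis by (simp add: sum_distrib_left mult.commute)
  qed
  have C0: "C \<ge> 0" using norm_nonneg[OF x(1)] x(2) order_trans by blast
  have ex: "\<exists>y. vlim X (s a) y" if a: "a \<in> vcarrier ell1" for a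
  proof -
    have sa: "summable (\<lambda>n. cmod (a n))" using a by (simp add: ell1_def)
    have "\<exists>N. \<forall>m\<ge>N. \<forall>n\<ge>N. vnorm X (s a m - s a n) < e" if e: "e > 0" for e
    proof -
      obtain N where N: "\<And>m n. m \<ge> N \<Longrightarrow> norm (\<Sum>i=m..<n. cmod (a i)) < e / (C + 1)"
        using sa[unfolded summable_Cauchy] e C0 by (metis add_nonneg_pos zero_less_divide_iff zero_less_one)
      have *: "vnorm X (s a n - s a m) < e" if "N \<le> m" "m \<le> n" for m n
      proof -
        have "s a n - s a m = (\<Sum>i=m..<n. a i *\<^sub>C x i)"
          unfolding s_def using sum_diff_nat_ivl[of 0 m n "\<lambda>i. a i *\<^sub>C x i"] that by (simp add: atLeast0LessThan)
        then have "vnorm X (s a n - s a m) \<le> C * (\<Sum>i=m..<n. cmod (a i))"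
          using s_le[of "{m..<n}" a] by simp
        also have "\<dots> \<le> C * (e / (C + 1))"
          using N[OF that(1), of n] C0 by (intro mult_left_mono) auto
        also have "\<dots> < e" using C0 e by (simp add: field_simps)
        finally show ?thesis .
      qed
      have "vnorm X (s a m - s a n) < e" if "m \<ge> N" "n \<ge> N" for m n
        using *[of m n] *[of n m] that norm_diff_commute[OF sX sX] by (metis nle_le)
      then show ?thesis by blast
    qed
    then show ?thesis using Cauchy_limit[of "s a"] sX unfolding vlim_def by (metis image_subsetI)
  qed
  define J where "J a = (if a \<in> vcarrier ell1 then SOME y. vlim X (s a) y else 0)" for a
  have J: "vlim X (s a) (J a)" if "a \<in> vcarrier ell1" for a
    unfolding J_def using someI_ex[OF ex[OF that]] that by simp
  have J_eq: "J a = y" if "a \<in> vcarrier ell1" "vlim X (s a) y" for a y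
    using vlim_unique[OF J[OF that(1)] that(2)] .
  have s_add: "s (a + b) = (\<lambda>N. s a N + s b N)" for a b
    by (simp add: s_def fun_eq_iff plus_fun_def scaleC_add_left sum.distrib)
  have s_scale: "s (c *\<^sub>C a) = (\<lambda>N. c *\<^sub>C s a N)" for c a
    by (simp add: s_def fun_eq_iff scaleC_fun_def scaleC_complex_def complex_vector.scale_sum_right)
  have partial: "(\<lambda>N. \<Sum>i<N. cmod (a i)) \<longlonglongrightarrow> vnorm ell1 a" if "a \<in> vcarrier ell1" for a
    using that summable_LIMSEQ[of "\<lambda>i. cmod (a i)"] by (simp add: ell1_def)
  have up: "vnorm X (J a) \<le> C * vnorm ell1 a" if a: "a \<in> vcarrier ell1" for a
    by (rule LIMSEQ_le[OF vlim_norm[OF J[OF a]] tendsto_mult_left[OF partial[OF a]]])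
      (use s_le[of "{..<_}" a] in \<open>auto simp: s_def\<close>)
  have low: "d * vnorm ell1 a \<le> vnorm X (J a)" if a: "a \<in> vcarrier ell1" for a
    by (rule LIMSEQ_le[OF tendsto_mult_left[OF partial[OF a]] vlim_norm[OF J[OF a]]])
      (use d(2) in \<open>auto simp: s_def\<close>)
  have op: "J \<in> operators ell1 X"
  proof (rule operatorsI[OF L X _ _ _ _ up])
    show "J (a + b) = J a + J b" if "a \<in> vcarrier ell1" "b \<in> vcarrier ell1" for a b
      by (rule J_eq[OF L.add_in[OF that]]) (unfold s_add, intro vlim_add J that)
    show "J (c *\<^sub>C a) = c *\<^sub>C J a" if "a \<in> vcarrier ell1" for c a
      by (rule J_eq[OF L.scale_in[OF that]]) (unfold s_scale, intro vlim_scale J that)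
    show "J a \<in> vcarrier X" if "a \<in> vcarrier ell1" for a using J[OF that] by (simp add: vlim_def)
  qed (auto simp: J_def)
  show ?thesis
    unfolding contains_isomorphic_copy_def
    using op embedding_map_if_bounded_below[OF L X op d(1) low] by blast
qed

section \<open>Finitely additive means\<close>

definition bounded_on :: "'k set \<Rightarrow> ('k \<Rightarrow> real) \<Rightarrow> bool"
  where "bounded_on S h \<longleftrightarrow> (\<exists>B. \<forall>x\<in>S. \<bar>h x\<bar> \<le> B)"

lemma bounded_onI: "(\<And>x. x \<in> S \<Longrightarrow> \<bar>h x\<bar> \<le> B) \<Longrightarrow> bounded_on S h"
  unfolding bounded_on_def by blast

lemma bounded_on_add:
  assumes "bounded_on S g" "bounded_on S h" shows "bounded_on S (\<lambda>x. g x + h x)"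
proof -
  obtain B C where B: "\<And>x. x \<in> S \<Longrightarrow> \<bar>g x\<bar> \<le> B" and C: "\<And>x. x \<in> S \<Longrightarrow> \<bar>h x\<bar> \<le> C"
    using assms unfolding bounded_on_def by blast
  show ?thesis
    by (rule bounded_onI[of _ _ "B + C"]) (use abs_triangle_ineq B C add_mono order_trans in blast)
qed

lemma bounded_on_mult:
  assumes "bounded_on S g" "bounded_on S h" shows "bounded_on S (\<lambda>x. g x * h x)"
proof -
  obtain B C where B: "\<And>x. x \<in> S \<Longrightarrow> \<bar>g x\<bar> \<le> B" and C: "\<And>x. x \<in> S \<Longrightarrow> \<bar>h x\<bar> \<le> C"
    using assms unfolding bounded_on_def by blast
  have "\<bar>g x * h x\<bar> \<le> B * C" if "x \<in> S" for x
    unfolding abs_mult using B[OF that] C[OF that] by (intro mult_mono) auto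
  then show ?thesis by (rule bounded_onI)
qed

lemma bounded_on_const: "bounded_on S (\<lambda>_. c)"
  by (rule bounded_onI[of _ _ "\<bar>c\<bar>"]) simp

lemma bounded_on_sum: "(\<And>i. i \<in> I \<Longrightarrow> bounded_on S (h i)) \<Longrightarrow> bounded_on S (\<lambda>x. \<Sum>i\<in>I. h i x)"
  by (induction I rule: infinite_finite_induct) (auto intro!: bounded_on_add bounded_on_const)

lemma bounded_on_uminus: "bounded_on S h \<Longrightarrow> bounded_on S (\<lambda>x. - h x)"
  using bounded_on_mult[OF bounded_on_const[of S "-1"]] by fastforce

lemma bounded_on_diff: "bounded_on S g \<Longrightarrow> bounded_on S h \<Longrightarrow> bounded_on S (\<lambda>x. g x - h x)"
  using bounded_on_add[OF _ bounded_on_uminus] by fastforce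

lemma bounded_on_indicator: "bounded_on S (indicator D)"
  by (rule bounded_onI[of _ _ 1]) (simp add: indicator_def)

lemmas bounded_on_intros = bounded_on_add bounded_on_mult bounded_on_const bounded_on_sum
  bounded_on_uminus bounded_on_diff bounded_on_indicator

text \<open>
  A finitely additive probability on \<open>S\<close>, given by its integral of bounded functions. It arises as a
  limit of averages over finite sets.
\<close>

locale mean =
  fixes S :: "'k set" and \<nu> :: "('k \<Rightarrow> real) \<Rightarrow> real"
  assumes add: "bounded_on S g \<Longrightarrow> bounded_on S h \<Longrightarrow> \<nu> (\<lambda>x. g x + h x) = \<nu> g + \<nu> h"
    and scale: "bounded_on S h \<Longrightarrow> \<nu> (\<lambda>x. c * h x) = c * \<nu> h"
    and nonneg: "bounded_on S h \<Longrightarrow> (\<And>x. x \<in> S \<Longrightarrow> 0 \<le> h x) \<Longrightarrow> 0 \<le> \<nu> h"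
    and one: "\<nu> (\<lambda>_. 1) = 1"
begin

lemma diff: "bounded_on S g \<Longrightarrow> bounded_on S h \<Longrightarrow> \<nu> (\<lambda>x. g x - h x) = \<nu> g - \<nu> h"
  using add[of g "\<lambda>x. -1 * h x"] scale[of h "-1"] by (simp add: bounded_on_uminus)

lemma const: "\<nu> (\<lambda>_. c) = c"
  using scale[OF bounded_on_const[of S 1], of c] one by simp

lemma mono:
  "bounded_on S g \<Longrightarrow> bounded_on S h \<Longrightarrow> (\<And>x. x \<in> S \<Longrightarrow> g x \<le> h x) \<Longrightarrow> \<nu> g \<le> \<nu> h"
  using nonneg[of "\<lambda>x. h x - g x"] diff[of h g] by (simp add: bounded_on_diff)

lemma cong:
  "bounded_on S g \<Longrightarrow> bounded_on S h \<Longrightarrow> (\<And>x. x \<in> S \<Longrightarrow> g x = h x) \<Longrightarrow> \<nu> g = \<nu> h"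
  using mono[of g h] mono[of h g] by force

lemma sum: "finite I \<Longrightarrow> (\<And>i. i \<in> I \<Longrightarrow> bounded_on S (h i)) \<Longrightarrow> \<nu> (\<lambda>x. \<Sum>i\<in>I. h i x) = (\<Sum>i\<in>I. \<nu> (h i))"
proof (induction I rule: finite_induct)
  case empty
  then show ?case using const[of 0] by simp
next
  case (insert i I)
  then show ?case by (simp add: add bounded_on_sum)
qed

lemma abs_le:
  assumes "bounded_on S g" "bounded_on S h" "\<And>x. x \<in> S \<Longrightarrow> \<bar>g x\<bar> \<le> h x"
  shows "\<bar>\<nu> g\<bar> \<le> \<nu> h"
proof -
  have "\<nu> g \<le> \<nu> h" using assms by (intro mono) (auto simp: abs_le_iff)
  moreover have "\<nu> (\<lambda>x. -1 * g x) \<le> \<nu> h"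
    by (rule mono) (use assms in \<open>auto simp: abs_le_iff bounded_on_uminus\<close>)
  ultimately show ?thesis using scale[OF assms(1), of "-1"] by simp
qed

text \<open>
  Expand the integral of the square of \<open>h\<close> minus its projection onto the orthonormal functions \<open>e i\<close>.
\<close>

lemma Bessel:
  fixes e :: "nat \<Rightarrow> 'k \<Rightarrow> real"
  assumes h: "bounded_on S h" "\<And>x. x \<in> S \<Longrightarrow> \<bar>h x\<bar> \<le> B"
    and e: "\<And>i. bounded_on S (e i)" "\<And>i x. x \<in> S \<Longrightarrow> e i x * e i x = 1"
    and orth: "\<And>i j. i \<noteq> j \<Longrightarrow> \<nu> (\<lambda>x. e i x * e j x) = 0"
  shows "(\<Sum>i<n. (\<nu> (\<lambda>x. h x * e i x))\<^sup>2) \<le> B\<^sup>2"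
proof -
  define c where "c i = \<nu> (\<lambda>x. h x * e i x)" for i :: nat
  define g where "g x = (\<Sum>i<n. c i * e i x)" for x
  note bd = bounded_on_intros h(1) e(1)
  have g: "bounded_on S g" unfolding g_def by (intro bd)
  have hg: "\<nu> (\<lambda>x. h x * g x) = (\<Sum>i<n. (c i)\<^sup>2)"
  proof -
    have "\<nu> (\<lambda>x. h x * g x) = \<nu> (\<lambda>x. \<Sum>i<n. c i * (h x * e i x))"
      by (simp add: g_def sum_distrib_left mult_ac)
    also have "\<dots> = (\<Sum>i<n. \<nu> (\<lambda>x. c i * (h x * e i x)))" by (rule sum) (intro bd | simp)+
    also have "\<dots> = (\<Sum>i<n. (c i)\<^sup>2)"
      by (intro sum.cong refl, subst scale) (intro bd | simp add: c_def power2_eq_square)+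
    finally show ?thesis .
  qed
  have gg: "\<nu> (\<lambda>x. g x * g x) = (\<Sum>i<n. (c i)\<^sup>2)"
  proof -
    have ee: "\<nu> (\<lambda>x. e i x * e j x) = (if i = j then 1 else 0)" for i j
    proof (cases "i = j")
      case True
      have "\<nu> (\<lambda>x. e i x * e j x) = \<nu> (\<lambda>_. 1)" using True e by (intro cong) (auto intro!: bd)
      then show ?thesis using True one by simp
    qed (simp add: orth)
    have "\<nu> (\<lambda>x. g x * g x) = \<nu> (\<lambda>x. \<Sum>i<n. \<Sum>j<n. c i * c j * (e i x * e j x))"
      by (simp add: g_def sum_product mult_ac)
    also have "\<dots> = (\<Sum>i<n. \<nu> (\<lambda>x. \<Sum>j<n. c i * c j * (e i x * e j x)))" by (rule sum) (intro bd | simp)+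
    also have "\<dots> = (\<Sum>i<n. \<Sum>j<n. \<nu> (\<lambda>x. c i * c j * (e i x * e j x)))"
      by (intro sum.cong refl sum) (intro bd | simp)+
    also have "\<dots> = (\<Sum>i<n. \<Sum>j<n. c i * c j * (if i = j then 1 else 0))"
      by (intro sum.cong refl, subst scale) (intro bd | simp add: ee)+
    also have "\<dots> = (\<Sum>i<n. (c i)\<^sup>2)" by (simp add: power2_eq_square if_distrib cong: if_cong)
    finally show ?thesis .
  qed
  have "0 \<le> \<nu> (\<lambda>x. (h x * h x - 2 * (h x * g x)) + g x * g x)"
  proof (rule nonneg)
    show "0 \<le> h x * h x - 2 * (h x * g x) + g x * g x" for x
      using zero_le_square[of "h x - g x"] by (simp add: algebra_simps)
  qed (intro bd g)
  also have "\<dots> = \<nu> (\<lambda>x. h x * h x) - 2 * \<nu> (\<lambda>x. h x * g x) + \<nu> (\<lambda>x. g x * g x)"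
    by (subst add, intro bd g, intro bd g, subst diff, intro bd g, intro bd g, subst scale, intro bd g) simp
  finally have "(\<Sum>i<n. (c i)\<^sup>2) \<le> \<nu> (\<lambda>x. h x * h x)" using hg gg by simp
  also have "\<dots> \<le> \<nu> (\<lambda>_. B\<^sup>2)"
  proof (rule mono)
    show "h x * h x \<le> B\<^sup>2" if "x \<in> S" for x
      using power_mono[OF h(2)[OF that] abs_ge_zero, of 2] by (simp add: power2_eq_square)
  qed (intro bd)+
  finally show ?thesis by (simp add: const c_def)
qed

lemma Bessel_tendsto_0:
  assumes h: "bounded_on S h"
    and e: "\<And>i. bounded_on S (e i)" "\<And>i x. x \<in> S \<Longrightarrow> e i x * e i x = 1"
    and orth: "\<And>i j :: nat. i \<noteq> j \<Longrightarrow> \<nu> (\<lambda>x. e i x * e j x) = 0"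
  shows "(\<lambda>i. \<nu> (\<lambda>x. h x * e i x)) \<longlonglongrightarrow> 0"
proof -
  obtain B where B: "\<And>x. x \<in> S \<Longrightarrow> \<bar>h x\<bar> \<le> B" using h unfolding bounded_on_def by blast
  have "summable (\<lambda>i. (\<nu> (\<lambda>x. h x * e i x))\<^sup>2)"
    by (rule summableI_nonneg_bounded[of _ "B\<^sup>2"]) (use Bessel[OF h B e orth] in auto)
  then have "(\<lambda>i. (\<nu> (\<lambda>x. h x * e i x))\<^sup>2) \<longlonglongrightarrow> 0" by (rule summable_LIMSEQ_zero)
  from tendsto_real_sqrt[OF this] show ?thesis by (simp add: tendsto_rabs_zero_iff)
qed

text \<open>
  If infinitely many of the sets \<open>X \<inter> D i\<close> have measure at least \<open>c\<close>, the same holds, with a smaller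
  bound, inside some \<open>X \<inter> D j\<close>. Otherwise infinitely many of them would be almost disjoint from all
  the previous ones, and unions of \<open>k\<close> of them would have measure at least \<open>k * c / 2\<close>.
\<close>

lemma infinite_intersection_step:
  assumes c: "c > 0" and inf: "infinite {i :: nat. c \<le> \<nu> (indicator (X \<inter> D i))}"
  shows "\<exists>j>n. \<exists>b>0. infinite {i. b \<le> \<nu> (indicator (X \<inter> D j \<inter> D i))}"
proof (rule ccontr)
  assume no: "\<not> ?thesis"
  define L where "L = {i. c \<le> \<nu> (indicator (X \<inter> D i))} - {..n}"
  have L: "infinite L" "\<And>i. i \<in> L \<Longrightarrow> c \<le> \<nu> (indicator (X \<inter> D i))" "\<And>i. i \<in> L \<Longrightarrow> n < i"
    using inf by (auto simp: L_def)
  note bd = bounded_on_intros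
  have grow: "\<exists>Q\<subseteq>L. finite Q \<and> real k * (c / 2) \<le> \<nu> (indicator (\<Union>j\<in>Q. X \<inter> D j))" for k :: nat
  proof (induction k)
    case 0
    show ?case by (intro exI[of _ "{}"]) (simp add: const)
  next
    case (Suc k)
    then obtain Q where Q: "Q \<subseteq> L" "finite Q" "real k * (c / 2) \<le> \<nu> (indicator (\<Union>j\<in>Q. X \<inter> D j))" by blast
    define b where "b = c / (2 * (real (card Q) + 1))"
    have b: "b > 0" using c by (simp add: b_def)
    have "finite (\<Union>j\<in>Q. {i. b \<le> \<nu> (indicator (X \<inter> D j \<inter> D i))})"
      using no Q L(3) b by blast
    then have "infinite (L - (\<Union>j\<in>Q. {i. b \<le> \<nu> (indicator (X \<inter> D j \<inter> D i))}))" using L(1) by simp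
    then obtain i where i': "i \<in> L - (\<Union>j\<in>Q. {i. b \<le> \<nu> (indicator (X \<inter> D j \<inter> D i))})"
      using infinite_imp_nonempty by blast
    then have i: "i \<in> L" "\<And>j. j \<in> Q \<Longrightarrow> \<nu> (indicator (X \<inter> D j \<inter> D i)) < b"
      by (auto simp: not_le)
    let ?Y = "\<Union>j\<in>Q. X \<inter> D j"
    have "(\<Sum>j\<in>Q. \<nu> (indicator (X \<inter> D j \<inter> D i))) \<le> (\<Sum>j\<in>Q. b)"
      using i(2) by (intro sum_mono less_imp_le)
    also have "\<dots> \<le> c / 2"
    proof -
      have "real (card Q) * c \<le> c * (real (card Q) + 1)" using c by (simp add: algebra_simps)
      then show ?thesis by (simp add: b_def field_simps)
    qed
    finally have small: "(\<Sum>j\<in>Q. \<nu> (indicator (X \<inter> D j \<inter> D i))) \<le> c / 2" .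
    have "\<nu> (\<lambda>x. (indicator ?Y x + indicator (X \<inter> D i) x) - (\<Sum>j\<in>Q. indicator (X \<inter> D j \<inter> D i) x))
        \<le> \<nu> (indicator (\<Union>j\<in>insert i Q. X \<inter> D j))"
    proof (rule mono)
      fix x
      show "(indicator ?Y x + indicator (X \<inter> D i) x) - (\<Sum>j\<in>Q. indicator (X \<inter> D j \<inter> D i) x)
          \<le> (indicator (\<Union>j\<in>insert i Q. X \<inter> D j) x :: real)"
      proof (cases "x \<in> ?Y \<and> x \<in> X \<inter> D i")
        case True
        then obtain j where j: "j \<in> Q" "x \<in> X \<inter> D j \<inter> D i" by blast
        have "indicator (X \<inter> D j \<inter> D i) x \<le> (\<Sum>j\<in>Q. indicator (X \<inter> D j \<inter> D i) x :: real)"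
          using j(1) Q(2) by (intro member_le_sum) auto
        then show ?thesis using True j by (auto simp: indicator_def)
      next
        case False
        have "0 \<le> (\<Sum>j\<in>Q. indicator (X \<inter> D j \<inter> D i) x :: real)" by (intro sum_nonneg) simp
        then show ?thesis using False by (auto simp: indicator_def)
      qed
    qed (intro bd)+
    moreover have "\<nu> (\<lambda>x. (indicator ?Y x + indicator (X \<inter> D i) x) - (\<Sum>j\<in>Q. indicator (X \<inter> D j \<inter> D i) x))
        = \<nu> (indicator ?Y) + \<nu> (indicator (X \<inter> D i)) - (\<Sum>j\<in>Q. \<nu> (indicator (X \<inter> D j \<inter> D i)))"
      by (subst diff, intro bd, intro bd, subst add, intro bd, intro bd, subst sum, rule Q(2), intro bd, rule refl)
    ultimately have "real (Suc k) * (c / 2) \<le> \<nu> (indicator (\<Union>j\<in>insert i Q. X \<inter> D j))"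
      using Q(3) L(2)[OF i(1)] small by (simp add: algebra_simps)
    then show ?case using Q i(1) by (intro exI[of _ "insert i Q"]) auto
  qed
  obtain k :: nat where "2 / c < real k" using reals_Archimedean2 by blast
  then have "1 < real k * (c / 2)" using c by (simp add: field_simps)
  moreover obtain Q where "real k * (c / 2) \<le> \<nu> (indicator (\<Union>j\<in>Q. X \<inter> D j))" using grow by blast
  moreover have "\<nu> (indicator (\<Union>j\<in>Q. X \<inter> D j)) \<le> \<nu> (\<lambda>_. 1)"
    by (rule mono) (intro bd | simp add: indicator_def)+
  ultimately show False using one by linarith
qed

text \<open>
  This replaces the dominated convergence theorem: for functions that are not small in the mean, the
  sets on which they are not small have a subsequence with the finite intersection property.
\<close>

lemma infinite_intersection:
  assumes c: "c > 0" "\<And>i :: nat. c \<le> \<nu> (indicator (D i))"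
  obtains r :: "nat \<Rightarrow> nat" where "strict_mono r" "\<And>k. \<exists>x\<in>S. \<forall>i\<le>k. x \<in> D (r i)"
proof -
  define P where "P = (\<lambda>(j :: nat, X). \<exists>b>0. infinite {i. b \<le> \<nu> (indicator (X \<inter> D i))})"
  define Q where "Q = (\<lambda>(j :: nat, X) (j', X'). j < j' \<and> X' = X \<inter> D j')"
  have "\<exists>s. \<forall>k::nat. P (s k) \<and> Q (s k) (s (Suc k))"
  proof (rule dependent_nat_choice)
    show "\<exists>s. P s" unfolding P_def using c by (intro exI[of _ "(0, UNIV)"]) auto
    fix s :: "nat \<times> 'k set" and k :: nat
    assume s: "P s"
    obtain n X where sd: "s = (n, X)" by (cases s)
    from s obtain b where "b > 0" "infinite {i. b \<le> \<nu> (indicator (X \<inter> D i))}" unfolding P_def sd by auto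
    from infinite_intersection_step[OF this, of n] obtain j b' where
      "n < j" "b' > 0" "infinite {i. b' \<le> \<nu> (indicator (X \<inter> D j \<inter> D i))}" by blast
    then have "P (j, X \<inter> D j) \<and> Q s (j, X \<inter> D j)" unfolding P_def Q_def sd by auto
    then show "\<exists>s'. P s' \<and> Q s s'" by blast
  qed
  then obtain s where s: "\<And>k. P (s k)" "\<And>k. Q (s k) (s (Suc k))" by blast
  define j X where "j k = fst (s k)" and "X k = snd (s k)" for k
  have nxt: "j k < j (Suc k)" "X (Suc k) = X k \<inter> D (j (Suc k))" for k
    using s(2)[of k] unfolding Q_def j_def X_def by (auto split: prod.splits)
  have ne: "\<exists>x\<in>S. x \<in> X k" for k
  proof (rule ccontr)
    assume no: "\<not> ?thesis"
    obtain b where b: "b > 0" "infinite {i. b \<le> \<nu> (indicator (X k \<inter> D i))}"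
      using s(1)[of k] unfolding P_def X_def by (auto split: prod.splits)
    obtain i where "b \<le> \<nu> (indicator (X k \<inter> D i))" using infinite_imp_nonempty[OF b(2)] by blast
    moreover have "\<nu> (indicator (X k \<inter> D i)) = \<nu> (\<lambda>_. 0)"
      by (rule cong) (use no in \<open>auto simp: indicator_def intro!: bounded_on_indicator bounded_on_const\<close>)
    ultimately show False using b(1) const by simp
  qed
  have "X (Suc k) \<subseteq> D (j (Suc i))" if "i \<le> k" for i k
    using that by (induction k) (auto simp: nxt(2) le_Suc_eq)
  then have "\<exists>x\<in>S. \<forall>i\<le>k. x \<in> D (j (Suc i))" for k using ne[of "Suc k"] by blast
  then show ?thesis using that[of "\<lambda>i. j (Suc i)"] nxt(1) by (simp add: strict_mono_Suc_iff)
qed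

end

text \<open>
  Tychonoff's theorem in the form in which it is used: a condition that is closed for pointwise
  convergence and holds from some index on holds for the cluster point.
\<close>

lemma function_cluster_point:
  fixes E :: "nat \<Rightarrow> 'a \<Rightarrow> 'b::topological_space"
  assumes K: "\<And>a. compact (K a)" and E: "\<And>N a. E N a \<in> K a"
  obtains \<phi> where "\<And>N Q. closed Q \<Longrightarrow> (\<And>n. n \<ge> N \<Longrightarrow> E n \<in> Q) \<Longrightarrow> \<phi> \<in> Q"
proof -
  have "compactin (product_topology (\<lambda>_. euclidean) UNIV) (PiE UNIV K)"
    using K by (simp add: compactin_PiE)
  then have comp: "compact (PiE UNIV K)" by (simp add: euclidean_product_topology)
  have "PiE UNIV K \<inter> (\<Inter>N\<in>UNIV. closure (E ` {N..})) \<noteq> {}"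
  proof (rule compact_imp_fip_image[OF comp])
    fix I :: "nat set" assume I: "finite I"
    have "E (Max (insert 0 I)) \<in> closure (E ` {N..})" if "N \<in> I" for N
      using that I closure_subset[of "E ` {N..}"] by (force intro!: Max_ge)
    then show "PiE UNIV K \<inter> (\<Inter>N\<in>I. closure (E ` {N..})) \<noteq> {}" using E by blast
  qed simp
  then obtain \<phi> where \<phi>: "\<And>N. \<phi> \<in> closure (E ` {N..})" by blast
  have "\<phi> \<in> Q" if "closed Q" "\<And>n. n \<ge> N \<Longrightarrow> E n \<in> Q" for N Q
    using closure_minimal[of "E ` {N..}" Q] \<phi>[of N] that by blast
  then show ?thesis using that by blast
qed

text \<open>
  A cluster point of the averages, as functions of the integrand. Unbounded integrands are given the
  value \<open>0\<close> in order to confine all values to compact intervals.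
\<close>

lemma limit_of_averages:
  fixes x :: "nat \<Rightarrow> 'i \<Rightarrow> 'k" and I :: "nat \<Rightarrow> 'i set"
  assumes I: "\<And>N. finite (I N)" "\<And>N. I N \<noteq> {}" and x: "\<And>N i. i \<in> I N \<Longrightarrow> x N i \<in> S"
  obtains \<nu> where "mean S \<nu>"
    "\<And>h a N. bounded_on S h \<Longrightarrow> (\<And>n. n \<ge> N \<Longrightarrow> a \<le> (\<Sum>i\<in>I n. h (x n i)) / card (I n)) \<Longrightarrow> a \<le> \<nu> h"
    "\<And>h b N. bounded_on S h \<Longrightarrow> (\<And>n. n \<ge> N \<Longrightarrow> (\<Sum>i\<in>I n. h (x n i)) / card (I n) \<le> b) \<Longrightarrow> \<nu> h \<le> b"
proof -
  define avg where "avg N h = (\<Sum>i\<in>I N. h (x N i)) / card (I N)" for N and h :: "'k \<Rightarrow> real"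
  define E where "E N h = (if bounded_on S h then avg N h else 0)" for N h
  define B where "B h = (if bounded_on S h then SOME B. \<forall>x\<in>S. \<bar>h x\<bar> \<le> B else 0)" for h
  have card: "real (card (I N)) > 0" for N using I by (simp add: card_gt_0_iff)
  have B: "\<bar>h y\<bar> \<le> B h" if "bounded_on S h" "y \<in> S" for h y
    using someI_ex[of "\<lambda>B. \<forall>x\<in>S. \<bar>h x\<bar> \<le> B"] that unfolding bounded_on_def B_def by simp
  have avg_le: "avg N h \<le> b" if "\<And>y. y \<in> S \<Longrightarrow> h y \<le> b" for N h b
  proof -
    have "(\<Sum>i\<in>I N. h (x N i)) \<le> (\<Sum>i\<in>I N. b)" using that x by (intro sum_mono) auto
    then show ?thesis using card[of N] by (simp add: avg_def divide_le_eq mult.commute)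
  qed
  have avg_ge: "a \<le> avg N h" if "\<And>y. y \<in> S \<Longrightarrow> a \<le> h y" for N h a
  proof -
    have "(\<Sum>i\<in>I N. a) \<le> (\<Sum>i\<in>I N. h (x N i))" using that x by (intro sum_mono) auto
    then show ?thesis using card[of N] by (simp add: avg_def le_divide_eq mult.commute)
  qed
  have "E N h \<in> cball 0 (B h)" for N h
  proof (cases "bounded_on S h")
    case True
    have "- B h \<le> avg N h" "avg N h \<le> B h" using B[OF True] by (intro avg_ge avg_le; force)+
    then show ?thesis using True by (simp add: E_def)
  qed (simp add: E_def B_def)
  then obtain \<nu> where \<nu>: "\<And>N Q. closed Q \<Longrightarrow> (\<And>n. n \<ge> N \<Longrightarrow> E n \<in> Q) \<Longrightarrow> \<nu> \<in> Q"
    using function_cluster_point[of "\<lambda>h. cball 0 (B h)" E] by (metis compact_cball)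
  have coord: "continuous_on UNIV (\<lambda>\<mu> :: ('k \<Rightarrow> real) \<Rightarrow> real. \<mu> h)" for h
    by (rule continuous_on_product_coordinates)
  have lower: "a \<le> \<nu> h" if "bounded_on S h" "\<And>n. n \<ge> N \<Longrightarrow> a \<le> avg n h" for h a N
  proof -
    have "closed {\<mu> :: ('k \<Rightarrow> real) \<Rightarrow> real. a \<le> \<mu> h}"
      by (intro closed_Collect_le coord continuous_on_const)
    from \<nu>[OF this, of N] show ?thesis using that by (simp add: E_def)
  qed
  have upper: "\<nu> h \<le> b" if "bounded_on S h" "\<And>n. n \<ge> N \<Longrightarrow> avg n h \<le> b" for h b N
  proof -
    have "closed {\<mu> :: ('k \<Rightarrow> real) \<Rightarrow> real. \<mu> h \<le> b}"
      by (intro closed_Collect_le coord continuous_on_const)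
    from \<nu>[OF this, of N] show ?thesis using that by (simp add: E_def)
  qed
  have "mean S \<nu>"
  proof
    show "\<nu> (\<lambda>x. g x + h x) = \<nu> g + \<nu> h" if gh: "bounded_on S g" "bounded_on S h" for g h
    proof -
      have "\<nu> \<in> {\<mu>. \<mu> (\<lambda>x. g x + h x) = \<mu> g + \<mu> h}"
      proof (rule \<nu>)
        show "closed {\<mu> :: ('k \<Rightarrow> real) \<Rightarrow> real. \<mu> (\<lambda>x. g x + h x) = \<mu> g + \<mu> h}"
          by (intro closed_Collect_eq continuous_on_add coord)
      qed (use gh bounded_on_add[OF gh] in \<open>simp add: E_def avg_def sum.distrib add_divide_distrib\<close>)
      then show ?thesis by simp
    qed
    show "\<nu> (\<lambda>x. c * h x) = c * \<nu> h" if h: "bounded_on S h" for c h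
    proof -
      have "\<nu> \<in> {\<mu>. \<mu> (\<lambda>x. c * h x) = c * \<mu> h}"
      proof (rule \<nu>)
        show "closed {\<mu> :: ('k \<Rightarrow> real) \<Rightarrow> real. \<mu> (\<lambda>x. c * h x) = c * \<mu> h}"
          by (intro closed_Collect_eq continuous_on_mult continuous_on_const coord)
      qed (use h bounded_on_mult[OF bounded_on_const h] in \<open>simp add: E_def avg_def flip: sum_distrib_left\<close>)
      then show ?thesis by simp
    qed
    show "0 \<le> \<nu> h" if "bounded_on S h" "\<And>x. x \<in> S \<Longrightarrow> 0 \<le> h x" for h
      using that avg_ge by (intro lower) auto
    show "\<nu> (\<lambda>_. 1) = 1"
      by (intro antisym upper lower bounded_on_const) (use avg_ge avg_le in auto)
  qed
  then show ?thesis by (rule that) (fact lower[unfolded avg_def], fact upper[unfolded avg_def])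
qed

text \<open>
  Inserting or removing \<open>i\<close> is an involution that changes the sign of each term.
\<close>

lemma sum_signed_subsets_eq_0:
  fixes g :: "nat set \<Rightarrow> real"
  assumes i: "i < N" and g: "\<And>P. g (insert i P) = g (P - {i})"
  shows "(\<Sum>P\<in>Pow {..<N}. g P * (if i \<in> P then 1 else -1)) = 0"
proof -
  define flip where "flip P = (if i \<in> P then P - {i} else insert i P)" for P
  let ?f = "\<lambda>P. g P * (if i \<in> P then 1 else -1)"
  have g': "g (flip P) = g P" for P
    using g[of P] by (cases "i \<in> P") (auto simp: flip_def insert_absorb)
  have "sum ?f (Pow {..<N}) = (\<Sum>P\<in>Pow {..<N}. - ?f P)"
  proof (rule sum.reindex_bij_witness[of _ flip flip])
    fix P assume "P \<in> Pow {..<N}"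
    then show "flip (flip P) = P" "flip P \<in> Pow {..<N}" "flip (flip P) = P" "flip P \<in> Pow {..<N}"
      using i by (auto simp: flip_def)
    have "i \<in> flip P \<longleftrightarrow> i \<notin> P" by (simp add: flip_def)
    then show "- ?f (flip P) = ?f P" using g'[of P] by simp
  qed
  then show ?thesis by (simp add: sum_negf)
qed

section \<open>Sets almost absorbed by a Rosenthal set\<close>

text \<open>
  For each \<open>N\<close> take the average over \<open>2 ^ N\<close> points, one for each pattern of the first \<open>N\<close> indices.
  The functions \<open>e i\<close> that record on which side the value of \<open>z i\<close> lies are Rademacher functions for
  these averages. As \<open>z i\<close> differs from \<open>(p + q) / 2 + e i * (p - q) / 2\<close> by less than
  \<open>cmod (p - q) / 8\<close>, its integral against \<open>e i\<close> is close to \<open>(p - q) / 2\<close>. A limit for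
  \<open>N \<rightarrow> \<infinity>\<close> has both properties for all \<open>i\<close> simultaneously.
\<close>

lemma rademacher_mean:
  fixes z :: "nat \<Rightarrow> 'k \<Rightarrow> complex"
  assumes bd: "\<And>i. bounded_on S (\<lambda>x. Re (z i x))" "\<And>i. bounded_on S (\<lambda>x. Im (z i x))"
    and pq: "p \<noteq> q"
    and ind: "\<And>N P. \<exists>x\<in>S. \<forall>i<N. cmod (z i x - (if i \<in> P then p else q)) < cmod (p - q) / 8"
  obtains \<nu> e where "mean S \<nu>" "\<And>i :: nat. bounded_on S (e i)" "\<And>i x. e i x * e i x = 1"
    "\<And>i j. i \<noteq> j \<Longrightarrow> \<nu> (\<lambda>x. e i x * e j x) = 0"
    "\<And>i. cmod (p - q) / 4 \<le> cmod (Complex (\<nu> (\<lambda>x. Re (z i x) * e i x)) (\<nu> (\<lambda>x. Im (z i x) * e i x)))"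
proof -
  define w where "w = p - q"
  define e :: "nat \<Rightarrow> 'k \<Rightarrow> real" where "e i x = (if cmod (z i x - p) < cmod w / 8 then 1 else -1)" for i x
  have "\<exists>X. \<forall>N P. X N P \<in> S \<and> (\<forall>i<N. cmod (z i (X N P) - (if i \<in> P then p else q)) < cmod w / 8)"
    using ind unfolding w_def by metis
  then obtain X where X: "\<And>N P. X N P \<in> S"
    "\<And>N P i. i < N \<Longrightarrow> cmod (z i (X N P) - (if i \<in> P then p else q)) < cmod w / 8"
    by blast
  have eX: "e i (X N P) = (if i \<in> P then 1 else -1)" if i: "i < N" for i N P
  proof (cases "i \<in> P")
    case True
    then show ?thesis using X(2)[OF i, of P] by (simp add: e_def)
  next
    case False
    have "cmod w \<le> cmod (z i (X N P) - p) + cmod (z i (X N P) - q)"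
      using norm_triangle_ineq4[of "z i (X N P) - q" "z i (X N P) - p"] by (simp add: w_def)
    moreover have "cmod (z i (X N P) - q) < cmod w / 8" using X(2)[OF i, of P] False by simp
    moreover have "0 < cmod w" using pq by (simp add: w_def)
    ultimately have "\<not> cmod (z i (X N P) - p) < cmod w / 8" by linarith
    then show ?thesis using False by (simp add: e_def)
  qed
  have card: "real (card (Pow {..<N})) = 2 ^ N" for N :: nat by (simp add: card_Pow)
  obtain \<nu> where \<nu>: "mean S \<nu>"
    and lower: "\<And>h a N. bounded_on S h \<Longrightarrow>
      (\<And>n. n \<ge> N \<Longrightarrow> a \<le> (\<Sum>P\<in>Pow {..<n}. h (X n P)) / card (Pow {..<n})) \<Longrightarrow> a \<le> \<nu> h"
    and upper: "\<And>h b N. bounded_on S h \<Longrightarrow>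
      (\<And>n. n \<ge> N \<Longrightarrow> (\<Sum>P\<in>Pow {..<n}. h (X n P)) / card (Pow {..<n}) \<le> b) \<Longrightarrow> \<nu> h \<le> b"
    using limit_of_averages[of "\<lambda>N. Pow {..<N}" X S] X(1) by (metis Pow_not_empty finite_Pow_iff finite_lessThan)
  have e_bd: "bounded_on S (e i)" for i by (rule bounded_onI[of _ _ 1]) (simp add: e_def)
  have orth: "\<nu> (\<lambda>x. e i x * e j x) = 0" if ij: "i \<noteq> j" for i j
  proof -
    have avg0: "(\<Sum>P\<in>Pow {..<n}. e i (X n P) * e j (X n P)) / card (Pow {..<n}) = 0" if n: "n \<ge> Suc (max i j)" for n
    proof -
      have "(\<Sum>P\<in>Pow {..<n}. e i (X n P) * e j (X n P)) =
          (\<Sum>P\<in>Pow {..<n}. (if i \<in> P then 1 else -1) * (if j \<in> P then 1 else -1))"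
        using n by (intro sum.cong refl arg_cong2[of _ _ _ _ "(*)"] eX) auto
      also have "\<dots> = 0" by (rule sum_signed_subsets_eq_0) (use n ij in auto)
      finally show ?thesis by simp
    qed
    show ?thesis
      by (intro antisym lower[where N = "Suc (max i j)"] upper[where N = "Suc (max i j)"]
          bounded_on_mult e_bd) (simp_all only: avg0)
  qed
  have half: "\<bar>\<nu> (\<lambda>x. h x * e i x) - (a - b) / 2\<bar> \<le> \<eta>"
    if h: "bounded_on S h" and near: "\<And>N P. i < N \<Longrightarrow> \<bar>h (X N P) - (if i \<in> P then a else b)\<bar> \<le> \<eta>"
    for h i a b \<eta>
  proof -
    have avg: "(a - b) / 2 - \<eta> \<le> (\<Sum>P\<in>Pow {..<n}. h (X n P) * e i (X n P)) / card (Pow {..<n})"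
      "(\<Sum>P\<in>Pow {..<n}. h (X n P) * e i (X n P)) / card (Pow {..<n}) \<le> (a - b) / 2 + \<eta>"
      if n: "n \<ge> Suc i" for n
    proof -
      let ?s = "\<lambda>P. (a + b) / 2 * (if i \<in> P then 1 else -1 :: real)"
      have zero: "(\<Sum>P\<in>Pow {..<n}. ?s P) = 0" by (rule sum_signed_subsets_eq_0) (use n in auto)
      have each: "?s P + ((a - b) / 2 - \<eta>) \<le> h (X n P) * e i (X n P)"
        "h (X n P) * e i (X n P) \<le> ?s P + ((a - b) / 2 + \<eta>)" for P
        using near[of n P] n eX[of i n P] by (auto simp: abs_le_iff field_simps split: if_splits)
      have "(\<Sum>P\<in>Pow {..<n}. ?s P + ((a - b) / 2 - \<eta>)) \<le> (\<Sum>P\<in>Pow {..<n}. h (X n P) * e i (X n P))"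
        "(\<Sum>P\<in>Pow {..<n}. h (X n P) * e i (X n P)) \<le> (\<Sum>P\<in>Pow {..<n}. ?s P + ((a - b) / 2 + \<eta>))"
        by (intro sum_mono each)+
      then show "(a - b) / 2 - \<eta> \<le> (\<Sum>P\<in>Pow {..<n}. h (X n P) * e i (X n P)) / card (Pow {..<n})"
        "(\<Sum>P\<in>Pow {..<n}. h (X n P) * e i (X n P)) / card (Pow {..<n}) \<le> (a - b) / 2 + \<eta>"
        unfolding sum.distrib zero sum_constant card by (simp_all add: le_divide_eq divide_le_eq algebra_simps)
    qed
    have "(a - b) / 2 - \<eta> \<le> \<nu> (\<lambda>x. h x * e i x)"
      by (rule lower[OF bounded_on_mult[OF h e_bd], where N = "Suc i"]) (rule avg)
    moreover have "\<nu> (\<lambda>x. h x * e i x) \<le> (a - b) / 2 + \<eta>"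
      by (rule upper[OF bounded_on_mult[OF h e_bd], where N = "Suc i"]) (rule avg)
    ultimately show ?thesis by (simp add: abs_le_iff)
  qed
  have "cmod w / 4 \<le> cmod (Complex (\<nu> (\<lambda>x. Re (z i x) * e i x)) (\<nu> (\<lambda>x. Im (z i x) * e i x)))"
    (is "_ \<le> cmod ?c") for i
  proof -
    have near: "cmod (z i (X N P) - (if i \<in> P then p else q)) \<le> cmod w / 8" if "i < N" for N P
      using X(2)[OF that, of P] by simp
    have re: "\<bar>Re ?c - Re (w / 2)\<bar> \<le> cmod w / 8"
      using half[OF bd(1)[of i], where i = i and a = "Re p" and b = "Re q" and \<eta> = "cmod w / 8"]
        order_trans[OF abs_Re_le_cmod near]
      by (simp add: w_def if_distrib[of Re] cong: if_cong)
    have im: "\<bar>Im ?c - Im (w / 2)\<bar> \<le> cmod w / 8"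
      using half[OF bd(2)[of i], where i = i and a = "Im p" and b = "Im q" and \<eta> = "cmod w / 8"]
        order_trans[OF abs_Im_le_cmod near]
      by (simp add: w_def if_distrib[of Im] cong: if_cong)
    have "cmod (?c - w / 2) \<le> cmod w / 4" using cmod_le[of "?c - w / 2"] re im by simp
    moreover have "cmod (w / 2) \<le> cmod ?c + cmod (?c - w / 2)"
      using norm_triangle_ineq4[of ?c "?c - w / 2"] by simp
    ultimately show ?thesis by (simp add: norm_divide)
  qed
  then show ?thesis
    by (intro that[of \<nu> e]) (use \<nu> e_bd orth in \<open>auto simp: w_def e_def\<close>)
qed

text \<open>
  For nonnegative \<open>K\<close> and \<open>e\<close> this says, by the bipolar theorem, that \<open>y\<close> lies in the closure of \<open>K\<close> times the absolutely convex
  hull of \<open>A\<close> plus \<open>e\<close> times the unit ball. The dual formulation is what the sets in question satisfy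
  directly, and it is what the proof evaluates.
\<close>

definition (in complex_normed_space) near_hull :: "'a set \<Rightarrow> real \<Rightarrow> real \<Rightarrow> 'a \<Rightarrow> bool"
  where "near_hull A K e y \<longleftrightarrow> (\<forall>\<phi>\<in>operators X complex_scalars. \<forall>s\<ge>0. \<forall>t\<ge>0.
    (\<forall>a\<in>A. cmod (\<phi> a) \<le> s) \<longrightarrow> (\<forall>x\<in>vcarrier X. cmod (\<phi> x) \<le> t * vnorm X x) \<longrightarrow>
    cmod (\<phi> y) \<le> K * s + e * t)"

definition (in complex_normed_space) almost_absorbed :: "'a set \<Rightarrow> 'a set \<Rightarrow> bool"
  where "almost_absorbed A Y \<longleftrightarrow> (\<forall>e>0. \<exists>K. \<forall>y\<in>Y. near_hull A K e y)"

context complex_normed_space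
begin

lemma near_hullD:
  assumes "near_hull A K e y" "\<phi> \<in> operators X complex_scalars" "s \<ge> 0" "t \<ge> 0"
    "\<And>a. a \<in> A \<Longrightarrow> cmod (\<phi> a) \<le> s" "\<And>x. x \<in> vcarrier X \<Longrightarrow> cmod (\<phi> x) \<le> t * vnorm X x"
  shows "cmod (\<phi> y) \<le> K * s + e * t"
  using assms unfolding near_hull_def by simp

lemma dual_ball_operators: "\<phi> \<in> dual_ball \<Longrightarrow> \<phi> \<in> operators X complex_scalars"
  by (simp add: dual_ball_def)

text \<open>
  The weak* compactness of the dual ball, used for closed conditions on countably many vectors.
\<close>

lemma dual_ball_cluster_point:
  assumes \<phi>: "\<And>k. \<phi> k \<in> dual_ball" and d: "\<And>i k. i \<le> k \<Longrightarrow> c \<le> cmod (\<phi> k (d i))"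
  obtains \<psi> where "\<psi> \<in> dual_ball" "\<And>i :: nat. c \<le> cmod (\<psi> (d i))"
proof -
  have op: "\<phi> k \<in> operators X complex_scalars" for k using \<phi> by (simp add: dual_ball_def)
  define K where "K x = (if x \<in> vcarrier X then cball 0 (vnorm X x) else {0 :: complex})" for x
  have "\<phi> k x \<in> K x" for k x using \<phi>[of k] op[of k] by (auto simp: K_def dual_ball_def operators_off)
  moreover have "compact (K x)" for x by (simp add: K_def)
  ultimately obtain \<psi> where \<psi>: "\<And>N Q. closed Q \<Longrightarrow> (\<And>n. n \<ge> N \<Longrightarrow> \<phi> n \<in> Q) \<Longrightarrow> \<psi> \<in> Q"
    using function_cluster_point[of K \<phi>] by blast
  have coord: "continuous_on UNIV (\<lambda>\<mu> :: 'a \<Rightarrow> complex. \<mu> x)" for x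
    by (rule continuous_on_product_coordinates)
  have bound: "cmod (\<psi> x) \<le> vnorm X x" if "x \<in> vcarrier X" for x
  proof -
    have cl: "closed {\<mu> :: 'a \<Rightarrow> complex. cmod (\<mu> x) \<le> vnorm X x}"
      by (intro closed_Collect_le continuous_on_norm coord continuous_on_const)
    show ?thesis using \<psi>[OF cl, of 0] \<phi> that by (simp add: dual_ball_def)
  qed
  have "\<psi> \<in> operators X complex_scalars"
  proof (rule functionalI[OF complex_normed_space_axioms])
    fix x y assume xy: "x \<in> vcarrier X" "y \<in> vcarrier X"
    have cl: "closed {\<mu> :: 'a \<Rightarrow> complex. \<mu> (x + y) = \<mu> x + \<mu> y}"
      by (intro closed_Collect_eq continuous_on_add coord)
    show "\<psi> (x + y) = \<psi> x + \<psi> y" using \<psi>[OF cl, of 0] operators_add[OF op xy] by simp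
  next
    fix a x assume x: "x \<in> vcarrier X"
    have cl: "closed {\<mu> :: 'a \<Rightarrow> complex. \<mu> (a *\<^sub>C x) = a * \<mu> x}"
      by (intro closed_Collect_eq continuous_on_mult continuous_on_const coord)
    show "\<psi> (a *\<^sub>C x) = a * \<psi> x" using \<psi>[OF cl, of 0] functional_scale[OF op x] by simp
  next
    fix x assume x: "x \<notin> vcarrier X"
    have cl: "closed {\<mu> :: 'a \<Rightarrow> complex. \<mu> x = 0}"
      by (intro closed_Collect_eq continuous_on_const coord)
    show "\<psi> x = 0" using \<psi>[OF cl, of 0] operators_off[OF op x] by simp
  next
    show "cmod (\<psi> x) \<le> 1 * vnorm X x" if "x \<in> vcarrier X" for x using bound[OF that] by simp
  qed
  then have "\<psi> \<in> dual_ball" using bound by (simp add: dual_ball_def)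
  moreover have "c \<le> cmod (\<psi> (d i))" for i
  proof -
    have cl: "closed {\<mu> :: 'a \<Rightarrow> complex. c \<le> cmod (\<mu> (d i))}"
      by (intro closed_Collect_le continuous_on_norm coord continuous_on_const)
    show ?thesis using \<psi>[OF cl, of i] d by simp
  qed
  ultimately show ?thesis using that by blast
qed

lemma bounded_on_dual_ball_Re_Im:
  assumes "v \<in> vcarrier X"
  shows "bounded_on dual_ball (\<lambda>\<phi>. Re (\<phi> v))" "bounded_on dual_ball (\<lambda>\<phi>. Im (\<phi> v))"
    "bounded_on dual_ball (\<lambda>\<phi>. cmod (\<phi> v))"
proof -
  have *: "cmod (\<phi> v) \<le> vnorm X v" if "\<phi> \<in> dual_ball" for \<phi> using that assms by (simp add: dual_ball_def)
  show "bounded_on dual_ball (\<lambda>\<phi>. Re (\<phi> v))"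
    by (rule bounded_onI) (use order_trans[OF abs_Re_le_cmod *] in blast)
  show "bounded_on dual_ball (\<lambda>\<phi>. Im (\<phi> v))"
    by (rule bounded_onI) (use order_trans[OF abs_Im_le_cmod *] in blast)
  show "bounded_on dual_ball (\<lambda>\<phi>. cmod (\<phi> v))"
    by (rule bounded_onI[of _ _ "vnorm X v"]) (use * in simp)
qed

text \<open>
  The integral of \<open>\<phi> v * e \<phi>\<close> over the functionals \<open>\<phi>\<close>.
\<close>

definition mean_functional :: "((('a \<Rightarrow> complex) \<Rightarrow> real) \<Rightarrow> real) \<Rightarrow> (('a \<Rightarrow> complex) \<Rightarrow> real) \<Rightarrow> 'a \<Rightarrow> complex"
  where "mean_functional \<nu> e v = (if v \<in> vcarrier X
    then Complex (\<nu> (\<lambda>\<phi>. Re (\<phi> v) * e \<phi>)) (\<nu> (\<lambda>\<phi>. Im (\<phi> v) * e \<phi>)) else 0)"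

lemma mean_functional:
  assumes \<nu>: "mean dual_ball \<nu>" and e: "bounded_on dual_ball e" "\<And>\<phi>. e \<phi> * e \<phi> = 1"
  shows "mean_functional \<nu> e \<in> operators X complex_scalars" (is ?op)
    and "v \<in> vcarrier X \<Longrightarrow> cmod (mean_functional \<nu> e v) \<le> 2 * \<nu> (\<lambda>\<phi>. cmod (\<phi> v))" (is "_ \<Longrightarrow> ?le v")
    and "v \<in> vcarrier X \<Longrightarrow> cmod (mean_functional \<nu> e v) \<le> 2 * vnorm X v" (is "_ \<Longrightarrow> ?bound v")
proof -
  interpret mean dual_ball \<nu> by (rule \<nu>)
  note bd = bounded_on_intros bounded_on_dual_ball_Re_Im e(1)
  have abs_e: "\<bar>e \<phi>\<bar> = 1" for \<phi> using e(2)[of \<phi>] by (metis abs_1 abs_mult_self_eq abs_mult abs_ge_zero mult_cancel_right1 real_sqrt_abs2 real_sqrt_one)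
  have le: "?le v" if v: "v \<in> vcarrier X" for v
  proof -
    have "\<bar>\<nu> (\<lambda>\<phi>. Re (\<phi> v) * e \<phi>)\<bar> \<le> \<nu> (\<lambda>\<phi>. cmod (\<phi> v))"
      "\<bar>\<nu> (\<lambda>\<phi>. Im (\<phi> v) * e \<phi>)\<bar> \<le> \<nu> (\<lambda>\<phi>. cmod (\<phi> v))"
      by (rule abs_le; (intro bd v)?; simp add: abs_mult abs_e abs_Re_le_cmod abs_Im_le_cmod)+
    then show ?thesis
      using cmod_le[of "mean_functional \<nu> e v"] v by (simp add: mean_functional_def)
  qed
  have bound: "?bound v" if v: "v \<in> vcarrier X" for v
  proof -
    have "\<nu> (\<lambda>\<phi>. cmod (\<phi> v)) \<le> \<nu> (\<lambda>_. vnorm X v)"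
      by (rule mono) ((intro bd v)+, simp add: dual_ball_def v)
    then show ?thesis using le[OF v] const by simp
  qed
  show ?op
  proof (rule functionalI[OF complex_normed_space_axioms, where C = 2])
    fix u v assume uv: "u \<in> vcarrier X" "v \<in> vcarrier X"
    note uv' = add_in[OF uv]
    have lin: "\<phi> (u + v) = \<phi> u + \<phi> v" if "\<phi> \<in> dual_ball" for \<phi>
      using operators_add[OF dual_ball_operators[OF that] uv] .
    have "\<nu> (\<lambda>\<phi>. Re (\<phi> (u + v)) * e \<phi>) = \<nu> (\<lambda>\<phi>. Re (\<phi> u) * e \<phi> + Re (\<phi> v) * e \<phi>)"
      "\<nu> (\<lambda>\<phi>. Im (\<phi> (u + v)) * e \<phi>) = \<nu> (\<lambda>\<phi>. Im (\<phi> u) * e \<phi> + Im (\<phi> v) * e \<phi>)"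
      by (rule cong; (intro bd uv uv')?; simp add: lin distrib_right)+
    moreover have "\<nu> (\<lambda>\<phi>. Re (\<phi> u) * e \<phi> + Re (\<phi> v) * e \<phi>) = \<nu> (\<lambda>\<phi>. Re (\<phi> u) * e \<phi>) + \<nu> (\<lambda>\<phi>. Re (\<phi> v) * e \<phi>)"
      "\<nu> (\<lambda>\<phi>. Im (\<phi> u) * e \<phi> + Im (\<phi> v) * e \<phi>) = \<nu> (\<lambda>\<phi>. Im (\<phi> u) * e \<phi>) + \<nu> (\<lambda>\<phi>. Im (\<phi> v) * e \<phi>)"
      by (rule add; intro bd uv)+
    ultimately show "mean_functional \<nu> e (u + v) = mean_functional \<nu> e u + mean_functional \<nu> e v"
      using uv uv' by (simp add: mean_functional_def complex_eq_iff)
  next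
    fix a v assume v: "v \<in> vcarrier X"
    note v' = scale_in[OF v]
    have lin: "\<phi> (a *\<^sub>C v) = a * \<phi> v" if "\<phi> \<in> dual_ball" for \<phi>
      using functional_scale[OF dual_ball_operators[OF that] v] .
    have "\<nu> (\<lambda>\<phi>. Re (\<phi> (a *\<^sub>C v)) * e \<phi>) = \<nu> (\<lambda>\<phi>. Re a * (Re (\<phi> v) * e \<phi>) - Im a * (Im (\<phi> v) * e \<phi>))"
      "\<nu> (\<lambda>\<phi>. Im (\<phi> (a *\<^sub>C v)) * e \<phi>) = \<nu> (\<lambda>\<phi>. Re a * (Im (\<phi> v) * e \<phi>) + Im a * (Re (\<phi> v) * e \<phi>))"
      by (rule cong; (intro bd v v')?; simp add: lin algebra_simps)+
    moreover have "\<nu> (\<lambda>\<phi>. Re a * (Re (\<phi> v) * e \<phi>) - Im a * (Im (\<phi> v) * e \<phi>)) =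
        \<nu> (\<lambda>\<phi>. Re a * (Re (\<phi> v) * e \<phi>)) - \<nu> (\<lambda>\<phi>. Im a * (Im (\<phi> v) * e \<phi>))"
      by (rule diff; intro bd v)
    moreover have "\<nu> (\<lambda>\<phi>. Re a * (Im (\<phi> v) * e \<phi>) + Im a * (Re (\<phi> v) * e \<phi>)) =
        \<nu> (\<lambda>\<phi>. Re a * (Im (\<phi> v) * e \<phi>)) + \<nu> (\<lambda>\<phi>. Im a * (Re (\<phi> v) * e \<phi>))"
      by (rule add; intro bd v)
    moreover have "\<nu> (\<lambda>\<phi>. c * (Re (\<phi> v) * e \<phi>)) = c * \<nu> (\<lambda>\<phi>. Re (\<phi> v) * e \<phi>)"
      "\<nu> (\<lambda>\<phi>. c * (Im (\<phi> v) * e \<phi>)) = c * \<nu> (\<lambda>\<phi>. Im (\<phi> v) * e \<phi>)" for c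
      by (rule scale; intro bd v)+
    ultimately show "mean_functional \<nu> e (a *\<^sub>C v) = a * mean_functional \<nu> e v"
      using v v' by (simp add: mean_functional_def complex_eq_iff)
  qed (use bound in \<open>auto simp: mean_functional_def\<close>)
  show "v \<in> vcarrier X \<Longrightarrow> ?le v" "v \<in> vcarrier X \<Longrightarrow> ?bound v" using le bound by auto
qed

text \<open>
  By Bessel's inequality the functionals \<open>mean_functional \<nu> (e i)\<close> tend to \<open>0\<close> at each fixed \<open>b m\<close>,
  so for sparse indices \<open>m k\<close> they remain large at the differences \<open>d k\<close> of consecutive terms. Thus
  \<open>cmod (\<phi> (d k))\<close> is not small in the mean, infinitely many of the closed sets on which it is at
  least \<open>c / 8\<close> have the finite intersection property, and by compactness some functional lies in all
  of them; but \<open>\<phi> (d k)\<close> tends to \<open>0\<close> for every \<open>\<phi>\<close>.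
\<close>

lemma Rosenthal_sequence_no_rademacher:
  assumes \<nu>: "mean dual_ball \<nu>" and e: "\<And>i :: nat. bounded_on dual_ball (e i)" "\<And>i \<phi>. e i \<phi> * e i \<phi> = 1"
    and orth: "\<And>i j. i \<noteq> j \<Longrightarrow> \<nu> (\<lambda>\<phi>. e i \<phi> * e j \<phi>) = 0"
    and b: "weakly_Cauchy X b" "\<And>i. vnorm X (b i) \<le> C"
    and c: "c > 0" "\<And>i. c < cmod (mean_functional \<nu> (e i) (b i))"
  shows False
proof -
  interpret mean dual_ball \<nu> by (rule \<nu>)
  have bX: "b i \<in> vcarrier X" for i using b(1) by (auto simp: weakly_Cauchy_def)
  define \<psi> where "\<psi> i = mean_functional \<nu> (e i)" for i
  note \<psi> = mean_functional[OF \<nu> e, folded \<psi>_def]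
  have lim: "(\<lambda>i. \<psi> i v) \<longlonglongrightarrow> 0" if v: "v \<in> vcarrier X" for v
  proof -
    have "(\<lambda>i. Complex (\<nu> (\<lambda>\<phi>. Re (\<phi> v) * e i \<phi>)) (\<nu> (\<lambda>\<phi>. Im (\<phi> v) * e i \<phi>))) \<longlonglongrightarrow> Complex 0 0"
      by (intro tendsto_Complex Bessel_tendsto_0 bounded_on_dual_ball_Re_Im v e orth)
    then show ?thesis using v by (simp add: \<psi>_def mean_functional_def flip: zero_complex.code)
  qed
  have "\<exists>m. \<forall>k::nat. True \<and> m k < m (Suc k) \<and> cmod (\<psi> (m (Suc k)) (b (m k))) < c / 2"
  proof (rule dependent_nat_choice)
    fix m :: nat
    obtain N where "\<forall>i\<ge>N. cmod (\<psi> i (b m)) < c / 2"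
      using LIMSEQ_D[OF lim[OF bX[of m]], of "c / 2"] c(1) by auto
    then show "\<exists>m'. True \<and> m < m' \<and> cmod (\<psi> m' (b m)) < c / 2"
      by (intro exI[of _ "max N (Suc m)"]) auto
  qed auto
  then obtain m where m: "\<And>k. m k < m (Suc k)" "\<And>k. cmod (\<psi> (m (Suc k)) (b (m k))) < c / 2" by blast
  define d where "d k = b (m (Suc k)) - b (m k)" for k
  have dX: "d k \<in> vcarrier X" for k unfolding d_def by (intro diff_in bX)
  define C' where "C' = 2 * \<bar>C\<bar> + 1"
  have C': "C' > 0" by (simp add: C'_def)
  have dC: "vnorm X (d k) \<le> C'" for k
    using norm_diff_triangle[OF bX bX, of "m (Suc k)" "m k"] b(2)[of "m (Suc k)"] b(2)[of "m k"]
    by (simp add: d_def C'_def)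
  define D where "D k = {\<phi>. c / 8 \<le> cmod (\<phi> (d k))}" for k
  have "c / (8 * C') \<le> \<nu> (indicator (D k))" for k
  proof -
    have "c < cmod (\<psi> (m (Suc k)) (d k)) + cmod (\<psi> (m (Suc k)) (b (m k)))"
      using c(2)[of "m (Suc k)"] norm_triangle_ineq[of "\<psi> (m (Suc k)) (d k)" "\<psi> (m (Suc k)) (b (m k))"]
        operators_diff[OF complex_normed_space_axioms \<psi>(1) bX bX, of "m (Suc k)" "m (Suc k)" "m k"]
      by (simp add: d_def \<psi>_def)
    then have "c / 4 \<le> \<nu> (\<lambda>\<phi>. cmod (\<phi> (d k)))"
      using m(2)[of k] \<psi>(2)[OF dX, of "m (Suc k)" k] by simp
    also have "\<dots> \<le> \<nu> (\<lambda>\<phi>. c / 8 + C' * indicator (D k) \<phi>)"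
    proof (rule mono)
      show "cmod (\<phi> (d k)) \<le> c / 8 + C' * indicator (D k) \<phi>" if "\<phi> \<in> dual_ball" for \<phi>
      proof -
        have "cmod (\<phi> (d k)) \<le> C'" using that dX[of k] dC[of k] unfolding dual_ball_def by force
        then show ?thesis using c(1) by (auto simp: D_def indicator_def)
      qed
    qed (intro bounded_on_intros bounded_on_dual_ball_Re_Im dX)+
    also have "\<dots> = \<nu> (\<lambda>_. c / 8) + \<nu> (\<lambda>\<phi>. C' * indicator (D k) \<phi>)" by (rule add; intro bounded_on_intros)
    also have "\<dots> = c / 8 + C' * \<nu> (indicator (D k))" using const scale[OF bounded_on_indicator] by simp
    finally show ?thesis using C' by (simp add: field_simps)
  qed
  then obtain r :: "nat \<Rightarrow> nat" where r: "strict_mono r" "\<And>k. \<exists>\<phi>\<in>dual_ball. \<forall>i\<le>k. \<phi> \<in> D (r i)"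
    using infinite_intersection[of "c / (8 * C')" D] c(1) C' by (metis mult_pos_pos zero_less_divide_iff zero_less_numeral)
  then obtain \<phi> where \<phi>: "\<And>k. \<phi> k \<in> dual_ball" "\<And>i k. i \<le> k \<Longrightarrow> \<phi> k \<in> D (r i)" by metis
  obtain \<theta> where \<theta>: "\<theta> \<in> dual_ball" "\<And>i. c / 8 \<le> cmod (\<theta> (d (r i)))"
    using dual_ball_cluster_point[of \<phi> "c / 8" "\<lambda>i. d (r i)"] \<phi> by (auto simp: D_def)
  have op: "\<theta> \<in> operators X complex_scalars" using \<theta>(1) by (simp add: dual_ball_def)
  obtain N where N: "\<forall>i\<ge>N. \<forall>j\<ge>N. cmod (\<theta> (b i) - \<theta> (b j)) < c / 8"
    using weakly_CauchyD[OF b(1) op] c(1) unfolding Cauchy_iff by (meson divide_pos_pos zero_less_numeral)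
  have "N \<le> m (r N)" using m(1) r(1) by (meson order_trans strict_mono_Suc_iff strict_mono_imp_increasing)
  moreover have "m (r N) \<le> m (Suc (r N))" using m(1) less_imp_le by blast
  ultimately have "cmod (\<theta> (b (m (Suc (r N)))) - \<theta> (b (m (r N)))) < c / 8" using N by simp
  then show False
    using \<theta>(2)[of N] operators_diff[OF complex_normed_space_axioms op bX bX] by (simp add: d_def)
qed

text \<open>
  This contains the theorem that the closed absolutely convex hull of a Rosenthal set is Rosenthal. If a
  sequence \<open>y\<close> in \<open>Y\<close> has no weakly Cauchy subsequence, there are Rademacher functions \<open>e i\<close> for a
  mean on the dual ball such that the functionals \<open>mean_functional \<nu> (e i)\<close> are bounded below at
  terms of \<open>y\<close>. As \<open>y\<close> is almost absorbed by \<open>A\<close>, they are bounded below at suitable \<open>a i \<in> A\<close>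
  as well, and a weakly Cauchy subsequence of \<open>a\<close> contradicts the preceding lemma.
\<close>

theorem rosenthal_set_almost_absorbed:
  assumes A: "rosenthal_set X A" "\<And>a. a \<in> A \<Longrightarrow> vnorm X a \<le> C"
    and Y: "Y \<subseteq> vcarrier X" "almost_absorbed A Y"
  shows "rosenthal_set X Y"
  unfolding rosenthal_set_def
proof (intro conjI allI impI)
  fix y :: "nat \<Rightarrow> 'a" assume "range y \<subseteq> Y"
  then have y: "y n \<in> Y" "y n \<in> vcarrier X" for n using Y(1) by auto
  have AX: "A \<subseteq> vcarrier X" using A(1) by (simp add: rosenthal_set_def)
  have abs: "\<exists>K. \<forall>n. near_hull A K e (y n)" if "e > 0" for e
    using Y(2) that y(1) unfolding almost_absorbed_def by metis
  show "\<exists>r::nat \<Rightarrow> nat. strict_mono r \<and> weakly_Cauchy X (y \<circ> r)"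
  proof (rule pointwise_Cauchy_or_independent[of dual_ball "\<lambda>n \<phi>. \<phi> (y n)"])
    obtain K where K: "\<And>n. near_hull A K 1 (y n)" using abs[of 1] by auto
    fix \<phi> assume \<phi>: "\<phi> \<in> dual_ball"
    have "cmod (\<phi> a) \<le> \<bar>C\<bar>" if "a \<in> A" for a
    proof -
      have "cmod (\<phi> a) \<le> vnorm X a" using \<phi> that AX by (auto simp: dual_ball_def)
      then show ?thesis using A(2)[OF that] by linarith
    qed
    then have "cmod (\<phi> (y n)) \<le> K * \<bar>C\<bar> + 1 * 1" for n
      by (intro near_hullD[OF K]) (use \<phi> in \<open>auto simp: dual_ball_def\<close>)
    then show "bounded (range (\<lambda>n. \<phi> (y n)))" unfolding bounded_iff by blast
  next
    fix r :: "nat \<Rightarrow> nat"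
    assume "strict_mono r" "\<And>\<phi>. \<phi> \<in> dual_ball \<Longrightarrow> Cauchy (\<lambda>n. \<phi> (y (r n)))"
    then show ?thesis using y by (intro exI[of _ r]) (auto intro!: weakly_CauchyI)
  next
    fix p q and r :: "nat \<Rightarrow> nat"
    assume pq: "p \<noteq> q" and r: "strict_mono r"
      and ind: "\<And>N P. \<exists>\<phi>\<in>dual_ball. \<forall>i<N. cmod (\<phi> (y (r i)) - (if i \<in> P then p else q)) < cmod (p - q) / 8"
    obtain \<nu> e where \<nu>: "mean dual_ball \<nu>" and e: "\<And>i :: nat. bounded_on dual_ball (e i)" "\<And>i \<phi>. e i \<phi> * e i \<phi> = 1"
      and orth: "\<And>i j. i \<noteq> j \<Longrightarrow> \<nu> (\<lambda>\<phi>. e i \<phi> * e j \<phi>) = 0"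
      and big: "\<And>i. cmod (p - q) / 4 \<le> cmod (Complex (\<nu> (\<lambda>\<phi>. Re (\<phi> (y (r i))) * e i \<phi>)) (\<nu> (\<lambda>\<phi>. Im (\<phi> (y (r i))) * e i \<phi>)))"
      using rademacher_mean[OF bounded_on_dual_ball_Re_Im(1)[OF y(2)] bounded_on_dual_ball_Re_Im(2)[OF y(2)] pq ind]
      by blast
    define w where "w = cmod (p - q)"
    have w: "w > 0" using pq by (simp add: w_def)
    obtain K where K: "\<And>n. near_hull A K (w / 16) (y n)" using abs[of "w / 16"] w by auto
    \<comment> \<open>A functional of norm at most \<open>2\<close> that is bounded by \<open>c\<close> on \<open>A\<close> is bounded by
      \<open>K * c + w / 16 * 2 \<le> 3 * w / 16\<close> on the sequence, which is less than the lower bound \<open>w / 4\<close>.\<close>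
    define k where "k = \<bar>K\<bar> + 1"
    have k: "k > 0" "K \<le> k" by (simp_all add: k_def)
    define c where "c = w / (16 * k)"
    have c: "c > 0" using w k by (simp add: c_def)
    have Kc: "K * c \<le> w / 16"
    proof -
      have "K * c \<le> k * c" using c k by (intro mult_right_mono) auto
      also have "\<dots> = w / 16" using k by (simp add: c_def)
      finally show ?thesis .
    qed
    have "\<exists>a\<in>A. c < cmod (mean_functional \<nu> (e i) a)" for i
    proof (rule ccontr)
      assume "\<not> ?thesis"
      then have "\<forall>a\<in>A. cmod (mean_functional \<nu> (e i) a) \<le> c" by force
      then have "cmod (mean_functional \<nu> (e i) (y (r i))) \<le> K * c + w / 16 * 2"
        by (intro near_hullD[OF K]) (use mean_functional[OF \<nu> e] c in auto)
      moreover have "w / 4 \<le> cmod (mean_functional \<nu> (e i) (y (r i)))"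
        using big[of i] y(2) by (simp add: mean_functional_def w_def)
      ultimately show False using Kc w by simp
    qed
    then obtain a where a: "\<And>i. a i \<in> A" "\<And>i. c < cmod (mean_functional \<nu> (e i) (a i))" by metis
    obtain t :: "nat \<Rightarrow> nat" where t: "strict_mono t" "weakly_Cauchy X (a \<circ> t)"
      using A(1) a(1) unfolding rosenthal_set_def by (metis image_subset_iff)
    have False
      by (rule Rosenthal_sequence_no_rademacher[OF \<nu>, of "\<lambda>i. e (t i)" "a \<circ> t" C c])
        (use e orth t a A(2) c in \<open>auto simp: strict_mono_eq\<close>)
    then show ?thesis ..
  qed
qed (rule Y(1))

end

section \<open>An interpolation space without \<open>ell1\<close>\<close>

locale bounded_subset = complex_banach_space X for X :: "'a::complex_vector nspace" +
  fixes A :: "'a set" and C :: real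
  assumes A_in: "A \<subseteq> vcarrier X" and A_bound: "a \<in> A \<Longrightarrow> vnorm X a \<le> C" and C_nonneg: "0 \<le> C"
begin

text \<open>
  The polar of \<open>2 ^ n\<close> times the absolutely convex hull of \<open>A\<close> plus \<open>1 / 2 ^ n\<close> times the unit ball.
\<close>

definition test_functionals :: "nat \<Rightarrow> ('a \<Rightarrow> complex) set"
  where "test_functionals n = {\<phi> \<in> operators X complex_scalars. \<exists>s\<ge>0. \<exists>t\<ge>0. 2 ^ n * s + t / 2 ^ n \<le> 1 \<and>
    (\<forall>a\<in>A. cmod (\<phi> a) \<le> s) \<and> (\<forall>x\<in>vcarrier X. cmod (\<phi> x) \<le> t * vnorm X x)}"

text \<open>
  By the bipolar theorem this is the gauge of the closure of that sum.
\<close>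

definition level_norm :: "nat \<Rightarrow> 'a \<Rightarrow> real"
  where "level_norm n x = (SUP \<phi>\<in>test_functionals n. cmod (\<phi> x))"

text \<open>
  The interpolation space of Davis, Figiel, Johnson and Pelczynski for the set \<open>A\<close>, with a
  \<open>c\<^sub>0\<close>-sum instead of the usual \<open>\<ell>\<^sub>2\<close>-sum of the norms. In a \<open>c\<^sub>0\<close>-sum, sums of vectors with
  nearly disjoint levels stay bounded.
\<close>

definition interp :: "'a nspace"
  where "interp = \<lparr>vcarrier = {x \<in> vcarrier X. (\<lambda>n. level_norm n x) \<longlonglongrightarrow> 0}, vnorm = (\<lambda>x. SUP n. level_norm n x)\<rparr>"

lemma test_functionals_ne: "test_functionals n \<noteq> {}"
proof -
  have "(\<lambda>_. 0) \<in> operators X complex_scalars"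
    by (rule functionalI[where C = 0]) (auto simp: complex_normed_space_axioms)
  then have "(\<lambda>_. 0) \<in> test_functionals n"
    unfolding test_functionals_def by (auto intro!: exI[of _ 0])
  then show ?thesis by blast
qed

lemma test_functionalsE:
  assumes "\<phi> \<in> test_functionals n"
  obtains s where "\<phi> \<in> operators X complex_scalars" "0 \<le> s" "s \<le> 1 / 2 ^ n" "\<And>a. a \<in> A \<Longrightarrow> cmod (\<phi> a) \<le> s"
    "\<And>x. x \<in> vcarrier X \<Longrightarrow> cmod (\<phi> x) \<le> 2 ^ n * vnorm X x"
proof -
  obtain s t where st: "s \<ge> 0" "t \<ge> 0" "2 ^ n * s + t / 2 ^ n \<le> 1" "\<And>a. a \<in> A \<Longrightarrow> cmod (\<phi> a) \<le> s"
    "\<And>x. x \<in> vcarrier X \<Longrightarrow> cmod (\<phi> x) \<le> t * vnorm X x" and op: "\<phi> \<in> operators X complex_scalars"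
    using assms unfolding test_functionals_def by blast
  have "2 ^ n * s \<le> 1" "t / 2 ^ n \<le> 1" using st(1-3) by (smt (verit) divide_nonneg_nonneg mult_nonneg_nonneg zero_le_power)+
  then have "s \<le> 1 / 2 ^ n" "t \<le> 2 ^ n" by (simp_all add: field_simps)
  moreover have "cmod (\<phi> x) \<le> 2 ^ n * vnorm X x" if "x \<in> vcarrier X" for x
    using st(5)[OF that] mult_right_mono[OF \<open>t \<le> 2 ^ n\<close> norm_nonneg[OF that]] by simp
  ultimately show ?thesis using that[of s] op st by blast
qed

lemma test_functionals_bdd:
  assumes "x \<in> vcarrier X" shows "bdd_above ((\<lambda>\<phi>. cmod (\<phi> x)) ` test_functionals n)"
proof (rule bdd_aboveI2)
  fix \<phi> assume "\<phi> \<in> test_functionals n"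
  then show "cmod (\<phi> x) \<le> 2 ^ n * vnorm X x" by (rule test_functionalsE) (simp add: assms)
qed

lemma level_norm_upper: "x \<in> vcarrier X \<Longrightarrow> \<phi> \<in> test_functionals n \<Longrightarrow> cmod (\<phi> x) \<le> level_norm n x"
  unfolding level_norm_def by (rule cSUP_upper[OF _ test_functionals_bdd])

lemma level_norm_least: "(\<And>\<phi>. \<phi> \<in> test_functionals n \<Longrightarrow> cmod (\<phi> x) \<le> c) \<Longrightarrow> level_norm n x \<le> c"
  unfolding level_norm_def by (rule cSUP_least[OF test_functionals_ne])

lemma level_norm_nonneg: "x \<in> vcarrier X \<Longrightarrow> 0 \<le> level_norm n x"
  using test_functionals_ne[of n] level_norm_upper[of x _ n] by (meson all_not_in_conv norm_ge_zero order_trans)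

lemma level_norm_le_norm: "x \<in> vcarrier X \<Longrightarrow> level_norm n x \<le> 2 ^ n * vnorm X x"
  by (rule level_norm_least) (erule test_functionalsE, simp)

lemma level_norm_triangle:
  assumes "x \<in> vcarrier X" "y \<in> vcarrier X" shows "level_norm n (x + y) \<le> level_norm n x + level_norm n y"
proof (rule level_norm_least)
  fix \<phi> assume \<phi>: "\<phi> \<in> test_functionals n"
  then have op: "\<phi> \<in> operators X complex_scalars" by (simp add: test_functionals_def)
  have "cmod (\<phi> (x + y)) \<le> cmod (\<phi> x) + cmod (\<phi> y)"
    unfolding operators_add[OF op assms] by (rule norm_triangle_ineq)
  then show "cmod (\<phi> (x + y)) \<le> level_norm n x + level_norm n y"
    using level_norm_upper[OF assms(1) \<phi>] level_norm_upper[OF assms(2) \<phi>] by simp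
qed

lemma level_norm_scale:
  assumes x: "x \<in> vcarrier X" shows "level_norm n (a *\<^sub>C x) = cmod a * level_norm n x"
proof -
  have le: "level_norm n (a *\<^sub>C x) \<le> cmod a * level_norm n x" if x: "x \<in> vcarrier X" for a x
  proof (rule level_norm_least)
    fix \<phi> assume \<phi>: "\<phi> \<in> test_functionals n"
    then have op: "\<phi> \<in> operators X complex_scalars" by (simp add: test_functionals_def)
    show "cmod (\<phi> (a *\<^sub>C x)) \<le> cmod a * level_norm n x"
      unfolding functional_scale[OF op x] norm_mult by (rule mult_left_mono[OF level_norm_upper[OF x \<phi>]]) simp
  qed
  show ?thesis
    by (rule homogeneous_if_subhomogeneous[of "vcarrier X"]) (simp_all add: le scale_in level_norm_nonneg x)
qed

text \<open>
  Up to the factor \<open>2 ^ n * s + t / 2 ^ n + e\<close> the functional is a test functional; the additional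
  \<open>e > 0\<close> covers the case \<open>s = t = 0\<close>.
\<close>

lemma functional_le_level_norm:
  assumes x: "x \<in> vcarrier X" and op: "\<phi> \<in> operators X complex_scalars" and st: "s \<ge> 0" "t \<ge> 0"
    and s: "\<And>a. a \<in> A \<Longrightarrow> cmod (\<phi> a) \<le> s" and t: "\<And>y. y \<in> vcarrier X \<Longrightarrow> cmod (\<phi> y) \<le> t * vnorm X y"
  shows "cmod (\<phi> x) \<le> (2 ^ n * s + t / 2 ^ n) * level_norm n x"
proof -
  let ?D = "2 ^ n * s + t / 2 ^ n"
  have "cmod (\<phi> x) \<le> (?D + e) * level_norm n x" if e: "e > 0" for e
  proof -
    have D: "?D + e > 0" using st e by (simp add: add_nonneg_pos)
    let ?\<psi> = "\<lambda>y. of_real (1 / (?D + e)) * \<phi> y"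
    have c: "cmod (of_real (1 / (?D + e)) * z) = cmod z / (?D + e)" for z
      using D by (simp only: norm_mult norm_of_real) simp
    have bd: "cmod (?\<psi> y) \<le> t / (?D + e) * vnorm X y" if "y \<in> vcarrier X" for y
      unfolding c using divide_right_mono[OF t[OF that], of "?D + e"] D by simp
    have "?\<psi> \<in> operators X complex_scalars"
      by (rule functionalI[OF complex_normed_space_axioms _ _ _ bd])
        (simp_all add: operators_add[OF op] functional_scale[OF op] operators_off[OF op] distrib_left)
    moreover have "2 ^ n * (s / (?D + e)) + t / (?D + e) / 2 ^ n \<le> 1"
    proof -
      have "2 ^ n * (s / (?D + e)) + t / (?D + e) / 2 ^ n = ?D / (?D + e)" by (simp add: add_divide_distrib)
      then show ?thesis using D e by simp
    qed
    moreover have "cmod (?\<psi> a) \<le> s / (?D + e)" if "a \<in> A" for a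
      unfolding c using s[OF that] D by (simp add: divide_right_mono)
    ultimately have "?\<psi> \<in> test_functionals n"
      unfolding test_functionals_def using st D bd
      by (intro CollectI conjI exI[of _ "s / (?D + e)"] exI[of _ "t / (?D + e)"] ballI) auto
    from level_norm_upper[OF x this] show ?thesis unfolding c using D by (simp add: divide_le_eq mult.commute)
  qed
  then have *: "cmod (\<phi> x) \<le> ?D * level_norm n x + e * level_norm n x" if "e > 0" for e
    using that by (simp add: distrib_right)
  show ?thesis
  proof (rule field_le_epsilon)
    fix e :: real assume e: "e > 0"
    have g: "level_norm n x + 1 > 0" using level_norm_nonneg[OF x, of n] by simp
    have "e / (level_norm n x + 1) * level_norm n x \<le> e" using g e by (simp add: field_simps)
    then show "cmod (\<phi> x) \<le> ?D * level_norm n x + e" using *[of "e / (level_norm n x + 1)"] g e by simp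
  qed
qed

lemma norm_le_level_norm:
  assumes x: "x \<in> vcarrier X" shows "vnorm X x \<le> (2 ^ n * C + 1) * level_norm n x"
proof -
  obtain \<phi> where \<phi>: "\<phi> \<in> dual_ball" "\<phi> x = of_real (vnorm X x)" using norming_functional[OF x] by blast
  have "cmod (\<phi> x) \<le> (2 ^ n * C + 1 / 2 ^ n) * level_norm n x"
  proof (rule functional_le_level_norm[OF x dual_ball_operators[OF \<phi>(1)] C_nonneg])
    show "cmod (\<phi> a) \<le> C" if "a \<in> A" for a
      using \<phi>(1) A_bound[OF that] A_in that unfolding dual_ball_def by force
  qed (use \<phi>(1) in \<open>auto simp: dual_ball_def\<close>)
  also have "\<dots> \<le> (2 ^ n * C + 1) * level_norm n x"
    by (intro mult_right_mono add_left_mono level_norm_nonneg x) simp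
  finally show ?thesis using \<phi>(2) norm_nonneg[OF x] by simp
qed

lemma interp_carrier: "x \<in> vcarrier interp \<longleftrightarrow> x \<in> vcarrier X \<and> (\<lambda>n. level_norm n x) \<longlonglongrightarrow> 0"
  by (simp add: interp_def)

lemma interp_in: "x \<in> vcarrier interp \<Longrightarrow> x \<in> vcarrier X"
  by (simp add: interp_carrier)

lemma level_norm_le_interp: assumes x: "x \<in> vcarrier interp" shows "level_norm n x \<le> vnorm interp x"
proof -
  have "(\<lambda>n. level_norm n x) \<longlonglongrightarrow> 0" using x by (simp add: interp_carrier)
  then have "Bseq (\<lambda>n. level_norm n x)" by (rule convergent_imp_Bseq[OF convergentI])
  then have "bdd_above (range (\<lambda>n. level_norm n x))" by (rule Bseq_bdd_above)
  from cSUP_upper[OF UNIV_I this] show ?thesis by (simp add: interp_def)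
qed

lemma interp_norm_le: "(\<And>n. level_norm n x \<le> c) \<Longrightarrow> vnorm interp x \<le> c"
  by (simp add: interp_def cSUP_least)

lemma complex_normed_space_interp: "complex_normed_space interp"
proof
  have add: "x + y \<in> vcarrier interp" if "x \<in> vcarrier interp" "y \<in> vcarrier interp" for x y
  proof -
    have xy: "x \<in> vcarrier X" "y \<in> vcarrier X" using that by (auto simp: interp_carrier)
    have lim: "(\<lambda>n. level_norm n x + level_norm n y) \<longlonglongrightarrow> 0 + 0"
      using that by (intro tendsto_add) (auto simp: interp_carrier)
    have "(\<lambda>n. level_norm n (x + y)) \<longlonglongrightarrow> 0"
      by (rule tendsto_sandwich[OF _ _ tendsto_const lim[simplified]])
        (use level_norm_nonneg[OF add_in[OF xy]] level_norm_triangle[OF xy] in auto)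
    then show ?thesis using add_in[OF xy] by (simp add: interp_carrier)
  qed
  have scale: "a *\<^sub>C x \<in> vcarrier interp" if "x \<in> vcarrier interp" for a x
    using that tendsto_mult_right_zero[of "\<lambda>n. level_norm n x" _ "cmod a"]
    by (simp add: interp_carrier scale_in level_norm_scale)
  have zero: "level_norm n 0 = 0" for n using level_norm_scale[OF zero_in, of n 0] by simp
  show "complex_vector.subspace (vcarrier interp)"
    unfolding complex_vector.subspace_def using add scale by (auto simp: interp_carrier zero)
  fix x assume x: "x \<in> vcarrier interp"
  then have xX: "x \<in> vcarrier X" by (simp add: interp_carrier)
  show "vnorm interp x = 0 \<longleftrightarrow> x = 0"
  proof
    assume "vnorm interp x = 0"
    then have "level_norm 0 x \<le> 0" using level_norm_le_interp[OF x, of 0] by simp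
    then have "vnorm X x \<le> 0"
      using norm_le_level_norm[OF xX, of 0] C_nonneg level_norm_nonneg[OF xX, of 0] by simp
    then show "x = 0" using norm_eq_zero[OF xX] norm_nonneg[OF xX] by simp
  qed (simp add: interp_def zero)
  have le: "vnorm interp (a *\<^sub>C x) \<le> cmod a * vnorm interp x" if "x \<in> vcarrier interp" for a x
    by (rule interp_norm_le)
      (use that level_norm_le_interp[OF that] in \<open>simp add: interp_carrier level_norm_scale mult_left_mono\<close>)
  have nonneg: "0 \<le> vnorm interp x" if "x \<in> vcarrier interp" for x
    using order_trans[OF level_norm_nonneg[OF interp_in[OF that]] level_norm_le_interp[OF that]] .
  show "vnorm interp (a *\<^sub>C x) = cmod a * vnorm interp x" for a
    by (rule homogeneous_if_subhomogeneous[of "vcarrier interp"]) (fact le scale nonneg x)+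
  fix y assume y: "y \<in> vcarrier interp"
  then have yX: "y \<in> vcarrier X" by (simp add: interp_carrier)
  show "vnorm interp (x + y) \<le> vnorm interp x + vnorm interp y"
    by (rule interp_norm_le) (use level_norm_triangle[OF xX yX] level_norm_le_interp[OF x] level_norm_le_interp[OF y] in \<open>meson add_mono order_trans\<close>)
qed

lemma norm_le_interp:
  assumes "x \<in> vcarrier interp" shows "vnorm X x \<le> (C + 1) * vnorm interp x"
proof -
  have xX: "x \<in> vcarrier X" using assms by (simp add: interp_carrier)
  have "vnorm X x \<le> (C + 1) * level_norm 0 x" using norm_le_level_norm[OF xX, of 0] by simp
  also have "\<dots> \<le> (C + 1) * vnorm interp x"
    using C_nonneg level_norm_le_interp[OF assms] by (intro mult_left_mono) auto
  finally show ?thesis .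
qed

lemma level_norm_diff_commute:
  "x \<in> vcarrier X \<Longrightarrow> y \<in> vcarrier X \<Longrightarrow> level_norm n (x - y) = level_norm n (y - x)"
  using level_norm_scale[OF diff_in[of y x], of n "-1"] by simp

lemma complex_banach_space_interp: "complex_banach_space interp"
proof (rule complex_banach_spaceI[OF complex_normed_space_interp])
  interpret I: complex_normed_space interp by (rule complex_normed_space_interp)
  fix s assume s: "\<And>n :: nat. s n \<in> vcarrier interp"
    and cauchy: "\<And>e. e > 0 \<Longrightarrow> \<exists>N. \<forall>m\<ge>N. \<forall>n\<ge>N. vnorm interp (s m - s n) < e"
  have sX: "s n \<in> vcarrier X" for n using s by (simp add: interp_carrier)
  have "\<exists>N. \<forall>m\<ge>N. \<forall>n\<ge>N. vnorm X (s m - s n) < e" if e: "e > 0" for e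
  proof -
    obtain N where N: "\<forall>m\<ge>N. \<forall>n\<ge>N. vnorm interp (s m - s n) < e / (C + 1)"
      using cauchy[of "e / (C + 1)"] e C_nonneg by auto
    have "vnorm X (s m - s n) < e" if mn: "m \<ge> N" "n \<ge> N" for m n
    proof -
      have "vnorm X (s m - s n) \<le> (C + 1) * vnorm interp (s m - s n)"
        by (rule norm_le_interp[OF I.diff_in[OF s s]])
      also have "\<dots> < (C + 1) * (e / (C + 1))"
        using N mn C_nonneg by (intro mult_strict_left_mono) auto
      finally show ?thesis using C_nonneg by simp
    qed
    then show ?thesis by blast
  qed
  then obtain x where x: "x \<in> vcarrier X" "(\<lambda>n. vnorm X (s n - x)) \<longlonglongrightarrow> 0"
    using Cauchy_limit[of s] sX by metis
  have close: "\<exists>N. \<forall>k\<ge>N. \<forall>n. level_norm n (s k - x) \<le> e" if e: "e > 0" for e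
  proof -
    obtain N where N: "\<forall>m\<ge>N. \<forall>n\<ge>N. vnorm interp (s m - s n) < e" using cauchy[OF e] by blast
    have "level_norm n (s k - x) \<le> e" if k: "k \<ge> N" for k n
    proof -
      have lim: "(\<lambda>l. e + 2 ^ n * vnorm X (s l - x)) \<longlonglongrightarrow> e + 2 ^ n * 0"
        by (intro tendsto_intros x)
      have "level_norm n (s k - x) \<le> e + 2 ^ n * vnorm X (s l - x)" if l: "l \<ge> N" for l
      proof -
        have "level_norm n (s k - x) \<le> level_norm n (s k - s l) + level_norm n (s l - x)"
          using level_norm_triangle[OF diff_in[OF sX sX] diff_in[OF sX x(1)], of n k l l] by simp
        moreover have "level_norm n (s k - s l) \<le> e"
          using level_norm_le_interp[OF I.diff_in[OF s s], of n k l] N k l by (meson le_less_trans less_imp_le)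
        ultimately show ?thesis using level_norm_le_norm[OF diff_in[OF sX x(1)], of n l] by simp
      qed
      then show ?thesis using LIMSEQ_le_const[OF lim, of "level_norm n (s k - x)"] by auto
    qed
    then show ?thesis by blast
  qed
  have xG: "x \<in> vcarrier interp"
    unfolding interp_carrier
  proof (intro conjI x(1) LIMSEQ_I)
    fix e :: real assume e: "e > 0"
    obtain k where k: "\<And>n. level_norm n (s k - x) \<le> e / 2" using close[of "e / 2"] e by auto
    have "(\<lambda>n. level_norm n (s k)) \<longlonglongrightarrow> 0" using s by (simp add: interp_carrier)
    then obtain M where M: "\<forall>n\<ge>M. norm (level_norm n (s k) - 0) < e / 2" using LIMSEQ_D e by (metis half_gt_zero)
    have "norm (level_norm n x - 0) < e" if "n \<ge> M" for n
    proof -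
      have "level_norm n x \<le> level_norm n (s k) + level_norm n (x - s k)"
        using level_norm_triangle[OF sX diff_in[OF x(1) sX], of n k k] by simp
      moreover have "level_norm n (s k) < e / 2" using M that by force
      ultimately show ?thesis
        using k[of n] level_norm_diff_commute[OF sX x(1), of n k] level_norm_nonneg[OF x(1), of n] by simp
    qed
    then show "\<exists>M. \<forall>n\<ge>M. norm (level_norm n x - 0) < e" by blast
  qed
  moreover have "(\<lambda>n. vnorm interp (s n - x)) \<longlonglongrightarrow> 0"
  proof (rule LIMSEQ_I)
    fix e :: real assume e: "e > 0"
    obtain N where N: "\<forall>k\<ge>N. \<forall>n. level_norm n (s k - x) \<le> e / 2" using close[of "e / 2"] e by auto
    have "norm (vnorm interp (s k - x) - 0) < e" if "k \<ge> N" for k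
    proof -
      have "vnorm interp (s k - x) \<le> e / 2" using N that by (intro interp_norm_le) auto
      then show ?thesis using I.norm_nonneg[OF I.diff_in[OF s xG], of k] e by simp
    qed
    then show "\<exists>N. \<forall>k\<ge>N. norm (vnorm interp (s k - x) - 0) < e" by blast
  qed
  ultimately show "\<exists>x\<in>vcarrier interp. (\<lambda>n. vnorm interp (s n - x)) \<longlonglongrightarrow> 0" by blast
qed

lemma interp_inclusion: "(\<lambda>x. if x \<in> vcarrier interp then x else 0) \<in> operators interp X"
proof -
  interpret I: complex_normed_space interp by (rule complex_normed_space_interp)
  show ?thesis
    by (rule operatorsI[where C = "C + 1"])
      (simp_all add: I.add_in I.scale_in norm_le_interp interp_in complex_normed_space_interp
        complex_normed_space_axioms)
qed

text \<open>
  A vector that is dominated by \<open>A\<close> in this way has level norms at most \<open>M / 2 ^ n\<close>. Values,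
  derivatives and Taylor remainders of a holomorphic map with range \<open>A\<close> satisfy the hypothesis.
\<close>

lemma dominated_in_interp:
  assumes x: "x \<in> vcarrier X" and M: "M \<ge> 0"
    and dom: "\<And>\<phi> s. \<phi> \<in> operators X complex_scalars \<Longrightarrow> s \<ge> 0 \<Longrightarrow> (\<And>a. a \<in> A \<Longrightarrow> cmod (\<phi> a) \<le> s) \<Longrightarrow> cmod (\<phi> x) \<le> M * s"
  shows "x \<in> vcarrier interp" and "vnorm interp x \<le> M"
proof -
  have g: "level_norm n x \<le> M * (1 / 2 ^ n)" for n
  proof (rule level_norm_least)
    fix \<phi> assume "\<phi> \<in> test_functionals n"
    then obtain s where s: "\<phi> \<in> operators X complex_scalars" "0 \<le> s" "s \<le> 1 / 2 ^ n" "\<And>a. a \<in> A \<Longrightarrow> cmod (\<phi> a) \<le> s"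
      by (rule test_functionalsE) (rule that)
    have "cmod (\<phi> x) \<le> M * s" using dom s by blast
    also have "\<dots> \<le> M * (1 / 2 ^ n)" using s(3) M by (rule mult_left_mono)
    finally show "cmod (\<phi> x) \<le> M * (1 / 2 ^ n)" .
  qed
  have lim: "(\<lambda>n. M * (1 / 2 ^ n)) \<longlonglongrightarrow> 0"
    using tendsto_mult_right_zero[OF LIMSEQ_power_zero[of "1 / 2 :: real"], of M] by (simp add: power_one_over)
  have "(\<lambda>n. level_norm n x) \<longlonglongrightarrow> 0"
    by (rule tendsto_sandwich[OF _ _ tendsto_const lim]) (use g level_norm_nonneg[OF x] in auto)
  then show "x \<in> vcarrier interp" using x by (simp add: interp_carrier)
  have "M * (1 / 2 ^ n) \<le> M" for n using mult_left_mono[of "1 / 2 ^ n" 1 M] M by simp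
  then show "vnorm interp x \<le> M" using g by (intro interp_norm_le) (meson order_trans)
qed

lemma almost_absorbed_interp:
  assumes K: "K > 0"
  shows "almost_absorbed A {x \<in> vcarrier interp. vnorm interp x \<le> K}"
  unfolding almost_absorbed_def
proof (intro allI impI)
  fix e :: real assume e: "e > 0"
  obtain n :: nat where "K / e < 2 ^ n" using real_arch_pow[of 2 "K / e"] by auto
  then have n: "K / 2 ^ n \<le> e" using e by (simp add: field_simps)
  have "near_hull A (K * 2 ^ n) e x" if x: "x \<in> vcarrier interp" "vnorm interp x \<le> K" for x
    unfolding near_hull_def
  proof (intro ballI allI impI)
    fix \<phi> s t
    assume \<phi>: "\<phi> \<in> operators X complex_scalars" and s: "(0::real) \<le> s" and t: "(0::real) \<le> t"
      and sA: "\<forall>a\<in>A. cmod (\<phi> a) \<le> s" and tX: "\<forall>y\<in>vcarrier X. cmod (\<phi> y) \<le> t * vnorm X y"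
    have "cmod (\<phi> x) \<le> (2 ^ n * s + t / 2 ^ n) * level_norm n x"
      by (rule functional_le_level_norm) (use x \<phi> s t sA tX in \<open>auto simp: interp_carrier\<close>)
    also have "\<dots> \<le> (2 ^ n * s + t / 2 ^ n) * K"
      using order_trans[OF level_norm_le_interp[OF x(1)] x(2)] s t by (intro mult_left_mono) auto
    also have "\<dots> = K * 2 ^ n * s + K / 2 ^ n * t" by (simp add: algebra_simps)
    also have "\<dots> \<le> K * 2 ^ n * s + e * t" using n t by (intro add_left_mono mult_right_mono)
    finally show "cmod (\<phi> x) \<le> K * 2 ^ n * s + e * t" .
  qed
  then show "\<exists>L. \<forall>x\<in>{x \<in> vcarrier interp. vnorm interp x \<le> K}. near_hull A L e x" by blast
qed

lemma level_norm_sum: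
  assumes "finite I" "\<And>i. i \<in> I \<Longrightarrow> f i \<in> vcarrier X"
  shows "level_norm n (sum f I) \<le> (\<Sum>i\<in>I. level_norm n (f i))"
  using assms
proof (induction rule: finite_induct)
  case empty
  then show ?case using level_norm_scale[OF zero_in, of n 0] by simp
next
  case (insert i I)
  then show ?case
    using level_norm_triangle[of "f i" "sum f I" n] sum_in[of I f] by force
qed

text \<open>
  In a fixed level \<open>n\<close> there is at most one \<open>j\<close> with \<open>N j \<le> n < N (Suc j)\<close>; it contributes at most
  \<open>1\<close>, and the other terms are dominated by a geometric series with sum \<open>2\<close>.
\<close>

lemma gliding_hump:
  assumes u: "\<And>j. u j \<in> vcarrier interp" "\<And>j. vnorm interp (u j) \<le> 1"
    and N: "strict_mono (N :: nat \<Rightarrow> nat)"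
    and low: "\<And>j n. n < N j \<Longrightarrow> level_norm n (u j) \<le> (1 / 2) ^ j"
    and high: "\<And>j n. n \<ge> N (Suc j) \<Longrightarrow> level_norm n (u j) \<le> (1 / 2) ^ j"
  shows "vnorm interp (\<Sum>j<m. u j) \<le> 3"
proof (rule interp_norm_le)
  fix n
  define I where "I = {j. j < m \<and> N j \<le> n \<and> n < N (Suc j)}"
  have fin: "finite I" by (simp add: I_def)
  have "j = k" if "j \<in> I" "k \<in> I" for j k
  proof (rule ccontr)
    assume "j \<noteq> k"
    then have "Suc j \<le> k \<or> Suc k \<le> j" by auto
    then have "N (Suc j) \<le> N k \<or> N (Suc k) \<le> N j" using N by (simp add: strict_mono_less_eq)
    then show False using that by (auto simp: I_def)
  qed
  then have card: "card I \<le> 1" using card_le_Suc0_iff_eq[OF fin] by simp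
  have "level_norm n (\<Sum>j<m. u j) \<le> (\<Sum>j<m. level_norm n (u j))"
    by (rule level_norm_sum) (auto intro: interp_in u)
  also have "\<dots> \<le> (\<Sum>j<m. (1 / 2) ^ j + (if j \<in> I then 1 else 0))"
  proof (rule sum_mono)
    fix j assume j: "j \<in> {..<m}"
    show "level_norm n (u j) \<le> (1 / 2) ^ j + (if j \<in> I then 1 else 0)"
    proof (cases "j \<in> I")
      case True
      then show ?thesis using order_trans[OF level_norm_le_interp[OF u(1)] u(2), of n j] by (simp add: add_increasing)
    next
      case False
      then show ?thesis using low[of n j] high[of j n] j by (auto simp: I_def not_less)
    qed
  qed
  also have "\<dots> = (\<Sum>j<m. (1 / 2) ^ j) + real (card I)"
  proof -
    have "(\<Sum>j<m. if j \<in> I then 1 else 0 :: real) = (\<Sum>j\<in>{..<m} \<inter> I. 1)"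
      by (rule sum.inter_restrict[symmetric]) simp
    also have "{..<m} \<inter> I = I" by (auto simp: I_def)
    finally show ?thesis by (simp add: sum.distrib)
  qed
  also have "\<dots> \<le> 2 + 1"
  proof (rule add_mono)
    show "(\<Sum>j<m. (1 / 2) ^ j) \<le> (2 :: real)" by (simp add: geometric_sum)
  qed (use card in simp)
  finally show "level_norm n (\<Sum>j<m. u j) \<le> 3" by simp
qed

text \<open>
  On the span of a tail of an \<open>ell1\<close>-sequence the norm of \<open>interp\<close> is equivalent to the norm of \<open>X\<close>.
  Otherwise every tail contains normalised combinations \<open>u j\<close> with arbitrarily small norm in \<open>X\<close>,
  hence with small level norms up to a given level; the level norms of each \<open>u j\<close> also tend to \<open>0\<close>.
  Blocks of this kind have bounded sums, whereas the \<open>ell1\<close>-estimate forces the norm of a sum of \<open>m\<close>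
  disjoint blocks to grow like \<open>m\<close>.
\<close>

lemma ell1_sequence_interp_tail:
  assumes e: "ell1_sequence interp e"
  shows "\<exists>N. \<exists>\<eta>>0. \<forall>c M. \<eta> * vnorm interp (\<Sum>i<M. c i *\<^sub>C e (N + i)) \<le> vnorm X (\<Sum>i<M. c i *\<^sub>C e (N + i))"
proof (rule ccontr)
  interpret I: complex_normed_space interp by (rule complex_normed_space_interp)
  assume no: "\<not> ?thesis"
  obtain K d where eG: "\<And>n. e n \<in> vcarrier interp" and K: "\<And>n. vnorm interp (e n) \<le> K" and d: "d > 0"
    "\<And>N c. d * (\<Sum>i<N. cmod (c i)) \<le> vnorm interp (\<Sum>i<N. c i *\<^sub>C e i)"
    by (rule ell1_sequenceE[OF e]) (rule that)
  have K0: "K \<ge> 0" using order_trans[OF I.norm_nonneg[OF eG] K] .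
  define comb where "comb c L = (\<Sum>i<L. c i *\<^sub>C e i)" for c :: "nat \<Rightarrow> complex" and L :: nat
  have combG: "comb c L \<in> vcarrier interp" for c L unfolding comb_def by (intro I.sum_in I.scale_in eG)
  have comb_ext: "comb c L = comb c M" if "M \<le> L" "\<And>i. i \<ge> M \<Longrightarrow> c i = 0" for c L M
    unfolding comb_def by (rule sum.mono_neutral_right) (use that in auto)
  have comb_scale: "comb (\<lambda>i. b * c i) L = b *\<^sub>C comb c L" for b c L
    by (simp add: comb_def complex_vector.scale_sum_right)
  \<comment> \<open>Normalised combinations of terms with large index that are small in \<open>X\<close>.\<close>
  have block: "\<exists>c L. N < L \<and> (\<forall>i. i < N \<or> i \<ge> L \<longrightarrow> c i = 0) \<and> vnorm interp (comb c L) = 1 \<and>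
      vnorm X (comb c L) < \<eta>" if \<eta>: "\<eta> > 0" for N \<eta>
  proof -
    obtain c M where cM: "vnorm X (\<Sum>i<M. c i *\<^sub>C e (N + i)) < \<eta> * vnorm interp (\<Sum>i<M. c i *\<^sub>C e (N + i))"
      using no \<eta> by (metis not_le)
    define b where "b k = (if N \<le> k \<and> k < N + M then c (k - N) else 0)" for k
    have b: "comb b (N + M) = (\<Sum>i<M. c i *\<^sub>C e (N + i))"
    proof -
      have "comb b (N + M) = (\<Sum>k\<in>{N..<N + M}. b k *\<^sub>C e k)"
        unfolding comb_def by (rule sum.mono_neutral_right) (auto simp: b_def)
      also have "\<dots> = (\<Sum>i\<in>{0..<M}. b (N + i) *\<^sub>C e (N + i))"
        using sum.shift_bounds_nat_ivl[of "\<lambda>k. b k *\<^sub>C e k" 0 N M] by (simp add: add.commute)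
      also have "\<dots> = (\<Sum>i<M. c i *\<^sub>C e (N + i))" by (intro sum.cong) (auto simp: b_def)
      finally show ?thesis .
    qed
    let ?u = "comb b (N + M)"
    have lt: "vnorm X ?u < \<eta> * vnorm interp ?u" using cM b by simp
    have pos: "vnorm interp ?u > 0"
      using lt \<eta> norm_nonneg[OF interp_in[OF combG]] by (metis le_less_trans zero_less_mult_pos)
    define a :: complex where "a = of_real (1 / vnorm interp ?u)"
    have a: "cmod a = 1 / vnorm interp ?u" unfolding a_def using pos by (simp only: norm_of_real) simp
    have "vnorm interp (comb (\<lambda>i. a * b i) (N + M)) = 1"
      unfolding comb_scale I.norm_scale[OF combG] a using pos by simp
    moreover have "vnorm X (comb (\<lambda>i. a * b i) (N + M)) < \<eta>"
      unfolding comb_scale norm_scale[OF interp_in[OF combG]] a using lt pos by (simp add: field_simps)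
    moreover have "comb (\<lambda>i. a * b i) (N + M) = comb (\<lambda>i. a * b i) (Suc (N + M))"
      by (rule comb_ext[symmetric]) (auto simp: b_def)
    ultimately show ?thesis
      by (intro exI[of _ "\<lambda>i. a * b i"] exI[of _ "Suc (N + M)"]) (auto simp: b_def)
  qed
  define good where "good j N c L \<longleftrightarrow> N < L \<and> (\<forall>i. i < N \<or> i \<ge> L \<longrightarrow> c i = 0) \<and> vnorm interp (comb c L) = 1 \<and>
      (\<forall>n<N. level_norm n (comb c L) \<le> (1 / 2) ^ j) \<and> (\<forall>n\<ge>L. level_norm n (comb c L) \<le> (1 / 2) ^ j)"
    for j N c and L :: nat
  have next_block: "\<exists>c L. good j N c L" for j N
  proof -
    obtain c L where cL: "N < L" "\<forall>i. i < N \<or> i \<ge> L \<longrightarrow> c i = 0" "vnorm interp (comb c L) = 1"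
      "vnorm X (comb c L) < (1 / 2) ^ j / 2 ^ N"
      using block[of "(1 / 2) ^ j / 2 ^ N" N] by auto
    have "(\<lambda>n. level_norm n (comb c L)) \<longlonglongrightarrow> 0" using combG by (simp add: interp_carrier)
    then obtain M where M: "\<forall>n\<ge>M. norm (level_norm n (comb c L) - 0) < (1 / 2) ^ j"
      using LIMSEQ_D[of _ 0 "(1 / 2) ^ j"] by (metis half_gt_zero zero_less_one zero_less_power)
    let ?L = "max L M"
    have eq: "comb c ?L = comb c L" by (rule comb_ext) (use cL in auto)
    have "level_norm n (comb c L) \<le> (1 / 2) ^ j" if "n < N" for n
    proof -
      have "level_norm n (comb c L) \<le> 2 ^ n * vnorm X (comb c L)" by (rule level_norm_le_norm[OF interp_in[OF combG]])
      also have "\<dots> \<le> 2 ^ N * ((1 / 2) ^ j / 2 ^ N)"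
        using cL(4) that norm_nonneg[OF interp_in[OF combG]] by (intro mult_mono power_increasing) auto
      finally show ?thesis by simp
    qed
    moreover have "level_norm n (comb c L) \<le> (1 / 2) ^ j" if "n \<ge> ?L" for n
    proof -
      have "norm (level_norm n (comb c L) - 0) < (1 / 2) ^ j" using M that by simp
      then show ?thesis by (simp add: abs_less_iff)
    qed
    ultimately have "good j N c ?L" unfolding good_def eq using cL by auto
    then show ?thesis by blast
  qed
  have "\<exists>N. \<forall>j. True \<and> (\<exists>c. good j (N j) c (N (Suc j)))"
    by (rule dependent_nat_choice) (simp, use next_block in metis)
  then obtain N c where good: "\<And>j. good j (N j) (c j) (N (Suc j))" by metis
  have N: "strict_mono N" using good by (simp add: good_def strict_mono_Suc_iff)
  define u where "u j = comb (c j) (N (Suc j))" for j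
  have u: "u j \<in> vcarrier interp" "vnorm interp (u j) = 1" for j
    using good[of j] combG by (simp_all add: u_def good_def)
  have three: "vnorm interp (\<Sum>j<m. u j) \<le> 3" for m
    by (rule gliding_hump[OF _ _ N]) (use u good in \<open>auto simp: good_def u_def\<close>)
  have "d * real m \<le> 3 * (K + 1)" for m
  proof -
    let ?L = "N m" and ?c = "\<lambda>k. \<Sum>j<m. c j k"
    have supp: "c j k = 0" if "k < N j \<or> k \<ge> N (Suc j)" for j k using good[of j] that unfolding good_def by blast
    have uL: "u j = comb (c j) ?L" if "j < m" for j
      unfolding u_def by (rule comb_ext[symmetric]) (use N that supp in \<open>auto simp: strict_mono_less_eq\<close>)
    have sum_u: "(\<Sum>j<m. u j) = comb ?c ?L"
    proof -
      have "(\<Sum>j<m. u j) = (\<Sum>j<m. \<Sum>k<?L. c j k *\<^sub>C e k)" using uL by (simp add: comb_def)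
      also have "\<dots> = (\<Sum>k<?L. \<Sum>j<m. c j k *\<^sub>C e k)" by (rule sum.swap)
      finally show ?thesis by (simp add: comb_def complex_vector.scale_sum_left)
    qed
    have disj: "(\<Sum>j<m. cmod (c j k)) = cmod (?c k)" for k
    proof (cases "\<exists>i<m. c i k \<noteq> 0")
      case True
      then obtain i where i: "i < m" "c i k \<noteq> 0" by blast
      have other: "c j k = 0" if "j \<noteq> i" for j
      proof (rule ccontr)
        assume "c j k \<noteq> 0"
        then have "N j \<le> k" "k < N (Suc j)" "N i \<le> k" "k < N (Suc i)" using supp[of k] i(2) by (metis not_le)+
        moreover have "Suc i \<le> j \<or> Suc j \<le> i" using that by auto
        ultimately show False using N by (metis le_less_trans not_le strict_mono_less_eq order_trans)
      qed
      have "(\<Sum>j<m. cmod (c j k)) = cmod (c i k)" "?c k = c i k"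
        using i(1) other by (simp_all add: sum.remove[of "{..<m}" i])
      then show ?thesis by simp
    qed simp
    have one: "1 \<le> (K + 1) * (\<Sum>k<?L. cmod (c j k))" if j: "j < m" for j
    proof -
      have "1 = vnorm interp (\<Sum>k<?L. c j k *\<^sub>C e k)" using u(2)[of j] uL[OF j] by (simp add: comb_def)
      also have "\<dots> \<le> (\<Sum>k<?L. vnorm interp (c j k *\<^sub>C e k))"
        by (rule I.norm_sum_le) (auto intro: I.scale_in eG)
      also have "\<dots> \<le> (\<Sum>k<?L. cmod (c j k) * (K + 1))"
        by (rule sum_mono) (use K in \<open>auto simp: I.norm_scale[OF eG] intro!: mult_left_mono add_increasing2\<close>)
      finally show ?thesis by (simp add: sum_distrib_left mult.commute)
    qed
    have "real m = (\<Sum>j<m. 1)" by simp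
    also have "\<dots> \<le> (\<Sum>j<m. (K + 1) * (\<Sum>k<?L. cmod (c j k)))" by (rule sum_mono) (use one in simp)
    also have "\<dots> = (K + 1) * (\<Sum>k<?L. \<Sum>j<m. cmod (c j k))"
      by (subst sum.swap) (simp add: sum_distrib_left)
    also have "\<dots> = (K + 1) * (\<Sum>k<?L. cmod (?c k))" by (simp only: disj)
    finally have "d * real m \<le> (K + 1) * (d * (\<Sum>k<?L. cmod (?c k)))"
      using d(1) by (simp add: mult.left_commute)
    also have "\<dots> \<le> (K + 1) * 3"
      using d(2)[where N = ?L and c = ?c] three[of m] K0 unfolding sum_u comb_def by (intro mult_left_mono) auto
    finally show ?thesis by simp
  qed
  moreover obtain m :: nat where "3 * (K + 1) / d < real m" using reals_Archimedean2 by blast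
  ultimately show False using d(1) by (metis mult.commute not_le pos_divide_less_eq)
qed

text \<open>
  Balls of \<open>interp\<close> are almost absorbed by \<open>A\<close>, so an \<open>ell1\<close>-sequence of \<open>interp\<close> has a subsequence
  that is weakly Cauchy in \<open>X\<close>. A tail of this subsequence would be an \<open>ell1\<close>-sequence in \<open>X\<close>.
\<close>

theorem interp_not_contains_ell1:
  assumes A: "rosenthal_set X A"
  shows "\<not> contains_isomorphic_copy interp ell1"
proof
  interpret I: complex_normed_space interp by (rule complex_normed_space_interp)
  assume "contains_isomorphic_copy interp ell1"
  then obtain e where e: "ell1_sequence interp e"
    using contains_ell1_imp_ell1_sequence[OF complex_normed_space_interp] by blast
  obtain K d where eG: "\<And>n. e n \<in> vcarrier interp" and K: "\<And>n. vnorm interp (e n) \<le> K"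
    by (rule ell1_sequenceE[OF e]) (rule that)
  define Y where "Y = {x \<in> vcarrier interp. vnorm interp x \<le> \<bar>K\<bar> + 1}"
  have "rosenthal_set X Y"
    by (rule rosenthal_set_almost_absorbed[OF A A_bound])
      (use almost_absorbed_interp[of "\<bar>K\<bar> + 1"] in \<open>auto simp: Y_def interp_in\<close>)
  moreover have "e n \<in> Y" for n using eG[of n] K[of n] by (auto simp: Y_def)
  ultimately obtain r :: "nat \<Rightarrow> nat" where r: "strict_mono r" "weakly_Cauchy X (e \<circ> r)"
    unfolding rosenthal_set_def by (metis image_subsetI)
  obtain N \<eta> where \<eta>: "\<eta> > 0" "\<And>c M. \<eta> * vnorm interp (\<Sum>i<M. c i *\<^sub>C (e \<circ> r) (N + i))
      \<le> vnorm X (\<Sum>i<M. c i *\<^sub>C (e \<circ> r) (N + i))"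
    using ell1_sequence_interp_tail[OF ell1_sequence_subseq[OF e r(1)]] by blast
  have tail: "strict_mono (\<lambda>i. N + i)" by (simp add: strict_mono_def)
  let ?x = "\<lambda>i. (e \<circ> r) (N + i)"
  have "ell1_sequence interp ((e \<circ> r) \<circ> (\<lambda>i. N + i))"
    by (rule ell1_sequence_subseq[OF ell1_sequence_subseq[OF e r(1)] tail])
  then obtain K' d' where d': "d' > 0"
    "\<And>M c. d' * (\<Sum>i<M. cmod (c i)) \<le> vnorm interp (\<Sum>i<M. c i *\<^sub>C ((e \<circ> r) \<circ> (\<lambda>i. N + i)) i)"
    by (rule ell1_sequenceE) (rule that)
  have "ell1_sequence X ?x"
  proof (rule ell1_sequenceI[where C = "(C + 1) * K" and d = "\<eta> * d'"])
    show "?x n \<in> vcarrier X" for n using interp_in[OF eG] by simp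
    show "vnorm X (?x n) \<le> (C + 1) * K" for n
      using order_trans[OF norm_le_interp[OF eG] mult_left_mono[OF K, of "C + 1"]] C_nonneg by simp
    show "\<eta> * d' * (\<Sum>i<M. cmod (c i)) \<le> vnorm X (\<Sum>i<M. c i *\<^sub>C ?x i)" for M c
    proof -
      have "d' * (\<Sum>i<M. cmod (c i)) \<le> vnorm interp (\<Sum>i<M. c i *\<^sub>C ?x i)"
        unfolding o_def by (rule d'(2)[unfolded o_def])
      from mult_left_mono[OF this, of \<eta>] have "\<eta> * d' * (\<Sum>i<M. cmod (c i)) \<le> \<eta> * vnorm interp (\<Sum>i<M. c i *\<^sub>C ?x i)"
        using \<eta>(1) by (simp add: mult.assoc)
      also have "\<dots> \<le> vnorm X (\<Sum>i<M. c i *\<^sub>C ?x i)" by (rule \<eta>(2))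
      finally show ?thesis .
    qed
  qed (use \<eta> d' in simp)
  moreover have "weakly_Cauchy X ?x"
  proof (rule weakly_CauchyI)
    show "?x n \<in> vcarrier X" for n using interp_in[OF eG] by simp
    show "Cauchy (\<lambda>n. \<phi> (?x n))" if "\<phi> \<in> dual_ball" for \<phi>
      using Cauchy_subseq_Cauchy[OF weakly_CauchyD[OF r(2) dual_ball_operators[OF that]] tail] by (simp add: o_def)
  qed
  ultimately show False using ell1_sequence_not_weakly_Cauchy by blast
qed

end

section \<open>Bounded holomorphic maps and Cauchy estimates\<close>

text \<open>
  Derivatives in terms of increments \<open>v\<close> rather than difference quotients, which avoids the exceptional
  point \<open>v = 0\<close>.
\<close>

definition frechet ::
    "'a::complex_vector nspace \<Rightarrow> 'b::complex_vector nspace \<Rightarrow> ('a \<Rightarrow> 'b) \<Rightarrow> 'a \<Rightarrow> ('a \<Rightarrow> 'b) \<Rightarrow> bool"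
  where "frechet E F f x D \<longleftrightarrow> D \<in> operators E F \<and>
    (\<forall>e>0. \<exists>d>0. \<forall>v\<in>vcarrier E. vnorm E v < d \<longrightarrow> vnorm F (f (x + v) - f x - D v) \<le> e * vnorm E v)"

lemma holomorphic_map_iff_frechet:
  assumes E: "complex_normed_space E" and F: "complex_normed_space F" and U: "openin (vtopology E) U"
  shows "holomorphic_map E U F f \<longleftrightarrow> f ` U \<subseteq> vcarrier F \<and> (\<forall>x\<in>U. \<exists>D. frechet E F f x D)"
proof -
  interpret E: complex_normed_space E by fact
  interpret F: complex_normed_space F by fact
  have UE: "U \<subseteq> vcarrier E" and ball: "\<And>x. x \<in> U \<Longrightarrow> \<exists>r>0. \<forall>y\<in>vcarrier E. vnorm E (y - x) < r \<longrightarrow> y \<in> U"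
    using U unfolding E.openin_vtopology by auto
  have "((\<lambda>y. vnorm F (f y - f x - D (y - x)) / vnorm E (y - x)) \<longlongrightarrow> 0) (atin (vtopology E) x) \<longleftrightarrow> frechet E F f x D"
    if fU: "f ` U \<subseteq> vcarrier F" and x: "x \<in> U" and D: "D \<in> operators E F" for x D
  proof
    have xE: "x \<in> vcarrier E" using x UE by blast
    assume lim: "((\<lambda>y. vnorm F (f y - f x - D (y - x)) / vnorm E (y - x)) \<longlongrightarrow> 0) (atin (vtopology E) x)"
    show "frechet E F f x D"
      unfolding frechet_def
    proof (intro conjI allI impI D)
      fix e :: real assume "e > 0"
      then obtain d where d: "d > 0" "\<And>y. y \<in> vcarrier E \<Longrightarrow> y \<noteq> x \<Longrightarrow> vnorm E (y - x) < d \<Longrightarrow>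
          \<bar>vnorm F (f y - f x - D (y - x)) / vnorm E (y - x)\<bar> < e"
        using lim unfolding E.tendsto_0_atin_vtopology[OF xE] by meson
      have "vnorm F (f (x + v) - f x - D v) \<le> e * vnorm E v" if v: "v \<in> vcarrier E" "vnorm E v < d" for v
      proof (cases "v = 0")
        case True
        then show ?thesis using D by simp
      next
        case False
        then have "vnorm E v > 0" using E.norm_nonneg[OF v(1)] E.norm_eq_zero[OF v(1)] by simp
        moreover have "\<bar>vnorm F (f (x + v) - f x - D v) / vnorm E v\<bar> < e"
          using d(2)[OF E.add_in[OF xE v(1)]] v False by simp
        ultimately show ?thesis by (simp add: divide_less_eq abs_less_iff less_imp_le)
      qed
      then show "\<exists>d>0. \<forall>v\<in>vcarrier E. vnorm E v < d \<longrightarrow> vnorm F (f (x + v) - f x - D v) \<le> e * vnorm E v"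
        using d(1) by blast
    qed
  next
    have xE: "x \<in> vcarrier E" using x UE by blast
    assume fr: "frechet E F f x D"
    show "((\<lambda>y. vnorm F (f y - f x - D (y - x)) / vnorm E (y - x)) \<longlongrightarrow> 0) (atin (vtopology E) x)"
      unfolding E.tendsto_0_atin_vtopology[OF xE]
    proof (intro allI impI)
      fix e :: real assume e: "e > 0"
      obtain d where d: "d > 0" "\<And>v. v \<in> vcarrier E \<Longrightarrow> vnorm E v < d \<Longrightarrow>
          vnorm F (f (x + v) - f x - D v) \<le> e / 2 * vnorm E v"
        using fr e unfolding frechet_def by (meson half_gt_zero)
      obtain r where r: "r > 0" "\<And>y. y \<in> vcarrier E \<Longrightarrow> vnorm E (y - x) < r \<Longrightarrow> y \<in> U"
        using ball[OF x] by blast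
      have "\<bar>vnorm F (f y - f x - D (y - x)) / vnorm E (y - x)\<bar> < e"
        if y: "y \<in> vcarrier E" "y \<noteq> x" "vnorm E (y - x) < min d r" for y
      proof -
        have v: "y - x \<in> vcarrier E" using y xE by (simp add: E.diff_in)
        have pos: "vnorm E (y - x) > 0" using E.norm_nonneg[OF v] E.norm_eq_zero[OF v] y(2) by simp
        have "f y \<in> vcarrier F" "f x \<in> vcarrier F" using r(2)[of y] y fU x by auto
        then have "vnorm F (f y - f x - D (y - x)) \<ge> 0"
          by (intro F.norm_nonneg F.diff_in operators_in[OF E F D])
        moreover have "vnorm F (f y - f x - D (y - x)) \<le> e / 2 * vnorm E (y - x)"
          using d(2)[OF v] y(3) by simp
        moreover have "e / 2 * vnorm E (y - x) < e * vnorm E (y - x)" using pos e by simp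
        ultimately show ?thesis using pos by (simp add: divide_less_eq)
      qed
      then show "\<exists>d>0. \<forall>y\<in>vcarrier E. y \<noteq> x \<longrightarrow> vnorm E (y - x) < d \<longrightarrow>
          \<bar>vnorm F (f y - f x - D (y - x)) / vnorm E (y - x)\<bar> < e"
        using d(1) r(1) by (intro exI[of _ "min d r"]) auto
    qed
  qed
  moreover have "D \<in> operators E F" if "frechet E F f x D" for x D using that by (simp add: frechet_def)
  ultimately show ?thesis unfolding holomorphic_map_def by blast
qed

lemma frechetD:
  assumes "frechet E F f x D" "e > 0"
  obtains d where "d > 0" "\<And>v. v \<in> vcarrier E \<Longrightarrow> vnorm E v < d \<Longrightarrow>
    vnorm F (f (x + v) - f x - D v) \<le> e * vnorm E v"
  using assms unfolding frechet_def by meson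

lemma frechet_functional_comp:
  assumes E: "complex_normed_space E" and F: "complex_normed_space F" and U: "openin (vtopology E) U"
    and fU: "f ` U \<subseteq> vcarrier F" and x: "x \<in> U"
    and fr: "frechet E F f x D" and \<phi>: "\<phi> \<in> operators F complex_scalars"
  shows "frechet E complex_scalars (\<lambda>y. \<phi> (f y)) x (\<lambda>v. \<phi> (D v))"
proof -
  interpret E: complex_normed_space E by fact
  interpret F: complex_normed_space F by fact
  have D: "D \<in> operators E F" using fr by (simp add: frechet_def)
  have UE: "U \<subseteq> vcarrier E" using U unfolding E.openin_vtopology by auto
  obtain r where r: "r > 0" "\<And>y. y \<in> vcarrier E \<Longrightarrow> vnorm E (y - x) < r \<Longrightarrow> y \<in> U"
    using U x unfolding E.openin_vtopology by blast
  obtain K where K: "K > 0" "\<And>y. y \<in> vcarrier F \<Longrightarrow> cmod (\<phi> y) \<le> K * vnorm F y"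
    using functional_bounded[OF F \<phi>] by blast
  show ?thesis
    unfolding frechet_def
  proof (intro conjI allI impI functional_comp[OF E F D \<phi>])
    fix e :: real assume e: "e > 0"
    obtain d where d: "d > 0" "\<And>v. v \<in> vcarrier E \<Longrightarrow> vnorm E v < d \<Longrightarrow>
        vnorm F (f (x + v) - f x - D v) \<le> e / K * vnorm E v"
      using frechetD[OF fr, of "e / K"] e K(1) by auto
    have "cmod (\<phi> (f (x + v)) - \<phi> (f x) - \<phi> (D v)) \<le> e * vnorm E v"
      if v: "v \<in> vcarrier E" "vnorm E v < min d r" for v
    proof -
      have "x + v \<in> U" using r(2)[of "x + v"] v UE x by (auto intro: E.add_in)
      then have fin: "f (x + v) \<in> vcarrier F" "f x \<in> vcarrier F" using fU x by auto
      note Dv = operators_in[OF E F D, of v]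
      have "\<phi> (f (x + v)) - \<phi> (f x) - \<phi> (D v) = \<phi> (f (x + v) - f x - D v)"
        using operators_diff[OF F \<phi> F.diff_in[OF fin] Dv] operators_diff[OF F \<phi> fin] by simp
      also have "cmod \<dots> \<le> K * vnorm F (f (x + v) - f x - D v)"
        by (intro K(2) F.diff_in fin Dv)
      also have "\<dots> \<le> K * (e / K * vnorm E v)" using d(2)[OF v(1)] v(2) K(1) by (intro mult_left_mono) auto
      finally show ?thesis using K(1) by simp
    qed
    then show "\<exists>d>0. \<forall>v\<in>vcarrier E. vnorm E v < d \<longrightarrow>
        vnorm complex_scalars (\<phi> (f (x + v)) - \<phi> (f x) - \<phi> (D v)) \<le> e * vnorm E v"
      using d(1) r(1) by (intro exI[of _ "min d r"]) auto
  qed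
qed

lemma frechet_along_line:
  assumes E: "complex_normed_space E" and v: "v \<in> vcarrier E"
    and fr: "frechet E complex_scalars h (x + t *\<^sub>C v) D"
  shows "((\<lambda>s. h (x + s *\<^sub>C v)) has_field_derivative D v) (at t)"
  unfolding has_field_derivative_def has_derivative_at_alt
proof (intro conjI allI impI)
  interpret E: complex_normed_space E by fact
  show "bounded_linear ((*) (D v))" by (rule bounded_linear_mult_right)
  fix e :: real assume e: "e > 0"
  have D: "D \<in> operators E complex_scalars" using fr by (simp add: frechet_def)
  have nv: "vnorm E v \<ge> 0" by (rule E.norm_nonneg[OF v])
  obtain d where d: "d > 0" "\<And>u. u \<in> vcarrier E \<Longrightarrow> vnorm E u < d \<Longrightarrow>
      cmod (h (x + t *\<^sub>C v + u) - h (x + t *\<^sub>C v) - D u) \<le> e / (vnorm E v + 1) * vnorm E u"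
    using frechetD[OF fr, of "e / (vnorm E v + 1)"] e nv by auto
  have "cmod (h (x + s *\<^sub>C v) - h (x + t *\<^sub>C v) - D v * (s - t)) \<le> e * cmod (s - t)"
    if s: "cmod (s - t) < d / (vnorm E v + 1)" for s
  proof -
    let ?u = "(s - t) *\<^sub>C v"
    have nu: "vnorm E ?u = cmod (s - t) * vnorm E v" by (rule E.norm_scale[OF v])
    have lt: "vnorm E ?u < d"
    proof -
      have "cmod (s - t) * vnorm E v \<le> cmod (s - t) * (vnorm E v + 1)" by (intro mult_left_mono) auto
      also have "\<dots> < d" using s nv by (simp add: less_divide_eq)
      finally show ?thesis by (simp add: nu)
    qed
    have "t *\<^sub>C v + ?u = s *\<^sub>C v" by (simp add: complex_vector.scale_left_diff_distrib)
    then have eq: "x + t *\<^sub>C v + ?u = x + s *\<^sub>C v" by (simp only: add.assoc)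
    have "cmod (h (x + s *\<^sub>C v) - h (x + t *\<^sub>C v) - D ?u) \<le> e / (vnorm E v + 1) * vnorm E ?u"
      using d(2)[OF E.scale_in[OF v] lt] by (simp only: eq)
    also have "\<dots> = e * cmod (s - t) * (vnorm E v / (vnorm E v + 1))" by (simp add: nu)
    also have "\<dots> \<le> e * cmod (s - t) * 1" using nv e by (intro mult_left_mono) auto
    finally show ?thesis by (simp add: functional_scale[OF D v] mult.commute)
  qed
  then show "\<exists>d>0. \<forall>s. cmod (s - t) < d \<longrightarrow>
      cmod (h (x + s *\<^sub>C v) - h (x + t *\<^sub>C v) - D v * (s - t)) \<le> e * cmod (s - t)"
    using d(1) nv by (intro exI[of _ "d / (vnorm E v + 1)"]) auto
qed

text \<open>
  Cauchy's inequalities on circles of radius \<open>R / 2\<close>, together with Taylor's formula of order one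
  between \<open>0\<close> and \<open>1\<close>. For \<open>R \<ge> 4\<close> the circles about points of the unit disc stay inside the disc
  of radius \<open>R\<close>.
\<close>

lemma disc_Cauchy_estimates:
  fixes k :: "complex \<Rightarrow> complex"
  assumes hol: "k holomorphic_on ball 0 R" and R: "R > 0" and bd: "\<And>t. cmod t < R \<Longrightarrow> cmod (k t) \<le> s"
  shows "cmod (deriv k 0) \<le> 2 * s / R"
    and "4 \<le> R \<Longrightarrow> cmod (k 1 - k 0 - deriv k 0) \<le> 8 * s / R\<^sup>2"
proof -
  have est: "cmod ((deriv ^^ n) k t) \<le> fact n * s / (R / 2) ^ n" if "cmod t < R / 2" for t n
  proof (rule Cauchy_inequality)
    have sub: "cball t (R / 2) \<subseteq> ball 0 R"
    proof
      fix z assume "z \<in> cball t (R / 2)"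
      then have "cmod (z - t) \<le> R / 2" by (simp add: dist_norm norm_minus_commute)
      then show "z \<in> ball 0 R" using norm_triangle_ineq[of "z - t" t] that by (simp add: dist_norm)
    qed
    show "k holomorphic_on ball t (R / 2)" using hol sub by (meson ball_subset_cball holomorphic_on_subset)
    show "continuous_on (cball t (R / 2)) k"
      using hol sub by (meson holomorphic_on_imp_continuous_on holomorphic_on_subset)
    show "cmod (k z) \<le> s" if "cmod (t - z) = R / 2" for z
      using sub that by (intro bd) (auto simp: dist_norm)
  qed (use R in simp)
  show "cmod (deriv k 0) \<le> 2 * s / R" using est[of 0 1] R by (simp add: mult.commute)
  assume R4: "4 \<le> R"
  define f where "f i = (deriv ^^ i) k" for i
  have half: "cmod t < R / 2" if "t \<in> cball 0 1" for t using that R4 by simp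
  have "cmod (f 0 1 - (\<Sum>i\<le>1. f i 0 * (1 - 0) ^ i / fact i)) \<le> 8 * s / R\<^sup>2 * cmod (1 - 0) ^ Suc 1 / fact 1"
  proof (rule complex_Taylor[where S = "cball 0 1"])
    show "(f i has_field_derivative f (Suc i) t) (at t within cball 0 1)" if "t \<in> cball 0 1" for i t
    proof -
      have "f i holomorphic_on ball 0 R" unfolding f_def by (rule holomorphic_higher_deriv[OF hol]) simp
      then have "(f i has_field_derivative deriv (f i) t) (at t)"
        by (rule holomorphic_derivI[OF _ open_ball]) (use half[OF that] R in simp)
      then show ?thesis by (simp add: f_def has_field_derivative_at_within)
    qed
    show "cmod (f (Suc 1) t) \<le> 8 * s / R\<^sup>2" if "t \<in> cball 0 1" for t
    proof -
      have "cmod (f (Suc 1) t) \<le> fact (Suc 1) * s / (R / 2) ^ Suc 1" unfolding f_def by (rule est[OF half[OF that]])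
      then show ?thesis by (simp add: power2_eq_square)
    qed
  qed auto
  then show "cmod (k 1 - k 0 - deriv k 0) \<le> 8 * s / R\<^sup>2" by (simp add: f_def algebra_simps)
qed

text \<open>
  Apply the estimates for a disc to \<open>t \<mapsto> h (x + t *\<^sub>C v)\<close>, which is holomorphic for
  \<open>cmod t < r / vnorm E v\<close>. The right-hand sides are multiples of the bound \<open>s\<close> of \<open>h\<close>.
\<close>

lemma Cauchy_estimates:
  assumes E: "complex_normed_space E" and U: "openin (vtopology E) U"
    and hol: "holomorphic_map E U complex_scalars h" and bd: "\<And>y. y \<in> U \<Longrightarrow> cmod (h y) \<le> s"
    and x: "x \<in> U" and r: "r > 0" "\<And>y. y \<in> vcarrier E \<Longrightarrow> vnorm E (y - x) < r \<Longrightarrow> y \<in> U"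
    and fr: "frechet E complex_scalars h x D" and v: "v \<in> vcarrier E"
  shows "cmod (D v) \<le> 2 * vnorm E v / r * s"
    and "vnorm E v \<le> r / 4 \<Longrightarrow> cmod (h (x + v) - h x - D v) \<le> 8 * (vnorm E v)\<^sup>2 / r\<^sup>2 * s"
proof -
  interpret E: complex_normed_space E by fact
  have D: "D \<in> operators E complex_scalars" using fr by (simp add: frechet_def)
  have UE: "U \<subseteq> vcarrier E" using U unfolding E.openin_vtopology by auto
  have "cmod (D v) \<le> 2 * vnorm E v / r * s \<and>
    (vnorm E v \<le> r / 4 \<longrightarrow> cmod (h (x + v) - h x - D v) \<le> 8 * (vnorm E v)\<^sup>2 / r\<^sup>2 * s)"
  proof (cases "v = 0")
    case True
    then show ?thesis using D by simp
  next
    case False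
    then have nv: "vnorm E v > 0" using E.norm_nonneg[OF v] E.norm_eq_zero[OF v] by simp
    define R where "R = r / vnorm E v"
    have R: "R > 0" using r nv by (simp add: R_def)
    define k where "k t = h (x + t *\<^sub>C v)" for t
    have inU: "x + t *\<^sub>C v \<in> U" if "cmod t < R" for t
    proof (rule r(2))
      show "x + t *\<^sub>C v \<in> vcarrier E" using x UE v by (auto intro: E.add_in E.scale_in)
      show "vnorm E (x + t *\<^sub>C v - x) < r" using that nv by (simp add: E.norm_scale[OF v] R_def less_divide_eq)
    qed
    have der: "\<exists>d. (k has_field_derivative d) (at t)" if t: "cmod t < R" for t
    proof -
      obtain D' where "frechet E complex_scalars h (x + t *\<^sub>C v) D'"
        using hol inU[OF t] unfolding holomorphic_map_iff_frechet[OF E complex_normed_space_scalars U] by blast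
      from frechet_along_line[OF E v this] show ?thesis unfolding k_def by blast
    qed
    have kh: "k holomorphic_on ball 0 R"
      unfolding holomorphic_on_open[OF open_ball] using der by simp
    have kb: "cmod (k t) \<le> s" if "cmod t < R" for t unfolding k_def by (rule bd[OF inU[OF that]])
    have "frechet E complex_scalars h (x + 0 *\<^sub>C v) D" using fr by simp
    from frechet_along_line[OF E v this] have dk: "deriv k 0 = D v" unfolding k_def by (rule DERIV_imp_deriv)
    note est = disc_Cauchy_estimates[OF kh R kb, unfolded dk]
    have k: "k 1 = h (x + v)" "k 0 = h x" by (simp_all add: k_def scaleC_one)
    have "4 \<le> R" if "vnorm E v \<le> r / 4" using that nv by (simp add: R_def le_divide_eq)
    then show ?thesis using est unfolding k R_def by (auto simp: power_divide mult_ac)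
  qed
  then show "cmod (D v) \<le> 2 * vnorm E v / r * s"
    "vnorm E v \<le> r / 4 \<Longrightarrow> cmod (h (x + v) - h x - D v) \<le> 8 * (vnorm E v)\<^sup>2 / r\<^sup>2 * s" by auto
qed

lemma HinfD:
  assumes "f \<in> vcarrier (Hinf E U F)"
  shows "holomorphic_map E U F f" "\<exists>K. \<forall>x\<in>U. vnorm F (f x) \<le> K" "x \<notin> U \<Longrightarrow> f x = 0" "x \<in> U \<Longrightarrow> f x \<in> vcarrier F"
  using assms by (auto simp: Hinf_def holomorphic_map_def)

lemma Hinf_norm_upper:
  assumes "f \<in> vcarrier (Hinf E U F)" "x \<in> U"
  shows "vnorm F (f x) \<le> vnorm (Hinf E U F) f"
proof -
  obtain K where "\<forall>x\<in>U. vnorm F (f x) \<le> K" using HinfD(2)[OF assms(1)] by blast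
  then have "bdd_above (insert 0 ((\<lambda>x. vnorm F (f x)) ` U))" by (auto intro: bdd_aboveI)
  from cSup_upper[OF _ this, of "vnorm F (f x)"] show ?thesis using assms(2) by (simp add: Hinf_def)
qed

lemma Hinf_norm_nonneg:
  assumes "f \<in> vcarrier (Hinf E U F)" shows "0 \<le> vnorm (Hinf E U F) f"
proof -
  obtain K where "\<forall>x\<in>U. vnorm F (f x) \<le> K" using HinfD(2)[OF assms(1)] by blast
  then have "bdd_above (insert 0 ((\<lambda>x. vnorm F (f x)) ` U))" by (auto intro: bdd_aboveI)
  from cSup_upper[OF _ this, of 0] show ?thesis by (simp add: Hinf_def)
qed

lemma Hinf_norm_least:
  assumes "0 \<le> c" "\<And>x. x \<in> U \<Longrightarrow> vnorm F (f x) \<le> c" shows "vnorm (Hinf E U F) f \<le> c"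
proof -
  have "Sup (insert 0 ((\<lambda>x. vnorm F (f x)) ` U)) \<le> c" by (rule cSup_least) (use assms in auto)
  then show ?thesis by (simp add: Hinf_def)
qed

lemma complex_normed_space_Hinf:
  assumes E: "complex_normed_space E" and U: "openin (vtopology E) U"
  shows "complex_normed_space (Hinf E U complex_scalars)"
proof
  let ?H = "Hinf E U complex_scalars"
  note iff = holomorphic_map_iff_frechet[OF E complex_normed_space_scalars U]
  have HI: "f \<in> vcarrier ?H" if "\<And>x. x \<in> U \<Longrightarrow> \<exists>D. frechet E complex_scalars f x D"
    "\<And>x. x \<in> U \<Longrightarrow> cmod (f x) \<le> K" "\<And>x. x \<notin> U \<Longrightarrow> f x = 0" for f K
    using that unfolding Hinf_def by (auto simp: iff)
  have HD: "\<exists>D. frechet E complex_scalars f x D" if "f \<in> vcarrier ?H" "x \<in> U" for f x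
    using HinfD(1)[OF that(1)] that(2) by (simp add: iff)
  note up = Hinf_norm_upper[where F = complex_scalars, simplified]
  have zero: "0 \<in> vcarrier ?H"
  proof (rule HI[where K = 0])
    have "(\<lambda>_. 0) \<in> operators E complex_scalars"
      by (rule functionalI[OF E, where C = 0]) auto
    then have "frechet E complex_scalars 0 x (\<lambda>_. 0)" for x
      using complex_normed_space.norm_nonneg[OF E] by (auto simp: frechet_def intro!: exI[of _ 1])
    then show "\<exists>D. frechet E complex_scalars 0 x D" for x by blast
  qed auto
  have add: "f + g \<in> vcarrier ?H" if fg: "f \<in> vcarrier ?H" "g \<in> vcarrier ?H" for f g
  proof (rule HI[where K = "vnorm ?H f + vnorm ?H g"])
    fix x assume x: "x \<in> U"
    show "cmod ((f + g) x) \<le> vnorm ?H f + vnorm ?H g"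
      using norm_triangle_ineq[of "f x" "g x"] up[OF fg(1) x] up[OF fg(2) x] by simp
    obtain D1 D2 where fr: "frechet E complex_scalars f x D1" "frechet E complex_scalars g x D2"
      using HD[OF fg(1) x] HD[OF fg(2) x] by blast
    then have D: "D1 \<in> operators E complex_scalars" "D2 \<in> operators E complex_scalars" by (simp_all add: frechet_def)
    obtain C1 C2 where C: "\<And>v. v \<in> vcarrier E \<Longrightarrow> cmod (D1 v) \<le> C1 * vnorm E v"
      "\<And>v. v \<in> vcarrier E \<Longrightarrow> cmod (D2 v) \<le> C2 * vnorm E v"
      using functional_bounded[OF E D(1)] functional_bounded[OF E D(2)] by metis
    have "(\<lambda>v. D1 v + D2 v) \<in> operators E complex_scalars"
    proof (rule functionalI[OF E, where C = "C1 + C2"])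
      show "cmod (D1 v + D2 v) \<le> (C1 + C2) * vnorm E v" if "v \<in> vcarrier E" for v
        using norm_triangle_ineq[of "D1 v" "D2 v"] C(1)[OF that] C(2)[OF that] by (simp add: distrib_right)
    qed (simp_all add: operators_add[OF D(1)] operators_add[OF D(2)] functional_scale[OF D(1)]
        functional_scale[OF D(2)] operators_off[OF D(1)] operators_off[OF D(2)] algebra_simps)
    moreover have "\<exists>d>0. \<forall>v\<in>vcarrier E. vnorm E v < d \<longrightarrow>
        cmod ((f + g) (x + v) - (f + g) x - (D1 v + D2 v)) \<le> e * vnorm E v" if e: "e > 0" for e
    proof -
      obtain d1 where d1: "d1 > 0" "\<And>v. v \<in> vcarrier E \<Longrightarrow> vnorm E v < d1 \<Longrightarrow>
          cmod (f (x + v) - f x - D1 v) \<le> e / 2 * vnorm E v"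
        using frechetD[OF fr(1), of "e / 2"] e by auto
      obtain d2 where d2: "d2 > 0" "\<And>v. v \<in> vcarrier E \<Longrightarrow> vnorm E v < d2 \<Longrightarrow>
          cmod (g (x + v) - g x - D2 v) \<le> e / 2 * vnorm E v"
        using frechetD[OF fr(2), of "e / 2"] e by auto
      have "cmod ((f + g) (x + v) - (f + g) x - (D1 v + D2 v)) \<le> e * vnorm E v"
        if v: "v \<in> vcarrier E" "vnorm E v < min d1 d2" for v
      proof -
        have eq: "(f + g) (x + v) - (f + g) x - (D1 v + D2 v) = (f (x + v) - f x - D1 v) + (g (x + v) - g x - D2 v)"
          by simp
        have "cmod (f (x + v) - f x - D1 v) \<le> e / 2 * vnorm E v" "cmod (g (x + v) - g x - D2 v) \<le> e / 2 * vnorm E v"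
          using d1(2)[OF v(1)] d2(2)[OF v(1)] v(2) by simp_all
        then show ?thesis
          unfolding eq using norm_triangle_ineq[of "f (x + v) - f x - D1 v" "g (x + v) - g x - D2 v"] by linarith
      qed
      then show ?thesis using d1(1) d2(1) by (intro exI[of _ "min d1 d2"]) auto
    qed
    ultimately show "\<exists>D. frechet E complex_scalars (f + g) x D"
      unfolding frechet_def by (intro exI[of _ "\<lambda>v. D1 v + D2 v"]) simp
  qed (use HinfD(3)[OF fg(1)] HinfD(3)[OF fg(2)] in simp)
  have scale: "a *\<^sub>C f \<in> vcarrier ?H" if f: "f \<in> vcarrier ?H" for a f
  proof (rule HI[where K = "cmod a * vnorm ?H f"])
    fix x assume x: "x \<in> U"
    show "cmod ((a *\<^sub>C f) x) \<le> cmod a * vnorm ?H f"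
      using up[OF f x] by (simp add: scaleC_fun_def scaleC_complex_def norm_mult mult_left_mono)
    have mult: "(\<lambda>z. a * z) \<in> operators complex_scalars complex_scalars"
      by (rule functionalI[OF complex_normed_space_scalars, where C = "cmod a"])
        (auto simp: norm_mult algebra_simps scaleC_complex_def)
    obtain D where "frechet E complex_scalars f x D" using HD[OF f x] by blast
    from frechet_functional_comp[OF E complex_normed_space_scalars U _ x this mult]
    show "\<exists>D. frechet E complex_scalars (a *\<^sub>C f) x D" by (auto simp: scaleC_fun_def scaleC_complex_def)
  qed (use HinfD(3)[OF f] in \<open>simp add: scaleC_fun_def\<close>)
  show "complex_vector.subspace (vcarrier ?H)"
    unfolding complex_vector.subspace_def using zero add scale by blast
  fix f assume f: "f \<in> vcarrier ?H"
  show "vnorm ?H f = 0 \<longleftrightarrow> f = 0"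
  proof
    assume "vnorm ?H f = 0"
    then have "f x = 0" for x using up[OF f, of x] HinfD(3)[OF f, of x] by (cases "x \<in> U") auto
    then show "f = 0" by (simp add: fun_eq_iff)
  next
    assume "f = 0"
    then show "vnorm ?H f = 0" using Hinf_norm_nonneg[OF f] Hinf_norm_least[of 0 U complex_scalars f E] by simp
  qed
  show "vnorm ?H (f + g) \<le> vnorm ?H f + vnorm ?H g" if g: "g \<in> vcarrier ?H" for g
  proof (rule Hinf_norm_least)
    show "vnorm complex_scalars ((f + g) x) \<le> vnorm ?H f + vnorm ?H g" if "x \<in> U" for x
      using norm_triangle_ineq[of "f x" "g x"] up[OF f that] up[OF g that] by simp
  qed (use Hinf_norm_nonneg f g in \<open>blast intro: add_nonneg_nonneg\<close>)
  have le: "vnorm ?H (a *\<^sub>C f) \<le> cmod a * vnorm ?H f" if f: "f \<in> vcarrier ?H" for a f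
  proof (rule Hinf_norm_least)
    show "vnorm complex_scalars ((a *\<^sub>C f) x) \<le> cmod a * vnorm ?H f" if "x \<in> U" for x
      using up[OF f that] by (simp add: scaleC_fun_def scaleC_complex_def norm_mult mult_left_mono)
  qed (use Hinf_norm_nonneg[OF f] in simp)
  show "vnorm ?H (a *\<^sub>C f) = cmod a * vnorm ?H f" for a
    by (rule homogeneous_if_subhomogeneous[of "vcarrier ?H"]) (fact le scale Hinf_norm_nonneg f)+
qed

lemma functional_comp_Hinf:
  assumes E: "complex_normed_space E" and F: "complex_normed_space F" and U: "openin (vtopology E) U"
    and f: "f \<in> vcarrier (Hinf E U F)" and \<phi>: "\<phi> \<in> operators F complex_scalars"
  shows "(\<lambda>x. \<phi> (f x)) \<in> vcarrier (Hinf E U complex_scalars)"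
proof -
  have fU: "f ` U \<subseteq> vcarrier F" using HinfD(4)[OF f] by blast
  obtain K where K: "K > 0" "\<And>y. y \<in> vcarrier F \<Longrightarrow> cmod (\<phi> y) \<le> K * vnorm F y"
    using functional_bounded[OF F \<phi>] by blast
  have "holomorphic_map E U complex_scalars (\<lambda>x. \<phi> (f x))"
    unfolding holomorphic_map_iff_frechet[OF E complex_normed_space_scalars U]
  proof (intro conjI ballI)
    fix x assume x: "x \<in> U"
    obtain D where "frechet E F f x D"
      using HinfD(1)[OF f] x unfolding holomorphic_map_iff_frechet[OF E F U] by blast
    from frechet_functional_comp[OF E F U fU x this \<phi>]
    show "\<exists>D. frechet E complex_scalars (\<lambda>x. \<phi> (f x)) x D" by blast
  qed simp
  moreover have "cmod (\<phi> (f x)) \<le> K * vnorm (Hinf E U F) f" if "x \<in> U" for x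
    using order_trans[OF K(2)[OF HinfD(4)[OF f that]] mult_left_mono[OF Hinf_norm_upper[OF f that]]] K(1) by simp
  ultimately show ?thesis using HinfD(3)[OF f] \<phi> by (auto simp: Hinf_def)
qed

section \<open>Linearization of bounded holomorphic maps\<close>

context complex_normed_space
begin

lemma dual_norm_bdd:
  assumes "\<phi> \<in> operators X complex_scalars" shows "bdd_above ((\<lambda>x. cmod (\<phi> x)) ` unit_ball X)"
proof -
  obtain C where C: "C > 0" "\<And>x. x \<in> vcarrier X \<Longrightarrow> cmod (\<phi> x) \<le> C * vnorm X x"
    using functional_bounded[OF complex_normed_space_axioms assms] by blast
  have "cmod (\<phi> x) \<le> C" if "x \<in> unit_ball X" for x
  proof -
    have x: "x \<in> vcarrier X" "vnorm X x \<le> 1" using that by (simp_all add: unit_ball_def)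
    show ?thesis using order_trans[OF C(2)[OF x(1)] mult_left_mono[OF x(2), of C]] C(1) by simp
  qed
  then show ?thesis by (rule bdd_aboveI2)
qed

lemma dual_norm_least: "(\<And>x. x \<in> unit_ball X \<Longrightarrow> cmod (\<phi> x) \<le> c) \<Longrightarrow> vnorm (dual X) \<phi> \<le> c"
proof -
  have "unit_ball X \<noteq> {}" by (auto simp: unit_ball_def intro!: exI[of _ 0])
  then show "(\<And>x. x \<in> unit_ball X \<Longrightarrow> cmod (\<phi> x) \<le> c) \<Longrightarrow> vnorm (dual X) \<phi> \<le> c"
    by (simp add: dual_def cSUP_least)
qed

lemma dual_norm_upper:
  assumes \<phi>: "\<phi> \<in> operators X complex_scalars" and x: "x \<in> vcarrier X"
  shows "cmod (\<phi> x) \<le> vnorm (dual X) \<phi> * vnorm X x"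
proof (cases "x = 0")
  case True
  then show ?thesis using \<phi> by simp
next
  case False
  then have nx: "vnorm X x > 0" using norm_nonneg[OF x] norm_eq_zero[OF x] by simp
  define a :: complex where "a = of_real (1 / vnorm X x)"
  have a: "cmod a = 1 / vnorm X x" unfolding a_def using nx by (simp only: norm_of_real) simp
  have "a *\<^sub>C x \<in> unit_ball X" using x nx by (simp add: unit_ball_def scale_in norm_scale a)
  from cSUP_upper[OF this dual_norm_bdd[OF \<phi>]]
  have "cmod (\<phi> (a *\<^sub>C x)) \<le> vnorm (dual X) \<phi>" by (simp add: dual_def)
  then have "cmod (\<phi> x) / vnorm X x \<le> vnorm (dual X) \<phi>"
    by (simp add: functional_scale[OF \<phi> x] norm_mult a)
  then show ?thesis using nx by (simp add: divide_le_eq)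
qed

lemma dual_carrier [simp]: "vcarrier (dual X) = operators X complex_scalars"
  by (simp add: dual_def)

lemma complex_normed_space_dual: "complex_normed_space (dual X)"
proof
  note ax = complex_normed_space_axioms
  have zero: "0 \<in> operators X complex_scalars" by (rule functionalI[OF ax, where C = 0]) auto
  have add: "\<phi> + \<psi> \<in> operators X complex_scalars"
    if o: "\<phi> \<in> operators X complex_scalars" "\<psi> \<in> operators X complex_scalars" for \<phi> \<psi>
  proof (rule functionalI[OF ax])
    show "cmod ((\<phi> + \<psi>) x) \<le> (vnorm (dual X) \<phi> + vnorm (dual X) \<psi>) * vnorm X x" if "x \<in> vcarrier X" for x
      using norm_triangle_ineq[of "\<phi> x" "\<psi> x"] dual_norm_upper[OF o(1) that] dual_norm_upper[OF o(2) that]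
      by (simp add: distrib_right)
  qed (simp_all add: operators_add[OF o(1)] operators_add[OF o(2)] functional_scale[OF o(1)]
      functional_scale[OF o(2)] operators_off[OF o(1)] operators_off[OF o(2)] algebra_simps)
  have sc: "(a *\<^sub>C \<phi>) x = a * \<phi> x" for a and \<phi> :: "'a \<Rightarrow> complex" and x
    by (simp add: scaleC_fun_def scaleC_complex_def)
  have scale: "a *\<^sub>C \<phi> \<in> operators X complex_scalars" if o: "\<phi> \<in> operators X complex_scalars" for a \<phi>
  proof (rule functionalI[OF ax])
    show "cmod ((a *\<^sub>C \<phi>) x) \<le> (cmod a * vnorm (dual X) \<phi>) * vnorm X x" if "x \<in> vcarrier X" for x
      using mult_left_mono[OF dual_norm_upper[OF o that], of "cmod a"] by (simp add: sc norm_mult mult.assoc)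
  qed (simp_all add: sc operators_add[OF o] functional_scale[OF o] operators_off[OF o] algebra_simps)
  show "complex_vector.subspace (vcarrier (dual X))"
    unfolding complex_vector.subspace_def dual_carrier using zero add scale by blast
  have nn: "0 \<le> vnorm (dual X) \<phi>" if o: "\<phi> \<in> operators X complex_scalars" for \<phi>
    using cSUP_upper[OF _ dual_norm_bdd[OF o], of 0] o by (simp add: dual_def unit_ball_def)
  fix \<phi> assume "\<phi> \<in> vcarrier (dual X)"
  then have \<phi>: "\<phi> \<in> operators X complex_scalars" by simp
  show "vnorm (dual X) \<phi> = 0 \<longleftrightarrow> \<phi> = 0"
  proof
    assume 0: "vnorm (dual X) \<phi> = 0"
    have "\<phi> x = 0" for x
      using dual_norm_upper[OF \<phi>, of x] operators_off[OF \<phi>, of x] 0 by (cases "x \<in> vcarrier X") auto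
    then show "\<phi> = 0" by (simp add: fun_eq_iff)
  next
    assume "\<phi> = 0"
    then show "vnorm (dual X) \<phi> = 0" using nn[OF \<phi>] dual_norm_least[of \<phi> 0] by simp
  qed
  show "vnorm (dual X) (\<phi> + \<psi>) \<le> vnorm (dual X) \<phi> + vnorm (dual X) \<psi>" if "\<psi> \<in> vcarrier (dual X)" for \<psi>
  proof (rule dual_norm_least)
    have \<psi>: "\<psi> \<in> operators X complex_scalars" using that by simp
    fix x assume x: "x \<in> unit_ball X"
    have le: "cmod (\<theta> x) \<le> vnorm (dual X) \<theta>" if "\<theta> \<in> operators X complex_scalars" for \<theta>
      using cSUP_upper[OF x dual_norm_bdd[OF that]] by (simp add: dual_def)
    show "cmod ((\<phi> + \<psi>) x) \<le> vnorm (dual X) \<phi> + vnorm (dual X) \<psi>"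
      using norm_triangle_ineq[of "\<phi> x" "\<psi> x"] le[OF \<phi>] le[OF \<psi>] by simp
  qed
  have le: "vnorm (dual X) (a *\<^sub>C \<phi>) \<le> cmod a * vnorm (dual X) \<phi>" if o: "\<phi> \<in> operators X complex_scalars" for a \<phi>
  proof (rule dual_norm_least)
    fix x assume "x \<in> unit_ball X"
    from cSUP_upper[OF this dual_norm_bdd[OF o]]
    show "cmod ((a *\<^sub>C \<phi>) x) \<le> cmod a * vnorm (dual X) \<phi>" by (simp add: dual_def sc norm_mult mult_left_mono)
  qed
  show "vnorm (dual X) (a *\<^sub>C \<phi>) = cmod a * vnorm (dual X) \<phi>" for a
    by (rule homogeneous_if_subhomogeneous[of "operators X complex_scalars"]) (fact le scale nn \<phi>)+
qed

end

lemma scaleC_fun_apply: "(a *\<^sub>C g) x = a * (g x :: complex)"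
  by (simp add: scaleC_fun_def scaleC_complex_def)

locale bounded_holomorphic = E: complex_normed_space E + F: complex_banach_space F
  for E :: "'e::complex_vector nspace" and F :: "'f::complex_vector nspace" +
  fixes U :: "'e set" and f :: "'e \<Rightarrow> 'f"
  assumes open_U: "openin (vtopology E) U" and f: "f \<in> vcarrier (Hinf E U F)"
begin

abbreviation "H \<equiv> Hinf E U complex_scalars"

sublocale H: complex_normed_space H
  by (rule complex_normed_space_Hinf[OF E.complex_normed_space_axioms open_U])

sublocale DH: complex_normed_space "dual H"
  by (rule H.complex_normed_space_dual)

lemma comp_H: "\<phi> \<in> operators F complex_scalars \<Longrightarrow> (\<lambda>x. \<phi> (f x)) \<in> vcarrier H"
  by (rule functional_comp_Hinf[OF E.complex_normed_space_axioms F.complex_normed_space_axioms open_U f])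

lemma evaluation_eq: "g \<in> vcarrier H \<Longrightarrow> evaluation E U x g = g x"
  by (simp add: evaluation_def)

lemma evaluation_dual:
  assumes x: "x \<in> U"
  shows "evaluation E U x \<in> operators H complex_scalars" "vnorm (dual H) (evaluation E U x) \<le> 1"
proof -
  have le: "cmod (evaluation E U x g) \<le> 1 * vnorm H g" if "g \<in> vcarrier H" for g
    using Hinf_norm_upper[OF that x] that by (simp add: evaluation_eq)
  show "evaluation E U x \<in> operators H complex_scalars"
    by (rule functionalI[OF H.complex_normed_space_axioms _ _ _ le])
      (auto simp: evaluation_def H.add_in H.scale_in scaleC_fun_apply)
  show "vnorm (dual H) (evaluation E U x) \<le> 1"
    by (rule H.dual_norm_least) (use le order_trans in \<open>fastforce simp: unit_ball_def\<close>)
qed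

lemma evaluations_span: "complex_vector.span (evaluation E U ` U) \<subseteq> vcarrier (dual H)"
  by (rule complex_vector.span_minimal) (use evaluation_dual(1) DH.subspace in auto)

lemma Ginf_iff: "\<mu> \<in> vcarrier (Ginf E U) \<longleftrightarrow> \<mu> \<in> operators H complex_scalars \<and>
    (\<forall>r>0. \<exists>\<nu>\<in>complex_vector.span (evaluation E U ` U). vnorm (dual H) (\<mu> - \<nu>) < r)"
  using DH.closure_of_vtopology[OF evaluations_span, of \<mu>] by (simp add: Ginf_def)

lemma Ginf_norm [simp]: "vnorm (Ginf E U) = vnorm (dual H)"
  by (simp add: Ginf_def)

lemma span_in_Ginf: "\<nu> \<in> complex_vector.span (evaluation E U ` U) \<Longrightarrow> \<nu> \<in> vcarrier (Ginf E U)"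
  using evaluations_span by (fastforce simp: Ginf_iff intro!: bexI[of _ \<nu>])

lemma complex_normed_space_Ginf: "complex_normed_space (Ginf E U)"
proof -
  let ?S = "complex_vector.span (evaluation E U ` U)"
  have G: "\<mu> \<in> vcarrier (dual H)" if "\<mu> \<in> vcarrier (Ginf E U)" for \<mu> using that by (simp add: Ginf_iff)
  have S: "\<nu> \<in> vcarrier (dual H)" if "\<nu> \<in> ?S" for \<nu> using that evaluations_span by blast
  have add: "\<mu> + \<mu>' \<in> vcarrier (Ginf E U)" if m: "\<mu> \<in> vcarrier (Ginf E U)" "\<mu>' \<in> vcarrier (Ginf E U)" for \<mu> \<mu>'
    unfolding Ginf_iff
  proof (intro conjI allI impI)
    show "\<mu> + \<mu>' \<in> operators H complex_scalars" using DH.add_in[OF G[OF m(1)] G[OF m(2)]] by simp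
    fix r :: real assume "r > 0"
    then obtain \<nu> \<nu>' where n: "\<nu> \<in> ?S" "vnorm (dual H) (\<mu> - \<nu>) < r / 2" "\<nu>' \<in> ?S" "vnorm (dual H) (\<mu>' - \<nu>') < r / 2"
      using m unfolding Ginf_iff by (meson half_gt_zero)
    have "vnorm (dual H) ((\<mu> - \<nu>) + (\<mu>' - \<nu>')) < r"
      using DH.norm_triangle[OF DH.diff_in[OF G[OF m(1)] S[OF n(1)]] DH.diff_in[OF G[OF m(2)] S[OF n(3)]]] n by simp
    moreover have "(\<mu> - \<nu>) + (\<mu>' - \<nu>') = (\<mu> + \<mu>') - (\<nu> + \<nu>')" by (simp add: algebra_simps)
    ultimately show "\<exists>\<nu>\<in>?S. vnorm (dual H) (\<mu> + \<mu>' - \<nu>) < r"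
      using complex_vector.span_add[OF n(1,3)] by metis
  qed
  have scale: "a *\<^sub>C \<mu> \<in> vcarrier (Ginf E U)" if m: "\<mu> \<in> vcarrier (Ginf E U)" for a \<mu>
    unfolding Ginf_iff
  proof (intro conjI allI impI)
    show "a *\<^sub>C \<mu> \<in> operators H complex_scalars" using DH.scale_in[OF G[OF m]] by simp
    fix r :: real assume "r > 0"
    then have "r / (cmod a + 1) > 0" by (simp add: add_nonneg_pos)
    then obtain \<nu> where n: "\<nu> \<in> ?S" "vnorm (dual H) (\<mu> - \<nu>) < r / (cmod a + 1)"
      using m unfolding Ginf_iff by blast
    note d = DH.diff_in[OF G[OF m] S[OF n(1)]]
    have "vnorm (dual H) (a *\<^sub>C (\<mu> - \<nu>)) = cmod a * vnorm (dual H) (\<mu> - \<nu>)" by (rule DH.norm_scale[OF d])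
    also have "\<dots> \<le> (cmod a + 1) * vnorm (dual H) (\<mu> - \<nu>)"
      using DH.norm_nonneg[OF d] by (intro mult_right_mono) auto
    also have "\<dots> < r"
    proof -
      have "0 < cmod a + 1" by (simp add: add_nonneg_pos)
      then show ?thesis using n(2) by (simp add: less_divide_eq mult.commute)
    qed
    finally have "vnorm (dual H) (a *\<^sub>C \<mu> - a *\<^sub>C \<nu>) < r" by (simp only: complex_vector.scale_right_diff_distrib)
    then show "\<exists>\<nu>\<in>?S. vnorm (dual H) (a *\<^sub>C \<mu> - \<nu>) < r"
      using complex_vector.span_scale[OF n(1)] by blast
  qed
  show ?thesis
  proof
    show "complex_vector.subspace (vcarrier (Ginf E U))"
      unfolding complex_vector.subspace_def
      using add scale span_in_Ginf[OF complex_vector.span_zero] by blast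
  qed (use G DH.norm_eq_zero DH.norm_scale DH.norm_triangle in auto)
qed

sublocale G: complex_normed_space "Ginf E U"
  by (rule complex_normed_space_Ginf)

lemma Ginf_op: "\<mu> \<in> vcarrier (Ginf E U) \<Longrightarrow> \<mu> \<in> operators H complex_scalars"
  by (simp add: Ginf_iff)

lemma evaluation_Ginf: "x \<in> U \<Longrightarrow> evaluation E U x \<in> vcarrier (Ginf E U)"
  by (intro span_in_Ginf complex_vector.span_base) blast

text \<open>
  The vector \<open>y\<close> is the weak integral of \<open>f\<close> against \<open>\<mu>\<close>.
\<close>

definition represents :: "(('e \<Rightarrow> complex) \<Rightarrow> complex) \<Rightarrow> 'f \<Rightarrow> bool"
  where "represents \<mu> y \<longleftrightarrow> y \<in> vcarrier F \<and> (\<forall>\<phi>\<in>operators F complex_scalars. \<phi> y = \<mu> (\<lambda>x. \<phi> (f x)))"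

lemma represents_unique: "represents \<mu> y \<Longrightarrow> represents \<mu> z \<Longrightarrow> y = z"
  unfolding represents_def by (intro F.eq_if_functionals_eq) auto

lemma represents_0: "represents 0 0"
  by (auto simp: represents_def)

lemma represents_evaluation: "x \<in> U \<Longrightarrow> represents (evaluation E U x) (f x)"
  using HinfD(4)[OF f] by (auto simp: represents_def evaluation_eq comp_H)

lemma represents_add:
  assumes "represents \<mu> y" "represents \<nu> z" shows "represents (\<mu> + \<nu>) (y + z)"
  using assms unfolding represents_def by (auto simp: F.add_in) (metis operators_add)

lemma represents_scale:
  assumes "represents \<mu> y" shows "represents (a *\<^sub>C \<mu>) (a *\<^sub>C y)"
  using assms unfolding represents_def
  by (auto simp: F.scale_in functional_scale scaleC_fun_def scaleC_complex_def)

lemma represents_bound: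
  assumes r: "represents \<mu> y" and \<mu>: "\<mu> \<in> operators H complex_scalars"
  shows "vnorm F y \<le> vnorm (Hinf E U F) f * vnorm (dual H) \<mu>"
proof -
  have y: "y \<in> vcarrier F" using r by (simp add: represents_def)
  obtain \<phi> where \<phi>: "\<phi> \<in> F.dual_ball" "\<phi> y = of_real (vnorm F y)" using F.norming_functional[OF y] by blast
  note op = F.dual_ball_operators[OF \<phi>(1)]
  have "vnorm H (\<lambda>x. \<phi> (f x)) \<le> vnorm (Hinf E U F) f"
  proof (rule Hinf_norm_least)
    show "0 \<le> vnorm (Hinf E U F) f" by (rule Hinf_norm_nonneg[OF f])
    fix x assume x: "x \<in> U"
    have "cmod (\<phi> (f x)) \<le> vnorm F (f x)" using \<phi>(1) HinfD(4)[OF f x] by (simp add: F.dual_ball_def)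
    then show "vnorm complex_scalars (\<phi> (f x)) \<le> vnorm (Hinf E U F) f"
      using Hinf_norm_upper[OF f x] by simp
  qed
  moreover have "vnorm F y = cmod (\<mu> (\<lambda>x. \<phi> (f x)))"
    using r op \<phi>(2) F.norm_nonneg[OF y] by (metis abs_of_nonneg norm_of_real represents_def)
  moreover have "cmod (\<mu> (\<lambda>x. \<phi> (f x))) \<le> vnorm (dual H) \<mu> * vnorm H (\<lambda>x. \<phi> (f x))"
    by (rule H.dual_norm_upper[OF \<mu> comp_H[OF op]])
  moreover have "0 \<le> vnorm (dual H) \<mu>" using DH.norm_nonneg[of \<mu>] \<mu> by simp
  ultimately show ?thesis
    using mult_left_mono[of "vnorm H (\<lambda>x. \<phi> (f x))" "vnorm (Hinf E U F) f" "vnorm (dual H) \<mu>"]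
    by (simp add: mult.commute)
qed

text \<open>
  Representable functionals form a subspace that contains the evaluations, and it is closed: by
  \<open>represents_bound\<close> the vectors that represent an approximating sequence form a Cauchy sequence in \<open>F\<close>.
\<close>

lemma represents_ex:
  assumes \<mu>: "\<mu> \<in> vcarrier (Ginf E U)" shows "\<exists>y. represents \<mu> y"
proof -
  let ?S = "complex_vector.span (evaluation E U ` U)"
  define K where "K = vnorm (Hinf E U F) f + 1"
  have K: "K > 0" using Hinf_norm_nonneg[OF f] by (simp add: K_def)
  have bound: "vnorm F y \<le> K * vnorm (dual H) \<nu>" if "represents \<nu> y" "\<nu> \<in> vcarrier (dual H)" for \<nu> y
    using represents_bound[OF that(1)] that(2) DH.norm_nonneg[OF that(2)] by (simp add: K_def distrib_right)
  have span: "\<exists>y. represents \<nu> y" if "\<nu> \<in> ?S" for \<nu>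
    using that
  proof (induction rule: complex_vector.span_induct_alt)
    case base
    show ?case using represents_0 by blast
  next
    case (step c x y)
    then show ?case using represents_add represents_scale represents_evaluation by blast
  qed
  have S: "\<nu> \<in> vcarrier (dual H)" if "\<nu> \<in> ?S" for \<nu> using that evaluations_span by blast
  have \<mu>D: "\<mu> \<in> vcarrier (dual H)" using \<mu> by (simp add: Ginf_iff)
  have "\<forall>n. \<exists>\<nu>\<in>?S. vnorm (dual H) (\<mu> - \<nu>) < 1 / real (Suc n)" using \<mu> unfolding Ginf_iff by simp
  then obtain \<nu> where \<nu>: "\<And>n. \<nu> n \<in> ?S" "\<And>n. vnorm (dual H) (\<mu> - \<nu> n) < 1 / real (Suc n)" by metis
  obtain y where y: "\<And>n. represents (\<nu> n) (y n)" using span[OF \<nu>(1)] by metis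
  have yF: "y n \<in> vcarrier F" for n using y by (simp add: represents_def)
  have "\<exists>N. \<forall>m\<ge>N. \<forall>n\<ge>N. vnorm F (y m - y n) < e" if e: "e > 0" for e
  proof -
    obtain N where N: "inverse (real (Suc N)) < e / (2 * K)" using reals_Archimedean[of "e / (2 * K)"] e K by auto
    have "vnorm F (y m - y n) < e" if mn: "m \<ge> N" "n \<ge> N" for m n
    proof -
      have small: "vnorm (dual H) (\<mu> - \<nu> k) < e / (2 * K)" if "k \<ge> N" for k
      proof -
        have "1 / real (Suc k) \<le> 1 / real (Suc N)" using that by (intro divide_left_mono) auto
        then show ?thesis using \<nu>(2)[of k] N by (simp add: inverse_eq_divide)
      qed
      have d: "\<mu> - \<nu> k \<in> vcarrier (dual H)" for k by (rule DH.diff_in[OF \<mu>D S[OF \<nu>(1)]])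
      have "represents (\<nu> m + (-1) *\<^sub>C \<nu> n) (y m + (-1) *\<^sub>C y n)"
        by (intro represents_add represents_scale y)
      then have "represents (\<nu> m - \<nu> n) (y m - y n)" by simp
      then have "vnorm F (y m - y n) \<le> K * vnorm (dual H) (\<nu> m - \<nu> n)"
        by (rule bound) (intro DH.diff_in S \<nu>)
      also have "\<nu> m - \<nu> n = (\<mu> - \<nu> n) - (\<mu> - \<nu> m)" by simp
      also have "vnorm (dual H) \<dots> \<le> vnorm (dual H) (\<mu> - \<nu> n) + vnorm (dual H) (\<mu> - \<nu> m)"
        by (rule DH.norm_diff_triangle[OF d d])
      also have "\<dots> < e / K" using small[OF mn(1)] small[OF mn(2)] by (simp add: field_simps)
      finally show ?thesis using K by (simp add: field_simps)
    qed
    then show ?thesis by blast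
  qed
  then obtain z where z: "z \<in> vcarrier F" "(\<lambda>n. vnorm F (y n - z)) \<longlonglongrightarrow> 0"
    using F.Cauchy_limit[of y] yF by metis
  have "\<phi> z = \<mu> (\<lambda>x. \<phi> (f x))" if \<phi>: "\<phi> \<in> operators F complex_scalars" for \<phi>
  proof -
    let ?g = "\<lambda>x. \<phi> (f x)"
    obtain B where B: "B > 0" "\<And>v. v \<in> vcarrier F \<Longrightarrow> cmod (\<phi> v) \<le> B * vnorm F v"
      using functional_bounded[OF F.complex_normed_space_axioms \<phi>] by blast
    have "(\<lambda>n. \<phi> (y n)) \<longlonglongrightarrow> \<phi> z"
    proof (rule LIM_zero_cancel, rule Lim_null_comparison)
      show "(\<lambda>n. B * vnorm F (y n - z)) \<longlonglongrightarrow> 0" using tendsto_mult_right_zero[OF z(2)] .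
      show "\<forall>\<^sub>F n in sequentially. cmod (\<phi> (y n) - \<phi> z) \<le> B * vnorm F (y n - z)"
        using B(2)[OF F.diff_in[OF yF z(1)]] operators_diff[OF F.complex_normed_space_axioms \<phi> yF z(1)] by simp
    qed
    moreover have "(\<lambda>n. \<nu> n ?g) \<longlonglongrightarrow> \<mu> ?g"
    proof (rule LIM_zero_cancel, rule Lim_null_comparison)
      show "(\<lambda>n. 1 / real (Suc n) * vnorm H ?g) \<longlonglongrightarrow> 0"
        by (rule tendsto_mult_left_zero) (use LIMSEQ_inverse_real_of_nat in \<open>simp add: inverse_eq_divide\<close>)
      have "cmod (\<nu> n ?g - \<mu> ?g) \<le> 1 / real (Suc n) * vnorm H ?g" for n
      proof -
        have op: "\<mu> - \<nu> n \<in> operators H complex_scalars" using DH.diff_in[OF \<mu>D S[OF \<nu>(1)], of n] by simp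
        have "cmod (\<nu> n ?g - \<mu> ?g) = cmod ((\<mu> - \<nu> n) ?g)" by (simp add: norm_minus_commute)
        also have "\<dots> \<le> vnorm (dual H) (\<mu> - \<nu> n) * vnorm H ?g" by (rule H.dual_norm_upper[OF op comp_H[OF \<phi>]])
        also have "\<dots> \<le> 1 / real (Suc n) * vnorm H ?g"
          using \<nu>(2)[of n] Hinf_norm_nonneg[OF comp_H[OF \<phi>]] by (intro mult_right_mono) auto
        finally show ?thesis .
      qed
      then show "\<forall>\<^sub>F n in sequentially. cmod (\<nu> n ?g - \<mu> ?g) \<le> 1 / real (Suc n) * vnorm H ?g" by simp
    qed
    moreover have "\<phi> (y n) = \<nu> n ?g" for n using y[of n] \<phi> by (simp add: represents_def)
    ultimately show ?thesis using LIMSEQ_unique by simp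
  qed
  then have "represents \<mu> z" using z(1) by (simp add: represents_def)
  then show ?thesis by blast
qed

text \<open>
  This yields the uniqueness of the linearization: an operator with the prescribed values agrees with
  the representing vector on the span of the evaluations, and by continuity on its closure.
\<close>

lemma operator_represents:
  assumes T: "T \<in> operators (Ginf E U) F" "\<And>x. x \<in> U \<Longrightarrow> T (evaluation E U x) = f x"
    and \<mu>: "\<mu> \<in> vcarrier (Ginf E U)"
  shows "represents \<mu> (T \<mu>)"
proof -
  note G = G.complex_normed_space_axioms and F = F.complex_normed_space_axioms
  let ?S = "complex_vector.span (evaluation E U ` U)"
  have span: "represents \<nu> (T \<nu>)" if "\<nu> \<in> ?S" for \<nu>
  proof -
    have "\<nu> \<in> vcarrier (Ginf E U) \<and> represents \<nu> (T \<nu>)"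
      using that
    proof (induction rule: complex_vector.span_induct_alt)
      case base
      show ?case using represents_0 G.zero_in by (simp only: operators_0[OF T(1)] simp_thms)
    next
      case (step c v w)
      then obtain x where x: "x \<in> U" "v = evaluation E U x" by blast
      note v = evaluation_Ginf[OF x(1), folded x(2)]
      have "represents v (T v)" unfolding x(2) T(2)[OF x(1)] by (rule represents_evaluation[OF x(1)])
      then have "represents (c *\<^sub>C v + w) (c *\<^sub>C T v + T w)" using step by (intro represents_add represents_scale) auto
      moreover have "T (c *\<^sub>C v + w) = c *\<^sub>C T v + T w"
        using step v by (simp add: operators_add[OF T(1)] operators_scale[OF T(1)] G.scale_in)
      moreover have "c *\<^sub>C v + w \<in> vcarrier (Ginf E U)"
        using step v by (intro G.add_in G.scale_in) blast+
      ultimately show ?case by (simp only: simp_thms)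
    qed
    then show ?thesis by blast
  qed
  obtain y where y: "represents \<mu> y" using represents_ex[OF \<mu>] by blast
  obtain C where C: "C > 0" "\<And>\<nu>. \<nu> \<in> vcarrier (Ginf E U) \<Longrightarrow> vnorm F (T \<nu>) \<le> C * vnorm (dual H) \<nu>"
    using operators_bounded[OF G F T(1)] by auto
  define K where "K = C + vnorm (Hinf E U F) f"
  have K: "K > 0" using C(1) Hinf_norm_nonneg[OF f] by (simp add: K_def)
  have yF: "y \<in> vcarrier F" using y by (simp add: represents_def)
  have d: "T \<mu> - y \<in> vcarrier F" by (intro F.diff_in operators_in[OF G F T(1)] yF)
  have "vnorm F (T \<mu> - y) \<le> 0 + e" if e: "e > 0" for e
  proof -
    obtain \<nu> where \<nu>: "\<nu> \<in> ?S" "vnorm (dual H) (\<mu> - \<nu>) < e / K"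
      using \<mu> e K unfolding Ginf_iff by (meson divide_pos_pos)
    note nG = span_in_Ginf[OF \<nu>(1)]
    note dG = G.diff_in[OF \<mu> nG]
    have "represents (\<mu> + (-1) *\<^sub>C \<nu>) (y + (-1) *\<^sub>C T \<nu>)" by (intro represents_add represents_scale y span \<nu>)
    then have r: "represents (\<mu> - \<nu>) (y - T \<nu>)" by simp
    have eq: "T \<mu> - y = T (\<mu> - \<nu>) - (y - T \<nu>)" using operators_diff[OF G T(1) \<mu> nG] by simp
    have "vnorm F (T \<mu> - y) \<le> vnorm F (T (\<mu> - \<nu>)) + vnorm F (y - T \<nu>)"
      unfolding eq
      by (rule F.norm_diff_triangle[OF operators_in[OF G F T(1)] F.diff_in[OF yF operators_in[OF G F T(1)]]])
    also have "\<dots> \<le> K * vnorm (dual H) (\<mu> - \<nu>)"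
      using C(2)[OF dG] represents_bound[OF r Ginf_op[OF dG]] by (simp add: K_def distrib_right)
    also have "\<dots> \<le> e" using \<nu>(2) K by (simp add: field_simps)
    finally show ?thesis by simp
  qed
  then have "vnorm F (T \<mu> - y) \<le> 0" by (rule field_le_epsilon)
  then have "T \<mu> = y" using F.norm_nonneg[OF d] F.norm_eq_zero[OF d] by simp
  then show ?thesis using y by simp
qed

text \<open>
  Mujica's linearization theorem, with the weak description of \<open>T\<^sub>f\<close>.
\<close>

theorem linearization:
  shows "linearization E U F f \<in> operators (Ginf E U) F"
    and "x \<in> U \<Longrightarrow> linearization E U F f (evaluation E U x) = f x"
    and "\<mu> \<in> vcarrier (Ginf E U) \<Longrightarrow> represents \<mu> (linearization E U F f \<mu>)"
proof -
  note G = G.complex_normed_space_axioms and F = F.complex_normed_space_axioms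
  define T where "T \<mu> = (if \<mu> \<in> vcarrier (Ginf E U) then SOME y. represents \<mu> y else 0)" for \<mu>
  have T: "represents \<mu> (T \<mu>)" if "\<mu> \<in> vcarrier (Ginf E U)" for \<mu>
    using someI_ex[OF represents_ex[OF that]] that by (simp add: T_def)
  have T_eq: "T \<mu> = y" if "\<mu> \<in> vcarrier (Ginf E U)" "represents \<mu> y" for \<mu> y
    using represents_unique[OF T[OF that(1)] that(2)] .
  have op: "T \<in> operators (Ginf E U) F"
  proof (rule operatorsI[OF G F, where C = "vnorm (Hinf E U F) f"])
    show "T (\<mu> + \<nu>) = T \<mu> + T \<nu>" if "\<mu> \<in> vcarrier (Ginf E U)" "\<nu> \<in> vcarrier (Ginf E U)" for \<mu> \<nu>
      by (intro T_eq G.add_in represents_add T that)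
    show "T (a *\<^sub>C \<mu>) = a *\<^sub>C T \<mu>" if "\<mu> \<in> vcarrier (Ginf E U)" for a \<mu>
      by (intro T_eq G.scale_in represents_scale T that)
    show "T \<mu> \<in> vcarrier F" if "\<mu> \<in> vcarrier (Ginf E U)" for \<mu> using T[OF that] by (simp add: represents_def)
    show "vnorm F (T \<mu>) \<le> vnorm (Hinf E U F) f * vnorm (Ginf E U) \<mu>" if "\<mu> \<in> vcarrier (Ginf E U)" for \<mu>
      using represents_bound[OF T[OF that] Ginf_op[OF that]] by simp
  qed (simp add: T_def)
  have ev: "T (evaluation E U x) = f x" if "x \<in> U" for x
    by (rule T_eq[OF evaluation_Ginf[OF that] represents_evaluation[OF that]])
  have "linearization E U F f = T"
    unfolding linearization_def
  proof (rule the_equality)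
    fix T' assume T': "T' \<in> operators (Ginf E U) F \<and> (\<forall>x\<in>U. T' (evaluation E U x) = f x)"
    show "T' = T"
    proof
      fix \<mu>
      show "T' \<mu> = T \<mu>"
      proof (cases "\<mu> \<in> vcarrier (Ginf E U)")
        case True
        then show ?thesis using operator_represents[of T' \<mu>] T' T_eq by metis
      next
        case False
        then show ?thesis using T' by (simp add: T_def operators_off[of T' "Ginf E U" F])
      qed
    qed
  qed (use op ev in blast)
  then show "linearization E U F f \<in> operators (Ginf E U) F"
    "x \<in> U \<Longrightarrow> linearization E U F f (evaluation E U x) = f x"
    "\<mu> \<in> vcarrier (Ginf E U) \<Longrightarrow> represents \<mu> (linearization E U F f \<mu>)"
    using op ev T by auto
qed

section \<open>Rosenthal ranges and factorizations\<close>

sublocale R: bounded_subset F "f ` U" "vnorm (Hinf E U F) f"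
  by unfold_locales (use HinfD(4)[OF f] Hinf_norm_upper[OF f] Hinf_norm_nonneg[OF f] in auto)

text \<open>
  A functional \<open>\<phi>\<close> bounded by \<open>s\<close> on the range of \<open>f\<close> makes \<open>\<phi> \<circ> f\<close> an element of norm at most \<open>s\<close>,
  and its value at \<open>T\<^sub>f \<mu>\<close> is \<open>\<mu> (\<phi> \<circ> f)\<close>. Hence the image of the unit ball is absorbed by the range.
\<close>

lemma rosenthal_range_imp_operator:
  assumes "rosenthal_set F (f ` U)"
  shows "rosenthal_operator (Ginf E U) F (linearization E U F f)"
proof -
  let ?T = "linearization E U F f"
  let ?Y = "?T ` unit_ball (Ginf E U)"
  have "F.almost_absorbed (f ` U) ?Y"
    unfolding F.almost_absorbed_def F.near_hull_def
  proof (intro allI impI exI[of _ 1] ballI)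
    fix y \<phi> and e s t :: real
    assume e: "0 < e" and y: "y \<in> ?Y" and \<phi>: "\<phi> \<in> operators F complex_scalars" and s: "0 \<le> s" and t: "0 \<le> t"
      and sf: "\<forall>a\<in>f ` U. cmod (\<phi> a) \<le> s"
    obtain \<mu> where \<mu>: "\<mu> \<in> vcarrier (Ginf E U)" "vnorm (dual H) \<mu> \<le> 1" "y = ?T \<mu>"
      using y by (auto simp: unit_ball_def)
    have "cmod (\<phi> y) = cmod (\<mu> (\<lambda>x. \<phi> (f x)))"
      using linearization(3)[OF \<mu>(1)] \<phi> unfolding \<mu>(3) represents_def by simp
    also have "\<dots> \<le> vnorm (dual H) \<mu> * vnorm H (\<lambda>x. \<phi> (f x))"
      by (rule H.dual_norm_upper[OF Ginf_op[OF \<mu>(1)] comp_H[OF \<phi>]])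
    also have "\<dots> \<le> 1 * s"
      using Hinf_norm_least[OF s, of U complex_scalars "\<lambda>x. \<phi> (f x)" E] sf \<mu>(2) Hinf_norm_nonneg[OF comp_H[OF \<phi>]]
      by (intro mult_mono) auto
    finally show "cmod (\<phi> y) \<le> 1 * s + e * t" using e t by (simp add: add_increasing2)
  qed
  moreover have "?Y \<subseteq> vcarrier F"
    using operators_in[OF G.complex_normed_space_axioms F.complex_normed_space_axioms linearization(1)] by blast
  ultimately show ?thesis
    unfolding rosenthal_operator_def
    using linearization(1) F.rosenthal_set_almost_absorbed[OF assms R.A_bound] by blast
qed

lemma rosenthal_operator_imp_range:
  assumes "rosenthal_operator (Ginf E U) F (linearization E U F f)"
  shows "rosenthal_set F (f ` U)"
proof -
  let ?T = "linearization E U F f"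
  have "f x \<in> ?T ` unit_ball (Ginf E U)" if x: "x \<in> U" for x
    using linearization(2)[OF x] evaluation_Ginf[OF x] evaluation_dual(2)[OF x]
    by (intro image_eqI[of _ _ "evaluation E U x"]) (auto simp: unit_ball_def)
  then have "f ` U \<subseteq> ?T ` unit_ball (Ginf E U)" by blast
  then show ?thesis using assms unfolding rosenthal_operator_def rosenthal_set_def by (meson order_trans)
qed

text \<open>
  A functional \<open>\<phi>\<close> bounded by \<open>s\<close> on the range of \<open>f\<close> turns \<open>f\<close> into a scalar function bounded by
  \<open>s\<close>, so the Cauchy estimates bound \<open>\<phi>\<close> at the derivative and at the remainder by multiples of \<open>s\<close>.
  This is the hypothesis of \<open>dominated_in_interp\<close>: the derivative of \<open>f\<close> in \<open>F\<close> takes its values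
  in the interpolation space, and is the derivative there as well.
\<close>

lemma holomorphic_into_interp: "f \<in> vcarrier (Hinf E U R.interp)"
proof -
  note E = E.complex_normed_space_axioms and F = F.complex_normed_space_axioms
    and I = R.complex_normed_space_interp
  interpret I: complex_normed_space R.interp by (rule I)
  have fU: "f ` U \<subseteq> vcarrier F" using HinfD(4)[OF f] by blast
  have UE: "U \<subseteq> vcarrier E" using open_U unfolding E.openin_vtopology by auto
  have fI: "f x \<in> vcarrier R.interp \<and> vnorm R.interp (f x) \<le> 1" if "x \<in> U" for x
    using R.dominated_in_interp[of "f x" 1] fU that by auto
  have "\<exists>D. frechet E R.interp f x D" if x: "x \<in> U" for x
  proof -
    obtain D where fr: "frechet E F f x D"
      using HinfD(1)[OF f] x unfolding holomorphic_map_iff_frechet[OF E F open_U] by blast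
    then have D: "D \<in> operators E F" by (simp add: frechet_def)
    obtain r where r: "r > 0" "\<And>y. y \<in> vcarrier E \<Longrightarrow> vnorm E (y - x) < r \<Longrightarrow> y \<in> U"
      using open_U x unfolding E.openin_vtopology by blast
    have est: "cmod (\<phi> (D v)) \<le> 2 * vnorm E v / r * s"
      "vnorm E v \<le> r / 4 \<Longrightarrow> cmod (\<phi> (f (x + v) - f x - D v)) \<le> 8 * (vnorm E v)\<^sup>2 / r\<^sup>2 * s"
      if v: "v \<in> vcarrier E" and \<phi>: "\<phi> \<in> operators F complex_scalars" and s: "\<And>a. a \<in> f ` U \<Longrightarrow> cmod (\<phi> a) \<le> s"
      for v \<phi> s
    proof -
      note ce = Cauchy_estimates[OF E open_U HinfD(1)[OF comp_H[OF \<phi>]] _ x r(1) _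
          frechet_functional_comp[OF E F open_U fU x fr \<phi>] v, of s]
      show "cmod (\<phi> (D v)) \<le> 2 * vnorm E v / r * s" by (rule ce(1)) (use s r(2) in blast)+
      assume small: "vnorm E v \<le> r / 4"
      then have "x + v \<in> U" using r E.add_in[OF _ v, of x] x UE by (intro r(2)) auto
      then have fin: "f (x + v) \<in> vcarrier F" "f x \<in> vcarrier F" using fU x by auto
      have "\<phi> (f (x + v) - f x - D v) = \<phi> (f (x + v)) - \<phi> (f x) - \<phi> (D v)"
        using operators_diff[OF F \<phi> F.diff_in[OF fin] operators_in[OF E F D]] operators_diff[OF F \<phi> fin] by simp
      moreover have "cmod (\<phi> (f (x + v)) - \<phi> (f x) - \<phi> (D v)) \<le> 8 * (vnorm E v)\<^sup>2 / r\<^sup>2 * s"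
        by (rule ce(2)) (use s r(2) small in blast)+
      ultimately show "cmod (\<phi> (f (x + v) - f x - D v)) \<le> 8 * (vnorm E v)\<^sup>2 / r\<^sup>2 * s" by simp
    qed
    have DI: "D v \<in> vcarrier R.interp \<and> vnorm R.interp (D v) \<le> 2 / r * vnorm E v" if v: "v \<in> vcarrier E" for v
      using R.dominated_in_interp[OF operators_in[OF E F D, of v], of "2 * vnorm E v / r"] est(1)[OF v]
        E.norm_nonneg[OF v] r(1) by simp
    have "frechet E R.interp f x D"
      unfolding frechet_def
    proof (intro conjI allI impI)
      show "D \<in> operators E R.interp"
        by (rule operatorsI[OF E I, where C = "2 / r"])
          (use DI in \<open>simp_all add: operators_add[OF D] operators_scale[OF D] operators_off[OF D]\<close>)
      fix e :: real assume e: "e > 0"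
      define d where "d = min (r / 4) (e * r\<^sup>2 / 8)"
      have "vnorm R.interp (f (x + v) - f x - D v) \<le> e * vnorm E v" if v: "v \<in> vcarrier E" "vnorm E v < d" for v
      proof -
        have small: "vnorm E v \<le> r / 4" using v(2) by (simp add: d_def)
        then have "x + v \<in> U" using r E.add_in[OF _ v(1), of x] x UE by (intro r(2)) auto
        then have fin: "f (x + v) - f x - D v \<in> vcarrier F"
          using fU x operators_in[OF E F D] by (intro F.diff_in) auto
        have "vnorm R.interp (f (x + v) - f x - D v) \<le> 8 * (vnorm E v)\<^sup>2 / r\<^sup>2"
          by (rule R.dominated_in_interp(2)[OF fin]) (use est(2)[OF v(1) _ _ small] in auto)
        also have "\<dots> = (8 * vnorm E v / r\<^sup>2) * vnorm E v" by (simp add: power2_eq_square)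
        also have "\<dots> \<le> e * vnorm E v"
          using v(2) r(1) E.norm_nonneg[OF v(1)] by (intro mult_right_mono) (auto simp: d_def divide_le_eq)
        finally show ?thesis .
      qed
      moreover have "d > 0" using r(1) e by (simp add: d_def)
      ultimately show "\<exists>d>0. \<forall>v\<in>vcarrier E. vnorm E v < d \<longrightarrow>
          vnorm R.interp (f (x + v) - f x - D v) \<le> e * vnorm E v" by blast
    qed
    then show ?thesis by blast
  qed
  then have "holomorphic_map E U R.interp f"
    unfolding holomorphic_map_iff_frechet[OF E I open_U] using fI by blast
  then show ?thesis using fI HinfD(3)[OF f] unfolding Hinf_def by auto
qed

lemma rosenthal_range_imp_factorization:
  assumes "rosenthal_set F (f ` U)"
  shows "factors_without_ell1 E U F f R.interp"
  unfolding factors_without_ell1_def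
proof (intro conjI)
  show "complex_banach_space R.interp" by (rule R.complex_banach_space_interp)
  show "\<not> contains_isomorphic_copy R.interp ell1" by (rule R.interp_not_contains_ell1[OF assms])
  show "\<exists>T\<in>operators R.interp F. \<exists>g\<in>vcarrier (Hinf E U R.interp). \<forall>x\<in>U. f x = T (g x)"
    using R.interp_inclusion holomorphic_into_interp HinfD(4)[OF holomorphic_into_interp]
    by (intro bexI[of _ "\<lambda>x. if x \<in> vcarrier R.interp then x else 0"] bexI[of _ f]) auto
qed

text \<open>
  By Rosenthal's theorem every bounded sequence of a Banach space without a copy of \<open>ell1\<close> has a weakly
  Cauchy subsequence, and operators preserve weakly Cauchy sequences.
\<close>

lemma factorization_imp_rosenthal_range:
  assumes "factors_without_ell1 E U F f G"
  shows "rosenthal_set F (f ` U)"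
proof -
  obtain T g where G: "complex_banach_space G" "\<not> contains_isomorphic_copy G ell1"
    and T: "T \<in> operators G F" and g: "g \<in> vcarrier (Hinf E U G)" and fg: "\<And>x. x \<in> U \<Longrightarrow> f x = T (g x)"
    using assms unfolding factors_without_ell1_def by blast
  interpret Z: complex_banach_space G by (rule G(1))
  note ax = Z.complex_normed_space_axioms F.complex_normed_space_axioms
  show ?thesis
    unfolding rosenthal_set_def
  proof (intro conjI allI impI)
    show "f ` U \<subseteq> vcarrier F" by (rule R.A_in)
    fix s :: "nat \<Rightarrow> 'f" assume "range s \<subseteq> f ` U"
    then have "\<forall>n. \<exists>x\<in>U. s n = f x" by blast
    then obtain x where x: "\<And>n. x n \<in> U" "\<And>n. s n = f (x n)" by metis
    obtain r :: "nat \<Rightarrow> nat" where r: "strict_mono r"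
      "weakly_Cauchy G ((\<lambda>n. g (x n)) \<circ> r) \<or> ell1_sequence G ((\<lambda>n. g (x n)) \<circ> r)"
      using Z.Rosenthal_ell1_dichotomy[of "\<lambda>n. g (x n)"] HinfD(4)[OF g x(1)] Hinf_norm_upper[OF g x(1)] by blast
    then have wC: "weakly_Cauchy G ((\<lambda>n. g (x n)) \<circ> r)"
      using Z.ell1_sequence_imp_contains_ell1 G(2) by blast
    have "weakly_Cauchy F (s \<circ> r)"
    proof (rule F.weakly_CauchyI)
      show "(s \<circ> r) n \<in> vcarrier F" for n using x HinfD(4)[OF f] by simp
      fix \<phi> assume "\<phi> \<in> F.dual_ball"
      from Z.weakly_CauchyD[OF wC functional_comp[OF ax T F.dual_ball_operators[OF this]]]
      show "Cauchy (\<lambda>n. \<phi> ((s \<circ> r) n))" by (simp add: x fg)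
    qed
    then show "\<exists>r::nat \<Rightarrow> nat. strict_mono r \<and> weakly_Cauchy F (s \<circ> r)" using r(1) by blast
  qed
qed

end

theorem theorem2p9:
  fixes E :: "'e::complex_vector nspace"
    and F :: "'f::complex_vector nspace"
    and U :: "'e set"
    and f :: "'e \<Rightarrow> 'f"
  assumes "complex_banach_space E"
    and "complex_banach_space F"
    and "openin (vtopology E) U"
    and "f \<in> vcarrier (Hinf E U F)"
  shows "(rosenthal_set F (f ` U) \<longleftrightarrow> rosenthal_operator (Ginf E U) F (linearization E U F f)) \<and>
    (rosenthal_set F (f ` U) \<longleftrightarrow> (\<exists>G :: 'f nspace. factors_without_ell1 E U F f G)) \<and>
    (\<forall>G :: 'g::complex_vector nspace.
       factors_without_ell1 E U F f G \<longrightarrow> rosenthal_set F (f ` U))"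
proof -
  interpret E: complex_banach_space E by fact
  interpret F: complex_banach_space F by fact
  interpret bounded_holomorphic E F U f by unfold_locales (fact assms)+
  show ?thesis
  proof (intro conjI allI impI iffI)
    show "\<exists>G :: 'f nspace. factors_without_ell1 E U F f G" if "rosenthal_set F (f ` U)"
      using rosenthal_range_imp_factorization[OF that] by blast
    show "rosenthal_set F (f ` U)" if "\<exists>G :: 'f nspace. factors_without_ell1 E U F f G"
      using that factorization_imp_rosenthal_range by blast
    show "rosenthal_set F (f ` U)" if "factors_without_ell1 E U F f G" for G :: "'g nspace"
      by (rule factorization_imp_rosenthal_range[OF that])
  qed (fact rosenthal_range_imp_operator rosenthal_operator_imp_range)+
qed

end
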